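(* Let $H$ be a $d$-dimensional semisimple Hopf algebra over an algebraically closed field $k$ of characteristic $0$, with irreducible characters $\chi_i$ of degrees $d_i$. Let $\Lambda^1,\Lambda^2$ be two copies of the idempotent integral $\Lambda$ of $H$, let $z_2=\sum\Lambda^1_1\Lambda^2_1S(\Lambda^1_2)S(\Lambda^2_2)$, and let $f_{rob}=\sum_i\frac{d}{d_i}\chi_i$. Then $$d\,\Psi(z_2)=f_{rob},$$ where $\Psi:H\to H^*$ is the Frobenius map.
   Context: $H$ has comultiplication $\Delta(h)=\sum h_1\otimes h_2$ (Sweedler notation), counit $\varepsilon$ and antipode $S$. The idempotent integral $\Lambda$ satisfies $h\Lambda=\varepsilon(h)\Lambda=\Lambda h$ for all $h\in H$ and $\varepsilon(\Lambda)=1$. $\lambda=\chi_H=\sum_i d_i\chi_i$ is the character of the left regular representation (the integral of $H^*$ with $\langle\lambda,\Lambda\rangle=1$). For $p\in H^*$, $a\in H$, $\langle p\leftharpoonup a,a'\rangle=\langle p,aa'\rangle$. The Frobenius map is $\Psi(h)=\lambda\leftharpoonup S(h)$. *)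

theory Defs
  imports
    "HOL-Library.Poly_Mapping"
    "HOL-Computational_Algebra.Computational_Algebra"
    "Jordan_Normal_Form.Matrix"
begin

section \<open>Tensor powers\<close>

text \<open>
  Elements of \<open>H \<otimes> H\<close> are written as formal sums of simple tensors, i.e. as lists of pairs
  (scalars are absorbed into a tensor factor). Two lists denote the same tensor when their
  difference in the free abelian group on \<open>H \<times> H\<close> lies in the subgroup generated by the
  usual relations of the tensor product over \<open>k\<close>; similarly for \<open>H \<otimes> H \<otimes> H\<close>.
\<close>

definition formal_sum :: "'a list \<Rightarrow> 'a \<Rightarrow>\<^sub>0 int" where
  "formal_sum xs = sum_list (map frag_of xs)"

definition tensor2_relations ::
    "('k \<Rightarrow> 'h::ab_group_add \<Rightarrow> 'h) \<Rightarrow> ('h \<times> 'h \<Rightarrow>\<^sub>0 int) set" where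
  "tensor2_relations scale =
     {frag_of (a + a', b) - frag_of (a, b) - frag_of (a', b) | a a' b. True}
   \<union> {frag_of (a, b + b') - frag_of (a, b) - frag_of (a, b') | a b b'. True}
   \<union> {frag_of (scale c a, b) - frag_of (a, scale c b) | c a b. True}"

definition tensor2_eq ::
    "('k \<Rightarrow> 'h::ab_group_add \<Rightarrow> 'h) \<Rightarrow> ('h \<times> 'h) list \<Rightarrow> ('h \<times> 'h) list \<Rightarrow> bool" where
  "tensor2_eq scale xs ys \<longleftrightarrow>
     formal_sum xs - formal_sum ys \<in> group_closure (tensor2_relations scale)"

definition tensor3_relations ::
    "('k \<Rightarrow> 'h::ab_group_add \<Rightarrow> 'h) \<Rightarrow> ('h \<times> 'h \<times> 'h \<Rightarrow>\<^sub>0 int) set" where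
  "tensor3_relations scale =
     {frag_of (a + a', b, c) - frag_of (a, b, c) - frag_of (a', b, c) | a a' b c. True}
   \<union> {frag_of (a, b + b', c) - frag_of (a, b, c) - frag_of (a, b', c) | a b b' c. True}
   \<union> {frag_of (a, b, c + c') - frag_of (a, b, c) - frag_of (a, b, c') | a b c c'. True}
   \<union> {frag_of (scale r a, b, c) - frag_of (a, scale r b, c) | r a b c. True}
   \<union> {frag_of (a, scale r b, c) - frag_of (a, b, scale r c) | r a b c. True}"

definition tensor3_eq ::
    "('k \<Rightarrow> 'h::ab_group_add \<Rightarrow> 'h) \<Rightarrow> ('h \<times> 'h \<times> 'h) list \<Rightarrow> ('h \<times> 'h \<times> 'h) list \<Rightarrow> bool" where
  "tensor3_eq scale xs ys \<longleftrightarrow>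
     formal_sum xs - formal_sum ys \<in> group_closure (tensor3_relations scale)"


section \<open>Hopf algebras\<close>

locale unital_algebra = vector_space scale
  for scale :: "'k::field \<Rightarrow> 'h::ring_1 \<Rightarrow> 'h" +
  assumes scale_mult_left: "scale c x * y = scale c (x * y)"
    and scale_mult_right: "x * scale c y = scale c (x * y)"

text \<open>
  \<open>\<Delta> h\<close> is an arbitrary representative \<open>[(h\<^sub>1, h\<^sub>2), \<dots>]\<close> of the comultiplication of \<open>h\<close>, so that
  a Sweedler sum \<open>\<Sum> F h\<^sub>1 h\<^sub>2\<close> is the list sum \<open>\<Sum>(h1, h2)\<leftarrow>\<Delta> h. F h1 h2\<close>.
  All axioms on \<open>\<Delta>\<close> are equalities of tensors, not of representatives.
\<close>

locale hopf_algebra = unital_algebra scale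
  for scale :: "'k::field \<Rightarrow> 'h::ring_1 \<Rightarrow> 'h"
    and \<Delta> :: "'h \<Rightarrow> ('h \<times> 'h) list"
    and \<epsilon> :: "'h \<Rightarrow> 'k"
    and S :: "'h \<Rightarrow> 'h" +
  assumes comult_add: "tensor2_eq scale (\<Delta> (x + y)) (\<Delta> x @ \<Delta> y)"
    and comult_scale: "tensor2_eq scale (\<Delta> (scale c x)) [(scale c a, b). (a, b) \<leftarrow> \<Delta> x]"
    and counit_linear: "Vector_Spaces.linear scale (*) \<epsilon>"
    and coassoc: "tensor3_eq scale
          [(a1, a2, b). (a, b) \<leftarrow> \<Delta> x, (a1, a2) \<leftarrow> \<Delta> a]
          [(a, b1, b2). (a, b) \<leftarrow> \<Delta> x, (b1, b2) \<leftarrow> \<Delta> b]"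
    and counit_left: "(\<Sum>(a, b)\<leftarrow>\<Delta> x. scale (\<epsilon> a) b) = x"
    and counit_right: "(\<Sum>(a, b)\<leftarrow>\<Delta> x. scale (\<epsilon> b) a) = x"
    and comult_one: "tensor2_eq scale (\<Delta> 1) [(1, 1)]"
    and comult_mult: "tensor2_eq scale (\<Delta> (x * y))
          [(a * a', b * b'). (a, b) \<leftarrow> \<Delta> x, (a', b') \<leftarrow> \<Delta> y]"
    and counit_one: "\<epsilon> 1 = 1"
    and counit_mult: "\<epsilon> (x * y) = \<epsilon> x * \<epsilon> y"
    and antipode_linear: "Vector_Spaces.linear scale scale S"
    and antipode_left: "(\<Sum>(a, b)\<leftarrow>\<Delta> x. S a * b) = scale (\<epsilon> x) 1"
    and antipode_right: "(\<Sum>(a, b)\<leftarrow>\<Delta> x. a * S b) = scale (\<epsilon> x) 1"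

definition idempotent_integral ::
    "('k::field \<Rightarrow> 'h::ring_1 \<Rightarrow> 'h) \<Rightarrow> ('h \<Rightarrow> 'k) \<Rightarrow> 'h \<Rightarrow> bool" where
  "idempotent_integral scale \<epsilon> \<Lambda> \<longleftrightarrow>
     (\<forall>h. h * \<Lambda> = scale (\<epsilon> h) \<Lambda> \<and> \<Lambda> * h = scale (\<epsilon> h) \<Lambda>) \<and> \<epsilon> \<Lambda> = 1"


section \<open>Semisimplicity\<close>

definition left_ideal :: "'h::ring_1 set \<Rightarrow> bool" where
  "left_ideal L \<longleftrightarrow> 0 \<in> L \<and> (\<forall>x\<in>L. \<forall>y\<in>L. x + y \<in> L) \<and> (\<forall>a. \<forall>x\<in>L. a * x \<in> L)"

text \<open>Complete reducibility of the left regular module.\<close>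

definition semisimple_ring :: "'h::ring_1 itself \<Rightarrow> bool" where
  "semisimple_ring _ \<longleftrightarrow>
     (\<forall>L :: 'h set. left_ideal L \<longrightarrow>
        (\<exists>M. left_ideal M \<and> L \<inter> M = {0} \<and> {x + y | x y. x \<in> L \<and> y \<in> M} = UNIV))"


section \<open>Representations and characters\<close>

definition matrix_rep ::
    "('k::field \<Rightarrow> 'h::ring_1 \<Rightarrow> 'h) \<Rightarrow> nat \<Rightarrow> ('h \<Rightarrow> 'k mat) \<Rightarrow> bool" where
  "matrix_rep scale n \<rho> \<longleftrightarrow>
     (\<forall>a. \<rho> a \<in> carrier_mat n n) \<and>
     (\<forall>a b. \<rho> (a + b) = \<rho> a + \<rho> b) \<and>
     (\<forall>c a. \<rho> (scale c a) = c \<cdot>\<^sub>m \<rho> a) \<and>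
     (\<forall>a b. \<rho> (a * b) = \<rho> a * \<rho> b) \<and>
     \<rho> 1 = 1\<^sub>m n"

definition invariant_subspace ::
    "nat \<Rightarrow> ('h \<Rightarrow> 'k::field mat) \<Rightarrow> 'k vec set \<Rightarrow> bool" where
  "invariant_subspace n \<rho> W \<longleftrightarrow>
     W \<subseteq> carrier_vec n \<and> 0\<^sub>v n \<in> W \<and>
     (\<forall>v\<in>W. \<forall>w\<in>W. v + w \<in> W) \<and>
     (\<forall>c. \<forall>v\<in>W. c \<cdot>\<^sub>v v \<in> W) \<and>
     (\<forall>a. \<forall>v\<in>W. \<rho> a *\<^sub>v v \<in> W)"

definition irreducible_rep ::
    "('k::field \<Rightarrow> 'h::ring_1 \<Rightarrow> 'h) \<Rightarrow> nat \<Rightarrow> ('h \<Rightarrow> 'k mat) \<Rightarrow> bool" where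
  "irreducible_rep scale n \<rho> \<longleftrightarrow>
     matrix_rep scale n \<rho> \<and> n > 0 \<and>
     (\<forall>W. invariant_subspace n \<rho> W \<longrightarrow> W = {0\<^sub>v n} \<or> W = carrier_vec n)"

definition equivalent_reps ::
    "nat \<Rightarrow> ('h \<Rightarrow> 'k::field mat) \<Rightarrow> nat \<Rightarrow> ('h \<Rightarrow> 'k mat) \<Rightarrow> bool" where
  "equivalent_reps n \<rho> m \<sigma> \<longleftrightarrow>
     n = m \<and> (\<exists>P\<in>carrier_mat n n. invertible_mat P \<and> (\<forall>a. P * \<rho> a = \<sigma> a * P))"

text \<open>
  A full set of representatives of the equivalence classes of irreducible representations,
  \<open>\<rho> i\<close> having degree \<open>deg i\<close>.
\<close>

definition complete_irreps ::
    "('k::field \<Rightarrow> 'h::ring_1 \<Rightarrow> 'h) \<Rightarrow> 'i set \<Rightarrow> ('i \<Rightarrow> nat) \<Rightarrow> ('i \<Rightarrow> 'h \<Rightarrow> 'k mat) \<Rightarrow> bool" where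
  "complete_irreps scale I deg \<rho> \<longleftrightarrow>
     (\<forall>i\<in>I. irreducible_rep scale (deg i) (\<rho> i)) \<and>
     (\<forall>i\<in>I. \<forall>j\<in>I. equivalent_reps (deg i) (\<rho> i) (deg j) (\<rho> j) \<longrightarrow> i = j) \<and>
     (\<forall>n \<sigma>. irreducible_rep scale n \<sigma> \<longrightarrow>
        (\<exists>i\<in>I. equivalent_reps n \<sigma> (deg i) (\<rho> i)))"

definition character :: "('h \<Rightarrow> 'k::field mat) \<Rightarrow> 'h \<Rightarrow> 'k" where
  "character \<rho> a = (\<Sum>j<dim_row (\<rho> a). \<rho> a $$ (j, j))"

text \<open>Trace of a linear endomorphism, computed in the finite basis \<open>B\<close>.\<close>

definition linear_trace ::
    "('k::field \<Rightarrow> 'h::ab_group_add \<Rightarrow> 'h) \<Rightarrow> 'h set \<Rightarrow> ('h \<Rightarrow> 'h) \<Rightarrow> 'k" where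
  "linear_trace scale B f = (\<Sum>b\<in>B. module.representation scale B (f b) b)"

definition regular_character ::
    "('k::field \<Rightarrow> 'h::ring_1 \<Rightarrow> 'h) \<Rightarrow> 'h set \<Rightarrow> 'h \<Rightarrow> 'k" where
  "regular_character scale B a = linear_trace scale B (\<lambda>x. a * x)"


section \<open>The Frobenius map, commutator element and Frobenius function\<close>

definition right_act :: "('h::ring_1 \<Rightarrow> 'k) \<Rightarrow> 'h \<Rightarrow> ('h \<Rightarrow> 'k)" (infixl \<open>\<leftharpoonup>\<close> 70) where
  "p \<leftharpoonup> a = (\<lambda>a'. p (a * a'))"

definition frobenius_map ::
    "('k::field \<Rightarrow> 'h::ring_1 \<Rightarrow> 'h) \<Rightarrow> 'h set \<Rightarrow> ('h \<Rightarrow> 'h) \<Rightarrow> 'h \<Rightarrow> ('h \<Rightarrow> 'k)" where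
  "frobenius_map scale B S h = regular_character scale B \<leftharpoonup> S h"

definition z2 :: "('h::ring_1 \<Rightarrow> ('h \<times> 'h) list) \<Rightarrow> ('h \<Rightarrow> 'h) \<Rightarrow> 'h \<Rightarrow> 'h" where
  "z2 \<Delta> S \<Lambda> = (\<Sum>(a1, a2)\<leftarrow>\<Delta> \<Lambda>. \<Sum>(b1, b2)\<leftarrow>\<Delta> \<Lambda>. a1 * b1 * S a2 * S b2)"

definition f_rob ::
    "nat \<Rightarrow> 'i set \<Rightarrow> ('i \<Rightarrow> nat) \<Rightarrow> ('i \<Rightarrow> 'h \<Rightarrow> 'k::field mat) \<Rightarrow> ('h \<Rightarrow> 'k)" where
  "f_rob d I deg \<rho> = (\<lambda>a. \<Sum>i\<in>I. of_nat d / of_nat (deg i) * character (\<rho> i) a)"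

end

theory Submission
  imports Defs "Jordan_Normal_Form.Char_Poly"
begin

text \<open>
  Write \<open>E(x) = \<Sum> \<Lambda>\<^sub>1 x S(\<Lambda>\<^sub>2)\<close> for the projection onto the centre, so that
  \<open>z\<^sub>2 = \<Sum> E(\<Lambda>\<^sub>1) S(\<Lambda>\<^sub>2)\<close>. The legs of \<open>\<Sum> \<Lambda>\<^sub>1 \<otimes> S(\<Lambda>\<^sub>2)\<close> are dual bases for the form \<open>\<lambda>(x y)\<close>, where \<open>\<lambda>\<close> is
  the character of the regular representation (\<open>dual_basis\<close>). Hence \<open>\<lambda>(S(z\<^sub>2) a)\<close> is the trace of
  the endomorphism \<open>x \<mapsto> E(x) a\<close> (\<open>chi_z2\<close>). By Schur orthogonality \<open>E\<close> sends the matrix unit \<open>e\<^sub>p\<^sub>q\<close> of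
  the block \<open>i\<close> to \<open>\<delta>\<^sub>p\<^sub>q / d\<^sub>i\<close> times the unit of that block, so this trace is \<open>\<Sum>\<^sub>i \<chi>\<^sub>i(a) / d\<^sub>i\<close>
  (\<open>Tr_center_proj\<close>).

  This uses that \<open>\<lambda>\<close> is an integral of the dual and that \<open>E\<close> has the stated form, both of which rest
  on the theorem of Larson and Radford that \<open>S\<^sup>2 = 1\<close> in characteristic \<open>0\<close>
  (\<open>antipode_involutive\<close>). Most of the text proves it. The right integral of the dual is
  \<open>x \<mapsto> Tr(y \<mapsto> x S\<^sup>2 y)\<close> and the left integral is \<open>x \<mapsto> Tr(y \<mapsto> S\<^sup>2(y) x)\<close>; their value at \<open>1\<close> is the trace of
  \<open>S\<^sup>2\<close>. If this trace is nonzero, the two integrals agree, which forces \<open>S\<^sup>4 = 1\<close>; an integrality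
  argument with the idempotent \<open>\<lambda> / d\<close> of the dual then yields \<open>S\<^sup>2 = 1\<close>
  (\<open>antipode_involutive_if_trace_nonzero\<close>).

  That the trace is nonzero is a positivity statement. On the block \<open>i\<close> the map \<open>S\<^sup>2\<close> is conjugation
  by a matrix \<open>W\<^sub>i\<close> of trace \<open>1\<close>, and with \<open>q\<^sub>i = tr(W\<^sub>i\<^sup>-\<^sup>1)\<close> the trace of \<open>S\<^sup>2\<close> is \<open>\<Sum>\<^sub>i q\<^sub>i\<close>. The matrix
  \<open>q\<^sub>i W\<^sub>i\<^sup>2\<close> represents a group-like element that is independent of \<open>i\<close>, and integrals vanish at
  group-like elements other than \<open>1\<close>. If the trace of \<open>S\<^sup>2\<close> were zero, this would make certain odd
  power sums of the eigenvalues of the \<open>W\<^sub>i\<close> orthogonal to their traces. A rational linear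
  functional on the field, interpolated on the eigenvalues by an odd polynomial, turns this into
  a vanishing sum of squares of rationals (\<open>odd_power_sums_orthogonal_imp_zero\<close>).
\<close>

section \<open>Evaluating formal sums of tensors\<close>

text \<open>
  The homomorphism from the free abelian group into a ring that extends \<open>f\<close>. A ring as target
  supplies integer multiples, and both \<open>H\<close> and the scalars are rings.
\<close>

definition zsum :: "('a \<Rightarrow> 'w::ring_1) \<Rightarrow> ('a \<Rightarrow>\<^sub>0 int) \<Rightarrow> 'w" where
  "zsum f x = (\<Sum>i\<in>Poly_Mapping.keys x. of_int (Poly_Mapping.lookup x i) * f i)"

lemma zsum_superset:
  assumes "finite A" "Poly_Mapping.keys x \<subseteq> A"
  shows "zsum f x = (\<Sum>i\<in>A. of_int (Poly_Mapping.lookup x i) * f i)"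
  unfolding zsum_def using assms
  by (intro sum.mono_neutral_left) (auto simp: in_keys_iff)

lemma zsum_diff: "zsum f (x - y) = zsum f x - zsum f y"
proof -
  let ?A = "Poly_Mapping.keys x \<union> Poly_Mapping.keys y \<union> Poly_Mapping.keys (x - y)"
  have "zsum f z = (\<Sum>i\<in>?A. of_int (Poly_Mapping.lookup z i) * f i)" if "z \<in> {x, y, x - y}" for z
    using that by (intro zsum_superset) auto
  then show ?thesis
    by (simp add: lookup_minus sum_subtractf left_diff_distrib)
qed

lemma zsum_zero [simp]: "zsum f 0 = 0"
  by (simp add: zsum_def)

lemma zsum_add: "zsum f (x + y) = zsum f x + zsum f y"
  using zsum_diff[of f "x + y" y] by (simp add: algebra_simps)

lemma zsum_frag_of [simp]: "zsum f (frag_of a) = f a"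
  by (simp add: zsum_def)

lemma zsum_formal_sum: "zsum f (formal_sum xs) = (\<Sum>x\<leftarrow>xs. f x)"
  unfolding formal_sum_def by (induction xs) (simp_all add: zsum_add)

text \<open>
  Universal property: a map that kills the defining relations of a tensor product takes equal
  values on two lists that represent the same tensor.
\<close>

lemma sum_list_eq_if_group_closure:
  assumes "formal_sum xs - formal_sum ys \<in> group_closure R"
    and "\<And>r. r \<in> R \<Longrightarrow> zsum f r = 0"
  shows "(\<Sum>x\<leftarrow>xs. f x) = (\<Sum>x\<leftarrow>ys. f x)"
proof -
  have "zsum f z = 0" if "z \<in> group_closure R" for z
    using that by induction (auto simp: assms(2) zsum_diff)
  from this[OF assms(1)] show ?thesis
    by (simp add: zsum_diff zsum_formal_sum)
qed

definition balanced2 :: "('k \<Rightarrow> 'h::ab_group_add \<Rightarrow> 'h) \<Rightarrow> ('h \<Rightarrow> 'h \<Rightarrow> 'w::ring_1) \<Rightarrow> bool" where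
  "balanced2 scale F \<longleftrightarrow>
     (\<forall>a a' b. F (a + a') b = F a b + F a' b) \<and>
     (\<forall>a b b'. F a (b + b') = F a b + F a b') \<and>
     (\<forall>c a b. F (scale c a) b = F a (scale c b))"

definition balanced3 :: "('k \<Rightarrow> 'h::ab_group_add \<Rightarrow> 'h) \<Rightarrow> ('h \<Rightarrow> 'h \<Rightarrow> 'h \<Rightarrow> 'w::ring_1) \<Rightarrow> bool" where
  "balanced3 scale F \<longleftrightarrow>
     (\<forall>a a' b c. F (a + a') b c = F a b c + F a' b c) \<and>
     (\<forall>a b b' c. F a (b + b') c = F a b c + F a b' c) \<and>
     (\<forall>a b c c'. F a b (c + c') = F a b c + F a b c') \<and>
     (\<forall>r a b c. F (scale r a) b c = F a (scale r b) c) \<and>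
     (\<forall>r a b c. F a (scale r b) c = F a b (scale r c))"

lemma tensor2_eq_sum:
  assumes "tensor2_eq scale xs ys" "balanced2 scale F"
  shows "(\<Sum>(a, b)\<leftarrow>xs. F a b) = (\<Sum>(a, b)\<leftarrow>ys. F a b)"
  using assms unfolding tensor2_eq_def
  by (rule_tac sum_list_eq_if_group_closure)
    (auto simp: tensor2_relations_def balanced2_def zsum_diff)

lemma tensor3_eq_sum:
  assumes "tensor3_eq scale xs ys" "balanced3 scale F"
  shows "(\<Sum>(a, b, c)\<leftarrow>xs. F a b c) = (\<Sum>(a, b, c)\<leftarrow>ys. F a b c)"
  using assms unfolding tensor3_eq_def
  by (rule_tac sum_list_eq_if_group_closure)
    (auto simp: tensor3_relations_def balanced3_def zsum_diff)

section \<open>Sweedler sums and the antipode\<close>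

context hopf_algebra
begin

lemma hopf_linear:
  "S (x + y) = S x + S y" "S (scale c x) = scale c (S x)"
  "\<epsilon> (x + y) = \<epsilon> x + \<epsilon> y" "\<epsilon> (scale c x) = c * \<epsilon> x"
  "S 0 = 0" "\<epsilon> 0 = 0"
proof -
  interpret S: Vector_Spaces.linear scale scale S by (rule antipode_linear)
  interpret e: Vector_Spaces.linear scale "(*)" \<epsilon> by (rule counit_linear)
  show "S (x + y) = S x + S y" "S (scale c x) = scale c (S x)"
    "\<epsilon> (x + y) = \<epsilon> x + \<epsilon> y" "\<epsilon> (scale c x) = c * \<epsilon> x" "S 0 = 0" "\<epsilon> 0 = 0"
    by (simp_all add: S.add S.scale e.add e.scale)
qed

text \<open>
  A Sweedler sum is the functional that feeds the two tensor legs of \<open>\<Delta> x\<close> to \<open>F\<close>. Iterated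
  coproducts are nested applications, so no type of tensors is needed; the price is that
  coassociativity and multiplicativity of \<open>\<Delta>\<close> may only be used for balanced \<open>F\<close>.
\<close>

definition sw :: "('h \<Rightarrow> 'h \<Rightarrow> 'w::ring_1) \<Rightarrow> 'h \<Rightarrow> 'w" where
  "sw F x = (\<Sum>(a, b)\<leftarrow>\<Delta> x. F a b)"

abbreviation bal :: "('h \<Rightarrow> 'h \<Rightarrow> 'w::ring_1) \<Rightarrow> bool" where "bal \<equiv> balanced2 scale"
abbreviation tri :: "('h \<Rightarrow> 'h \<Rightarrow> 'h \<Rightarrow> 'w::ring_1) \<Rightarrow> bool" where "tri \<equiv> balanced3 scale"

lemma sw_plus_fun: "sw (\<lambda>a b. F a b + G a b) x = sw F x + sw G x"
  unfolding sw_def by (simp add: sum_list_addf split_def)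

lemma sw_mult_left: "sw (\<lambda>a b. c * F a b) x = c * sw F x"
  unfolding sw_def by (simp add: sum_list_const_mult split_def)

lemma sw_mult_right: "sw (\<lambda>a b. F a b * c) x = sw F x * c"
  unfolding sw_def by (simp add: sum_list_mult_const split_def)

lemma sw_zero: "sw (\<lambda>a b. 0) x = 0"
  unfolding sw_def by (simp add: split_def)

lemma sw_hom:
  assumes "\<And>a b. f (a + b) = f a + f b"
  shows "f (sw F x) = sw (\<lambda>a b. f (F a b)) x"
proof -
  have [simp]: "f 0 = 0" using assms[of 0 0] by simp
  have "f (\<Sum>p\<leftarrow>xs. case p of (a, b) \<Rightarrow> F a b) = (\<Sum>(a, b)\<leftarrow>xs. f (F a b))" for xs
    by (induction xs) (simp_all add: assms split_def)
  then show ?thesis unfolding sw_def .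
qed

lemma sw_scale_fun: "sw (\<lambda>a b. scale c (F a b)) x = scale c (sw F x)"
  by (rule sw_hom[symmetric]) (rule scale_right_distrib)

lemma sw_sum: "sw (\<lambda>a b. \<Sum>i\<in>A. F i a b) x = (\<Sum>i\<in>A. sw (F i) x)"
  by (induction A rule: infinite_finite_induct) (simp_all add: sw_plus_fun sw_zero)

lemma sw_swap: "sw (\<lambda>a b. sw (\<lambda>c d. F a b c d) y) x = sw (\<lambda>c d. sw (\<lambda>a b. F a b c d) x) y"
proof -
  have "(\<Sum>p\<leftarrow>xs. sw (\<lambda>c d. F (fst p) (snd p) c d) y)
      = sw (\<lambda>c d. \<Sum>p\<leftarrow>xs. F (fst p) (snd p) c d) y" for xs
    by (induction xs) (simp_all add: sw_plus_fun sw_zero)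
  then show ?thesis by (simp add: sw_def split_def)
qed

lemma sw_add: "bal F \<Longrightarrow> sw F (x + y) = sw F x + sw F y"
  unfolding sw_def by (subst tensor2_eq_sum[OF comult_add]) auto

lemma sw_scale: "bal F \<Longrightarrow> sw F (scale c x) = sw (\<lambda>a b. F (scale c a) b) x"
  unfolding sw_def by (subst tensor2_eq_sum[OF comult_scale]) (auto simp: split_def comp_def)

lemma sw_one: "bal F \<Longrightarrow> sw F 1 = F 1 1"
  unfolding sw_def by (subst tensor2_eq_sum[OF comult_one]) auto

lemma sum_list_concat_map: "sum_list (map f (concat xss)) = (\<Sum>xs\<leftarrow>xss. \<Sum>x\<leftarrow>xs. f x)"
  by (induction xss) simp_all

lemma sw_mult:
  "bal F \<Longrightarrow> sw F (x * y) = sw (\<lambda>a b. sw (\<lambda>a' b'. F (a * a') (b * b')) y) x"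
  unfolding sw_def
  by (subst tensor2_eq_sum[OF comult_mult])
    (auto simp: split_def comp_def sum_list_concat_map)

lemma sw_coassoc:
  "tri G \<Longrightarrow> sw (\<lambda>a b. sw (\<lambda>u v. G u v b) a) x = sw (\<lambda>a b. sw (\<lambda>u v. G a u v) b) x"
  unfolding sw_def
  using tensor3_eq_sum[OF coassoc, of G x]
  by (simp add: split_def comp_def sum_list_concat_map)

text \<open>
  Unfolding balancedness and moving scalars outward, past sums and Sweedler sums, decides the
  side conditions of the Sweedler rules; nested Sweedler sums are handled because additivity of
  the inner sum is again such a side condition.
\<close>

lemmas sweedler_simps = hopf_linear sw_add sw_scale sw_plus_fun sw_scale_fun sw_mult_left balanced2_def
  balanced3_def distrib_left distrib_right scale_mult_left scale_mult_right scale_left_distrib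
  scale_right_distrib mult.assoc

text \<open>
  The map \<open>f\<close> is the context in which a counit or an antipode is to be cancelled.
\<close>

lemma sw_counit_left:
  assumes "\<And>x y. f (x + y) = f x + f y"
  shows "sw (\<lambda>a b. f (scale (\<epsilon> a) b)) x = f x"
  using sw_hom[of f "\<lambda>a b. scale (\<epsilon> a) b" x, OF assms] counit_left[of x]
  by (simp add: sw_def split_def)

lemma sw_counit_right:
  assumes "\<And>x y. f (x + y) = f x + f y"
  shows "sw (\<lambda>a b. f (scale (\<epsilon> b) a)) x = f x"
  using sw_hom[of f "\<lambda>a b. scale (\<epsilon> b) a" x, OF assms] counit_right[of x]
  by (simp add: sw_def split_def)

lemma sw_antipode_left:
  assumes "\<And>x y. f (x + y) = f x + f y"
  shows "sw (\<lambda>a b. f (S a * b)) x = f (scale (\<epsilon> x) 1)"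
  using sw_hom[of f "\<lambda>a b. S a * b" x, OF assms] antipode_left[of x]
  by (simp add: sw_def split_def)

lemma sw_antipode_right:
  assumes "\<And>x y. f (x + y) = f x + f y"
  shows "sw (\<lambda>a b. f (a * S b)) x = f (scale (\<epsilon> x) 1)"
  using sw_hom[of f "\<lambda>a b. a * S b" x, OF assms] antipode_right[of x]
  by (simp add: sw_def split_def)

text \<open>
  Both sides are convolution inverses of the multiplication \<open>H \<otimes> H \<rightarrow> H\<close>. Evaluating
  \<open>\<Sum> S(x\<^sub>1 y\<^sub>1) x\<^sub>2 y\<^sub>2 S(y\<^sub>3) S(x\<^sub>3)\<close> by cancelling on the right or on the left gives the two sides.
\<close>

lemma antipode_mult: "S (x * y) = S y * S x"
proof -
  let ?T = "sw (\<lambda>x1 r. sw (\<lambda>y1 s. sw (\<lambda>x2 x3. sw (\<lambda>y2 y3.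
              S (x1 * y1) * (x2 * y2 * (S y3 * S x3))) s) r) y) x"
  have 1: "sw (\<lambda>y2 y3. S (x1 * y1) * (x2 * y2 * (S y3 * S x3))) s
       = scale (\<epsilon> s) (S (x1 * y1) * (x2 * S x3))" for x1 y1 x2 x3 s
    using sw_antipode_right[of "\<lambda>z. S (x1 * y1) * (x2 * z * S x3)" s]
    by (simp add: sweedler_simps)
  have 2: "sw (\<lambda>x2 x3. scale (\<epsilon> s) (S (x1 * y1) * (x2 * S x3))) r = scale (\<epsilon> s) (scale (\<epsilon> r) (S (x1 * y1)))"
    for x1 y1 r s
    using sw_antipode_right[of "\<lambda>z. S (x1 * y1) * z" r]
    by (simp add: sweedler_simps)
  have 3: "sw (\<lambda>y1 s. scale (\<epsilon> s) (scale (\<epsilon> r) (S (x1 * y1)))) y = scale (\<epsilon> r) (S (x1 * y))" for x1 r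
    using sw_counit_right[of "\<lambda>z. scale (\<epsilon> r) (S (x1 * z))" y]
    by (simp add: sweedler_simps ac_simps)
  have 4: "sw (\<lambda>x1 r. scale (\<epsilon> r) (S (x1 * y))) x = S (x * y)"
    using sw_counit_right[of "\<lambda>z. S (z * y)" x] by (simp add: sweedler_simps)
  have A: "?T = S (x * y)"
    by (simp only: 1 2 3 4)
  have "?T = sw (\<lambda>x1 r. sw (\<lambda>x2 x3. sw (\<lambda>y1 s. sw (\<lambda>y2 y3.
              S (x1 * y1) * (x2 * y2 * (S y3 * S x3))) s) y) r) x"
    by (subst sw_swap) simp
  also have "\<dots> = sw (\<lambda>p x3. sw (\<lambda>x1 x2. sw (\<lambda>y1 s. sw (\<lambda>y2 y3.
              S (x1 * y1) * (x2 * y2 * (S y3 * S x3))) s) y) p) x"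
    by (rule sw_coassoc[symmetric]) (simp add: sweedler_simps)
  also have "\<dots> = sw (\<lambda>p x3. sw (\<lambda>x1 x2. sw (\<lambda>q y3. sw (\<lambda>y1 y2.
              S (x1 * y1) * (x2 * y2 * (S y3 * S x3))) q) y) p) x"
    by (subst sw_coassoc[symmetric]) (simp_all add: sweedler_simps)
  also have "\<dots> = sw (\<lambda>p x3. sw (\<lambda>q y3. sw (\<lambda>x1 x2. sw (\<lambda>y1 y2.
              S (x1 * y1) * (x2 * y2 * (S y3 * S x3))) q) p) y) x"
    by (subst sw_swap) simp
  also have "\<dots> = sw (\<lambda>p x3. sw (\<lambda>q y3. sw (\<lambda>u v. S u * v * (S y3 * S x3)) (p * q)) y) x"
    by (subst sw_mult) (simp_all add: sweedler_simps)
  also have "\<dots> = sw (\<lambda>p x3. sw (\<lambda>q y3. scale (\<epsilon> p) (scale (\<epsilon> q) (S y3 * S x3))) y) x"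
    by (subst sw_antipode_left[where f="\<lambda>z. z * _"]) (simp_all add: sweedler_simps counit_mult)
  also have "\<dots> = sw (\<lambda>p x3. scale (\<epsilon> p) (S y * S x3)) x"
    using sw_counit_left[of "\<lambda>z. scale (\<epsilon> p) (S z * S x3)" y for p x3] by (simp add: sweedler_simps)
  also have "\<dots> = S y * S x"
    using sw_counit_left[of "\<lambda>z. S y * S z" x] by (simp add: sweedler_simps)
  finally show ?thesis using A by simp
qed

lemma antipode_one: "S 1 = 1"
proof -
  have "sw (\<lambda>a b. S a * b) 1 = 1"
    using sw_antipode_left[of "\<lambda>z. z" 1] by (simp add: counit_one)
  then show ?thesis by (subst (asm) sw_one) (simp_all add: sweedler_simps)
qed

lemma counit_antipode: "\<epsilon> (S x) = \<epsilon> x"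
proof -
  have "sw (\<lambda>a b. \<epsilon> (S a * b)) x = \<epsilon> x"
    by (subst sw_antipode_left) (simp_all add: hopf_linear counit_one)
  moreover have "sw (\<lambda>a b. \<epsilon> (S a * b)) x = \<epsilon> (S x)"
    using sw_counit_right[of "\<lambda>z. \<epsilon> (S z)" x] by (simp add: hopf_linear counit_mult mult.commute)
  ultimately show ?thesis by simp
qed

text \<open>
  The antipode reverses the comultiplication: \<open>\<Delta> \<circ> S\<close> and \<open>x \<mapsto> \<Sum> S(x\<^sub>2) \<otimes> S(x\<^sub>1)\<close> are both
  convolution inverses of \<open>\<Delta>\<close>. The sum \<open>\<Sum> \<Delta>(S x\<^sub>1) \<Delta>(x\<^sub>2) (S x\<^sub>4 \<otimes> S x\<^sub>3)\<close> is evaluated by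
  cancelling its first two or its last two factors.
\<close>

lemma sw_antipode:
  assumes F: "bal F"
  shows "sw F (S x) = sw (\<lambda>a b. F (S b) (S a)) x"
proof -
  have F_add1: "F (a + a') b = F a b + F a' b" and F_add2: "F a (b + b') = F a b + F a b'"
    and F_scale: "F (scale c a) b = F a (scale c b)" for a a' b b' c
    using F by (auto simp: balanced2_def)
  note [simp] = F_add1 F_add2 F_scale
  define K where "K s1 s2 u v p q = F (s1 * u * S q) (s2 * v * S p)" for s1 s2 u v p q
  note K = K_def[abs_def]
  let ?Y = "sw (\<lambda>x1 r. sw (\<lambda>x2 t. sw (\<lambda>s1 s2. sw (\<lambda>u v. sw (\<lambda>p q. K s1 s2 u v p q) t) x2) (S x1)) r) x"
  have "?Y = sw (\<lambda>m t. sw (\<lambda>x1 x2. sw (\<lambda>s1 s2. sw (\<lambda>u v. sw (\<lambda>p q. K s1 s2 u v p q) t) x2) (S x1)) m) x"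
    by (rule sw_coassoc[symmetric]) (simp add: sweedler_simps K)
  also have "\<dots> = sw (\<lambda>m t. sw (\<lambda>x1 x2. sw (\<lambda>c d. sw (\<lambda>p q. F (c * S q) (d * S p)) t) (S x1 * x2)) m) x"
    by (subst sw_mult) (simp_all add: sweedler_simps K)
  also have "\<dots> = sw (\<lambda>m t. sw (\<lambda>c d. sw (\<lambda>p q. F (c * S q) (d * S p)) t) (scale (\<epsilon> m) 1)) x"
    by (subst sw_antipode_left) (simp_all add: sweedler_simps)
  also have "\<dots> = sw (\<lambda>m t. sw (\<lambda>p q. F (S q) (S p)) (scale (\<epsilon> m) t)) x"
    by (simp add: sweedler_simps sw_one ac_simps)
  also have "\<dots> = sw (\<lambda>p q. F (S q) (S p)) x"
    by (rule sw_counit_left) (simp add: sweedler_simps)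
  finally have 1: "?Y = sw (\<lambda>a b. F (S b) (S a)) x" .
  have *: "sw (\<lambda>x2 t. sw (\<lambda>u v. sw (\<lambda>p q. K s1 s2 u v p q) t) x2) r = F (scale (\<epsilon> r) s1) s2"
    for s1 s2 r
  proof -
    have "sw (\<lambda>x2 t. sw (\<lambda>u v. sw (\<lambda>p q. K s1 s2 u v p q) t) x2) r
        = sw (\<lambda>u w. sw (\<lambda>v t. sw (\<lambda>p q. K s1 s2 u v p q) t) w) r"
      by (rule sw_coassoc) (simp add: sweedler_simps K)
    also have "\<dots> = sw (\<lambda>u w. sw (\<lambda>m q. sw (\<lambda>v p. K s1 s2 u v p q) m) w) r"
      by (subst sw_coassoc) (simp_all add: sweedler_simps K)
    also have "\<dots> = sw (\<lambda>u w. sw (\<lambda>m q. F (s1 * u * S (scale (\<epsilon> m) q)) s2) w) r"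
      unfolding K mult.assoc by (subst sw_antipode_right[of "\<lambda>z. F a (b * z)" for a b])
         (simp_all add: sweedler_simps)
    also have "\<dots> = sw (\<lambda>u w. F (s1 * (u * S w)) s2) r"
      using sw_counit_left[of "\<lambda>z. F (s1 * (u * S z)) s2" for u] by (simp add: sweedler_simps)
    also have "\<dots> = F (scale (\<epsilon> r) s1) s2"
      by (subst sw_antipode_right[of "\<lambda>z. F (s1 * z) s2"]) (simp_all add: sweedler_simps)
    finally show ?thesis .
  qed
  have "?Y = sw (\<lambda>x1 r. sw (\<lambda>s1 s2. sw (\<lambda>x2 t. sw (\<lambda>u v. sw (\<lambda>p q. K s1 s2 u v p q) t) x2) r) (S x1)) x"
    by (subst sw_swap) simp
  also have "\<dots> = sw (\<lambda>x1 r. sw (\<lambda>s1 s2. F (scale (\<epsilon> r) s1) s2) (S x1)) x"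
    by (simp add: *)
  also have "\<dots> = sw (\<lambda>x1 r. sw F (S (scale (\<epsilon> r) x1))) x"
    using F by (simp add: hopf_linear sw_scale)
  also have "\<dots> = sw F (S x)"
    using F by (intro sw_counit_right) (simp add: hopf_linear sw_add)
  finally show ?thesis using 1 by simp
qed

lemma sw_antipode2:
  assumes "bal F"
  shows "sw F (S (S x)) = sw (\<lambda>a b. F (S (S a)) (S (S b))) x"
  using assms by (subst sw_antipode, assumption, subst sw_antipode) (simp_all add: sweedler_simps)

end

section \<open>Traces of linear endomorphisms\<close>

locale fd_unital_algebra = unital_algebra scale + finite_dimensional_vector_space scale B
  for scale :: "'k::field \<Rightarrow> 'h::ring_1 \<Rightarrow> 'h" and B
begin

definition linear_map :: "('h \<Rightarrow> 'h) \<Rightarrow> bool" where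
  "linear_map f \<longleftrightarrow> (\<forall>x y. f (x + y) = f x + f y) \<and> (\<forall>c x. f (scale c x) = scale c (f x))"

definition functional :: "('h \<Rightarrow> 'k) \<Rightarrow> bool" where
  "functional p \<longleftrightarrow> (\<forall>x y. p (x + y) = p x + p y) \<and> (\<forall>c x. p (scale c x) = c * p x)"

lemma linear_map_zero: "linear_map f \<Longrightarrow> f 0 = 0"
  unfolding linear_map_def by (metis add_cancel_right_right)

lemma linear_map_sum: "linear_map f \<Longrightarrow> f (sum g A) = (\<Sum>i\<in>A. f (g i))"
  by (induction A rule: infinite_finite_induct) (simp_all add: linear_map_zero, simp add: linear_map_def)

lemma functional_zero: "functional p \<Longrightarrow> p 0 = 0"
  unfolding functional_def by (metis add_cancel_right_right)

lemma functional_diff: "functional p \<Longrightarrow> p (x - y) = p x - p y"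
  unfolding functional_def by (metis add_diff_cancel diff_add_cancel)

lemma functional_sum: "functional p \<Longrightarrow> p (sum g A) = (\<Sum>i\<in>A. p (g i))"
  by (induction A rule: infinite_finite_induct) (simp_all add: functional_zero, simp add: functional_def)

definition coord :: "'h \<Rightarrow> 'h \<Rightarrow> 'k" where "coord b v = representation B v b"

lemma coord_add: "coord b (x + y) = coord b x + coord b y"
  unfolding coord_def by (simp add: representation_add independent_Basis span_Basis)

lemma coord_scale: "coord b (scale c x) = c * coord b x"
  unfolding coord_def by (simp add: representation_scale independent_Basis span_Basis)

lemma functional_coord: "functional (coord b)"
  by (simp add: functional_def coord_add coord_scale)

lemma coord_expand: "(\<Sum>b\<in>B. scale (coord b x) b) = x"
  unfolding coord_def
  by (rule sum_representation_eq) (simp_all add: independent_Basis span_Basis finite_Basis)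

lemma linear_map_expand: "linear_map f \<Longrightarrow> f x = (\<Sum>b\<in>B. scale (coord b x) (f b))"
  by (subst (1) coord_expand[symmetric], subst linear_map_sum) (simp_all add: linear_map_def)

lemma functional_expand: "functional p \<Longrightarrow> p x = (\<Sum>b\<in>B. coord b x * p b)"
  by (subst (1) coord_expand[symmetric], subst functional_sum) (simp_all add: functional_def)

abbreviation Tr :: "('h \<Rightarrow> 'h) \<Rightarrow> 'k" where "Tr \<equiv> linear_trace scale B"

lemma Tr_def: "Tr f = (\<Sum>b\<in>B. coord b (f b))"
  by (simp add: linear_trace_def coord_def)

lemma Tr_add: "Tr (\<lambda>x. f x + g x) = Tr f + Tr g"
  by (simp add: Tr_def coord_add sum.distrib)

lemma Tr_scale: "Tr (\<lambda>x. scale c (f x)) = c * Tr f"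
  by (simp add: Tr_def coord_scale sum_distrib_left)

lemma Tr_sum: "Tr (\<lambda>x. \<Sum>i\<in>A. f i x) = (\<Sum>i\<in>A. Tr (f i))"
  by (simp add: Tr_def functional_sum[OF functional_coord]) (rule sum.swap)

text \<open>
  The rank one formula is the only way in which traces are evaluated: it computes the trace of
  \<open>f\<close> from any expansion \<open>f x = \<Sum>\<^sub>j p\<^sub>j(x) a\<^sub>j\<close>, whatever basis defines the trace.
\<close>

lemma Tr_rank_one:
  assumes "functional p"
  shows "Tr (\<lambda>x. scale (p x) a) = p a"
  by (simp add: Tr_def coord_scale functional_expand[OF assms, of a] mult.commute)

lemma Tr_commute:
  assumes f: "linear_map f" and g: "linear_map g"
  shows "Tr (\<lambda>x. f (g x)) = Tr (\<lambda>x. g (f x))"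
proof -
  have *: "Tr (\<lambda>x. f (g x)) = (\<Sum>b\<in>B. \<Sum>c\<in>B. coord c (g b) * coord b (f c))" if "linear_map f" "linear_map g" for f g
    unfolding Tr_def
    by (subst linear_map_expand[OF that(1)])
      (simp add: functional_sum[OF functional_coord] coord_scale)
  show ?thesis
    by (simp add: *[OF f g] *[OF g f]) (subst sum.swap, simp add: mult.commute)
qed

lemma Tr_id: "Tr (\<lambda>x. x) = of_nat (card B)"
  by (simp add: Tr_def coord_def representation_basis independent_Basis)

text \<open>
  The number \<open>n\<close> is the rank of \<open>p\<close>: expand \<open>p x\<close> in a basis of the range of \<open>p\<close>, whose elements are
  fixed by \<open>p\<close>.
\<close>

lemma Tr_idempotent:
  assumes p: "linear_map p" and idem: "\<And>x. p (p x) = p x"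
  obtains n where "Tr p = of_nat n" "\<And>x. n = 0 \<Longrightarrow> p x = 0"
proof -
  obtain C where C: "C \<subseteq> range p" "independent C" "range p \<subseteq> span C"
    by (rule basis_exists[of "range p"])
  have fin: "finite C" using C(2) by (rule finiteI_independent)
  have sp: "p x \<in> span C" for x using C(3) by auto
  have pc: "p c = c" if "c \<in> C" for c using that C(1) idem by auto
  have px: "p x = (\<Sum>c\<in>C. scale (representation C (p x) c) c)" for x
    using sum_representation_eq[OF C(2) sp fin] by simp
  have fn: "functional (\<lambda>x. representation C (p x) c)" for c
    using p sp C(2) by (simp add: functional_def linear_map_def representation_add representation_scale)
  have "Tr p = Tr (\<lambda>x. \<Sum>c\<in>C. scale (representation C (p x) c) c)"
    by (simp flip: px)
  also have "\<dots> = (\<Sum>c\<in>C. representation C (p c) c)"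
    by (simp add: Tr_sum Tr_rank_one[OF fn])
  also have "\<dots> = of_nat (card C)"
    using C(2) by (simp add: pc representation_basis)
  finally have "Tr p = of_nat (card C)" .
  moreover have "p x = 0" if "card C = 0" for x
    using that fin sp[of x] by simp
  ultimately show ?thesis using that by blast
qed

text \<open>
  The range of \<open>E\<close> splits into the eigenspaces of \<open>\<sigma>\<close> for \<open>1\<close> and \<open>-1\<close>; \<open>a\<close> and \<open>b\<close> are their
  dimensions, obtained as ranks of the idempotents \<open>E (1 \<plusminus> \<sigma>) / 2\<close>.
\<close>

lemma Tr_idempotent_involution:
  assumes two: "(2::'k) \<noteq> 0"
    and E: "linear_map E" "\<And>x. E (E x) = E x" "\<And>x. E (\<sigma> x) = \<sigma> (E x)"
    and \<sigma>: "linear_map \<sigma>" "\<And>x. \<sigma> (\<sigma> x) = x"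
  obtains a b where "Tr (\<lambda>x. E (\<sigma> x)) = of_nat a - of_nat b" "Tr E = of_nat a + of_nat b"
    "\<And>x. a = 0 \<Longrightarrow> E x + E (\<sigma> x) = 0" "\<And>x. b = 0 \<Longrightarrow> E x - E (\<sigma> x) = 0"
proof -
  have \<sigma>_simps: "\<sigma> (x + y) = \<sigma> x + \<sigma> y" "\<sigma> (scale c x) = scale c (\<sigma> x)" for x y c
    using \<sigma>(1) by (simp_all add: linear_map_def)
  have Es: "E (x + y) = E x + E y" "E (scale c x) = scale c (E x)" for x y c
    using E(1) by (simp_all add: linear_map_def)
  have "(2::'k) * 2 \<noteq> 0" by (rule no_zero_divisors[OF two two])
  then have four: "(4::'k) \<noteq> 0" by simp
  have half: "scale (1/2) (x + x) = x" for x
    using two by (simp flip: scale_left_distrib add: scale_right_distrib)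
  \<comment> \<open>\<open>F s\<close> projects onto the \<open>s\<close>-eigenspace of \<open>\<sigma>\<close> in the range of \<open>E\<close>.\<close>
  define F where "F s x = scale (1/2) (E x + scale s (E (\<sigma> x)))" for s :: 'k and x
  have Fl: "linear_map (F s)" for s
    by (simp add: F_def linear_map_def scale_right_distrib ac_simps Es \<sigma>_simps)
  have Fi: "F s (F s x) = F s x" if "s * s = 1" for s x
  proof -
    have "E (F s x) = F s x" "\<sigma> (F s x) = scale s (F s x)"
      using that by (simp_all add: F_def Es E(2,3) \<sigma>_simps \<sigma>(2) scale_right_distrib ac_simps flip: mult.assoc)
    moreover from this have "E (\<sigma> (F s x)) = scale s (F s x)"
      by (simp add: Es)
    ultimately have "F s (F s x) = scale (1/2) (F s x + scale (s * s) (F s x))"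
      by (simp add: F_def[of s "F s x"])
    then show ?thesis by (simp add: that half)
  qed
  obtain a where a: "Tr (F 1) = of_nat a" "\<And>x. a = 0 \<Longrightarrow> F 1 x = 0"
    using Tr_idempotent[OF Fl Fi] by (metis mult_1)
  obtain b where b: "Tr (F (-1)) = of_nat b" "\<And>x. b = 0 \<Longrightarrow> F (-1) x = 0"
    using Tr_idempotent[OF Fl Fi] by (metis mult_minus1 minus_minus)
  have T: "Tr (F s) = (1/2) * (Tr E + s * Tr (\<lambda>x. E (\<sigma> x)))" for s
    unfolding F_def by (simp add: Tr_scale Tr_add)
  show ?thesis
  proof (rule that[of a b])
    show "Tr (\<lambda>x. E (\<sigma> x)) = of_nat a - of_nat b" "Tr E = of_nat a + of_nat b"
      unfolding a(1)[symmetric] b(1)[symmetric] T using two four by (simp_all add: field_simps)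
    show "E x + E (\<sigma> x) = 0" if "a = 0" for x
      using a(2)[OF that, of x] two by (simp add: F_def)
    show "E x - E (\<sigma> x) = 0" if "b = 0" for x
      using b(2)[OF that, of x] two by (simp add: F_def)
  qed
qed

end

section \<open>Integrals of the dual algebra\<close>

locale fd_hopf_algebra = hopf_algebra scale \<Delta> \<epsilon> S + fd_unital_algebra scale B
  for scale :: "'k::field \<Rightarrow> 'h::ring_1 \<Rightarrow> 'h" and \<Delta> \<epsilon> S B

locale hopf_algebra_with_integral = fd_hopf_algebra scale \<Delta> \<epsilon> S B
  for scale :: "'k::field \<Rightarrow> 'h::ring_1 \<Rightarrow> 'h" and \<Delta> \<epsilon> S B +
  fixes \<Lambda> :: 'h
  assumes \<Lambda>: "idempotent_integral scale \<epsilon> \<Lambda>"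
begin

lemma int_left: "h * \<Lambda> = scale (\<epsilon> h) \<Lambda>" and int_right: "\<Lambda> * h = scale (\<epsilon> h) \<Lambda>" and counit_int: "\<epsilon> \<Lambda> = 1"
  using \<Lambda> by (auto simp: idempotent_integral_def)

text \<open>
  The trace formula for the right integral of the dual. As long as \<open>S\<^sup>2\<close> is not known to be the
  identity it differs from the character \<open>chi\<close> of the regular representation.
\<close>

definition rint :: "'h \<Rightarrow> 'k" where "rint x = Tr (\<lambda>y. x * S (S y))"

definition chi :: "'h \<Rightarrow> 'k" where "chi x = Tr (\<lambda>y. x * y)"

lemma rint_add: "rint (x + y) = rint x + rint y"
  by (simp add: rint_def distrib_right Tr_add)

lemma rint_scale: "rint (scale c x) = c * rint x"
  by (simp add: rint_def scale_mult_left Tr_scale)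

lemma chi_add: "chi (x + y) = chi x + chi y"
  by (simp add: chi_def distrib_right Tr_add)

lemma chi_scale: "chi (scale c x) = c * chi x"
  by (simp add: chi_def scale_mult_left Tr_scale)

lemma sw_scale_mult_fun: "sw (\<lambda>a b. scale (c * f a b) (F a b)) x = scale c (sw (\<lambda>a b. scale (f a b) (F a b)) x)"
  by (simp flip: sw_scale_fun)

lemmas rint_simps = sweedler_simps sw_scale_mult_fun coord_add coord_scale rint_add rint_scale chi_add chi_scale

lemma rint_int: "rint \<Lambda> = 1"
proof -
  have "functional \<epsilon>" by (simp add: functional_def hopf_linear)
  then show ?thesis
    by (simp add: rint_def int_right counit_antipode Tr_rank_one counit_int)
qed

lemma chi_int: "chi \<Lambda> = 1"
proof -
  have "functional \<epsilon>" by (simp add: functional_def hopf_linear)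
  then show ?thesis
    by (simp add: chi_def int_right Tr_rank_one counit_int)
qed

text \<open>
  Cyclicity of the trace for maps that carry an extra tensor leg: the coproduct of the basis
  vector, taken before \<open>\<phi>\<close> acts, may be exchanged for a further coproduct of the image under \<open>\<phi>\<close>.
\<close>

lemma trace_rotate:
  assumes phi: "linear_map \<phi>" and Q: "bal Q" and Qs: "\<And>c u v. Q (scale c u) v = scale c (Q u v)"
  shows "(\<Sum>b\<in>B. sw (\<lambda>y t. sw (\<lambda>u v. scale (coord b v) (Q u y)) (\<phi> t)) b)
       = (\<Sum>b\<in>B. sw (\<lambda>u v. sw (\<lambda>v1 v2. scale (coord b v2) (Q u v1)) v) (\<phi> b))"
proof -
  have [simp]: "\<phi> (x + y) = \<phi> x + \<phi> y" "\<phi> (scale c x) = scale c (\<phi> x)" for c x y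
    using phi by (auto simp: linear_map_def)
  have Q2: "Q u (scale c v) = scale c (Q u v)" for c u v
    using Q Qs by (metis balanced2_def)
  have [simp]: "Q (u + u') v = Q u v + Q u' v" "Q u (v + v') = Q u v + Q u v'" for u u' v v'
    using Q by (auto simp: balanced2_def)
  note [simp] = Qs Q2
  have 1: "sw (\<lambda>u v. scale (coord b v) (Q u y)) (\<phi> t)
      = (\<Sum>c\<in>B. scale (coord c t) (sw (\<lambda>u v. scale (coord b v) (Q u y)) (\<phi> c)))" for b y t
    by (rule linear_map_expand) (simp add: linear_map_def rint_simps ac_simps)
  have 2: "sw (\<lambda>v1 v2. scale (coord c v2) (Q u v1)) v
      = (\<Sum>b\<in>B. scale (coord b v) (sw (\<lambda>v1 v2. scale (coord c v2) (Q u v1)) b))" for c u v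
    by (rule linear_map_expand) (simp add: linear_map_def rint_simps ac_simps)
  have "(\<Sum>b\<in>B. sw (\<lambda>y t. sw (\<lambda>u v. scale (coord b v) (Q u y)) (\<phi> t)) b)
     = (\<Sum>b\<in>B. \<Sum>c\<in>B. sw (\<lambda>y t. scale (coord c t) (sw (\<lambda>u v. scale (coord b v) (Q u y)) (\<phi> c))) b)"
    by (subst 1) (simp add: sw_sum)
  also have "\<dots> = (\<Sum>b\<in>B. \<Sum>c\<in>B. sw (\<lambda>u v. scale (coord b v) (sw (\<lambda>v1 v2. scale (coord c v2) (Q u v1)) b)) (\<phi> c))"
    by (simp only: sw_scale_fun[symmetric], subst sw_swap) (simp add: ac_simps)
  also have "\<dots> = (\<Sum>c\<in>B. sw (\<lambda>u v. sw (\<lambda>v1 v2. scale (coord c v2) (Q u v1)) v) (\<phi> c))"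
    by (subst 2) (simp add: sw_sum, rule sum.swap)
  finally show ?thesis .
qed

text \<open>
  In \<open>\<Sum> h\<^sub>1 Tr(y \<mapsto> h\<^sub>2 S\<^sup>2 y)\<close> one inserts \<open>\<epsilon>(y\<^sub>1) = S(y\<^sub>1 S(y\<^sub>2)) = S\<^sup>2(y\<^sub>2) S(y\<^sub>1)\<close> next to \<open>h\<^sub>1\<close>, so that
  the coproduct of \<open>z = h S\<^sup>2 y\<close> appears. Rotating the remaining \<open>S(y\<^sub>1)\<close> through the trace turns it
  into \<open>S(z\<^sub>2)\<close>, which cancels against \<open>z\<^sub>1\<close>.
\<close>

lemma rint_right_integral: "sw (\<lambda>a b. scale (rint b) a) h = scale (rint h) 1"
proof -
  have SS: "S (S (x * y)) = S (S x) * S (S y)" for x y by (simp add: antipode_mult)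
  define \<phi> where "\<phi> t = h * S (S t)" for t
  have phi: "linear_map \<phi>" by (simp add: linear_map_def \<phi>_def rint_simps)
  define Q where "Q u y = u * S y" for u y
  have Q: "bal Q" "Q (scale c u) v = scale c (Q u v)" for c u v by (simp_all add: Q_def[abs_def] rint_simps)
  have 1: "sw (\<lambda>h1 h2. scale (coord b (h2 * S (S y))) h1) h
     = sw (\<lambda>y1 t. sw (\<lambda>u v. scale (coord b v) (Q u y1)) (\<phi> t)) y" for b y
  proof -
    have "sw (\<lambda>h1 h2. scale (coord b (h2 * S (S y))) h1) h
        = sw (\<lambda>p y3. sw (\<lambda>h1 h2. scale (coord b (h2 * S (S y3))) (h1 * S (scale (\<epsilon> p) 1))) h) y"
      using sw_counit_left[of "\<lambda>z. sw (\<lambda>h1 h2. scale (coord b (h2 * S (S z))) h1) h" y]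
      by (simp add: rint_simps antipode_one ac_simps)
    also have "\<dots> = sw (\<lambda>p y3. sw (\<lambda>y1 y2. sw (\<lambda>h1 h2. scale (coord b (h2 * S (S y3))) (h1 * S (y1 * S y2))) h) p) y"
      by (subst sw_antipode_right[of "\<lambda>z. sw (\<lambda>h1 h2. scale (coord b (h2 * S (S y3))) (h1 * S z)) h" for y3])
         (simp_all add: rint_simps)
    also have "\<dots> = sw (\<lambda>y1 t. sw (\<lambda>y2 y3. sw (\<lambda>h1 h2. scale (coord b (h2 * S (S y3))) (h1 * S (y1 * S y2))) h) t) y"
      by (rule sw_coassoc) (simp add: rint_simps ac_simps)
    also have "\<dots> = sw (\<lambda>y1 t. sw (\<lambda>h1 h2. sw (\<lambda>y2 y3. scale (coord b (h2 * S (S y3))) (h1 * S (y1 * S y2))) t) h) y"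
      by (subst sw_swap) simp
    also have "\<dots> = sw (\<lambda>y1 t. sw (\<lambda>h1 h2. sw (\<lambda>y2 y3. scale (coord b (h2 * y3)) (Q (h1 * y2) y1)) (S (S t))) h) y"
      by (subst sw_antipode2) (simp_all add: rint_simps ac_simps Q_def antipode_mult)
    also have "\<dots> = sw (\<lambda>y1 t. sw (\<lambda>u v. scale (coord b v) (Q u y1)) (\<phi> t)) y"
      unfolding \<phi>_def by (subst sw_mult) (simp_all add: rint_simps ac_simps Q_def)
    finally show ?thesis .
  qed
  have 2: "sw (\<lambda>u v. sw (\<lambda>v1 v2. scale (coord b v2) (Q u v1)) v) z = scale (coord b z) 1" for b z
  proof -
    have "sw (\<lambda>u v. sw (\<lambda>v1 v2. scale (coord b v2) (Q u v1)) v) z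
       = sw (\<lambda>p v2. sw (\<lambda>u v1. scale (coord b v2) (u * S v1)) p) z"
      by (subst sw_coassoc) (simp_all add: rint_simps ac_simps Q_def)
    also have "\<dots> = sw (\<lambda>p v2. scale (coord b (scale (\<epsilon> p) v2)) 1) z"
      by (subst sw_antipode_right) (simp_all add: rint_simps ac_simps)
    also have "\<dots> = scale (coord b z) 1"
      by (rule sw_counit_left) (simp add: rint_simps)
    finally show ?thesis .
  qed
  have "sw (\<lambda>a b. scale (rint b) a) h = (\<Sum>b\<in>B. sw (\<lambda>h1 h2. scale (coord b (h2 * S (S b))) h1) h)"
    by (simp add: rint_def Tr_def scale_sum_left sw_sum)
  also have "\<dots> = (\<Sum>b\<in>B. sw (\<lambda>u v. sw (\<lambda>v1 v2. scale (coord b v2) (Q u v1)) v) (\<phi> b))"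
    unfolding 1 by (rule trace_rotate[OF phi Q])
  also have "\<dots> = scale (rint h) 1"
    unfolding 2 by (simp add: rint_def Tr_def scale_sum_left \<phi>_def)
  finally show ?thesis .
qed

text \<open>
  An integral \<open>\<Lambda>\<close> absorbs factors: a factor on one leg of \<open>\<Delta> \<Lambda>\<close> moves to the other leg at the price
  of an antipode, since \<open>\<Sum> \<Lambda>\<^sub>1 h \<otimes> \<Lambda>\<^sub>2 = \<Sum> \<Lambda>\<^sub>1 h\<^sub>1 \<otimes> \<Lambda>\<^sub>2 h\<^sub>2 S(h\<^sub>3)\<close> and \<open>\<Lambda> h = \<epsilon>(h) \<Lambda>\<close>.
\<close>

lemma casimir_right:
  assumes "bal F"
  shows "sw (\<lambda>a b. F (a * h) b) \<Lambda> = sw (\<lambda>a b. F a (b * S h)) \<Lambda>"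
proof -
  have F: "F (a + a') b = F a b + F a' b" "F a (b + b') = F a b + F a b'"
    "F (scale c a) b = F a (scale c b)" for a a' b b' c
    using assms by (auto simp: balanced2_def)
  note [simp] = F
  have "sw (\<lambda>a b. F (a * h) b) \<Lambda> = sw (\<lambda>h1 t. sw (\<lambda>a b. F (a * h1) (b * scale (\<epsilon> t) 1)) \<Lambda>) h"
    using sw_counit_right[of "\<lambda>z. sw (\<lambda>a b. F (a * z) b) \<Lambda>" h] by (simp add: rint_simps)
  also have "\<dots> = sw (\<lambda>h1 t. sw (\<lambda>h2 h3. sw (\<lambda>a b. F (a * h1) (b * (h2 * S h3))) \<Lambda>) t) h"
    by (subst sw_antipode_right) (simp_all add: rint_simps)
  also have "\<dots> = sw (\<lambda>p h3. sw (\<lambda>h1 h2. sw (\<lambda>a b. F (a * h1) (b * (h2 * S h3))) \<Lambda>) p) h"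
    by (rule sw_coassoc[symmetric]) (simp add: rint_simps)
  also have "\<dots> = sw (\<lambda>p h3. sw (\<lambda>a b. sw (\<lambda>h1 h2. F (a * h1) (b * h2 * S h3)) p) \<Lambda>) h"
    by (subst sw_swap) (simp add: mult.assoc)
  also have "\<dots> = sw (\<lambda>p h3. sw (\<lambda>a b. F a (b * S h3)) (\<Lambda> * p)) h"
    by (subst sw_mult) (simp_all add: rint_simps)
  also have "\<dots> = sw (\<lambda>p h3. sw (\<lambda>a b. F a (b * S (scale (\<epsilon> p) h3))) \<Lambda>) h"
    by (simp add: rint_simps int_right)
  also have "\<dots> = sw (\<lambda>a b. F a (b * S h)) \<Lambda>"
    by (rule sw_counit_left) (simp add: rint_simps)
  finally show ?thesis .
qed

lemma casimir_left:
  assumes "bal F"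
  shows "sw (\<lambda>a b. F a (h * b)) \<Lambda> = sw (\<lambda>a b. F (S h * a) b) \<Lambda>"
proof -
  have F: "F (a + a') b = F a b + F a' b" "F a (b + b') = F a b + F a b'"
    "F (scale c a) b = F a (scale c b)" for a a' b b' c
    using assms by (auto simp: balanced2_def)
  note [simp] = F
  have "sw (\<lambda>a b. F a (h * b)) \<Lambda> = sw (\<lambda>p h3. sw (\<lambda>a b. F (scale (\<epsilon> p) 1 * a) (h3 * b)) \<Lambda>) h"
    using sw_counit_left[of "\<lambda>z. sw (\<lambda>a b. F a (z * b)) \<Lambda>" h] by (simp add: rint_simps)
  also have "\<dots> = sw (\<lambda>p h3. sw (\<lambda>h1 h2. sw (\<lambda>a b. F (S h1 * h2 * a) (h3 * b)) \<Lambda>) p) h"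
    by (subst sw_antipode_left) (simp_all add: rint_simps)
  also have "\<dots> = sw (\<lambda>h1 t. sw (\<lambda>h2 h3. sw (\<lambda>a b. F (S h1 * h2 * a) (h3 * b)) \<Lambda>) t) h"
    by (rule sw_coassoc) (simp add: rint_simps)
  also have "\<dots> = sw (\<lambda>h1 t. sw (\<lambda>a b. F (S h1 * a) b) (t * \<Lambda>)) h"
    by (subst sw_mult) (simp_all add: rint_simps)
  also have "\<dots> = sw (\<lambda>h1 t. sw (\<lambda>a b. F (S (scale (\<epsilon> t) h1) * a) b) \<Lambda>) h"
    by (simp add: rint_simps int_left)
  also have "\<dots> = sw (\<lambda>a b. F (S h * a) b) \<Lambda>"
    by (rule sw_counit_right) (simp add: rint_simps)
  finally show ?thesis .
qed

lemma rint_int_dual: "sw (\<lambda>a b. scale (rint b) a) \<Lambda> = 1"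
  by (simp add: rint_right_integral rint_int)

text \<open>
  A left inverse of the antipode; hence \<open>S\<close> is bijective by finiteness of the dimension.
\<close>

lemma antipode_recover: "sw (\<lambda>a b. scale (rint (b * S h)) a) \<Lambda> = h"
proof -
  have "sw (\<lambda>a b. scale (rint (b * S h)) a) \<Lambda> = sw (\<lambda>a b. scale (rint b) (a * h)) \<Lambda>"
    by (rule casimir_right[symmetric]) (simp add: rint_simps ac_simps)
  also have "\<dots> = sw (\<lambda>a b. scale (rint b) a) \<Lambda> * h"
    by (simp flip: sw_mult_right add: rint_simps)
  finally show ?thesis by (simp add: rint_int_dual)
qed

lemma antipode_inj: "S x = S y \<Longrightarrow> x = y"
  by (metis antipode_recover)

lemma antipode_surj: "\<exists>x. S x = y"
proof -
  have "surj S"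
    using linear_inj_imp_surj[of S] antipode_linear antipode_inj by (metis injI)
  then show ?thesis by (metis surjD)
qed

lemma antipode_as_sum: "sw (\<lambda>a b. scale (rint (h * b)) a) \<Lambda> = S h"
proof -
  have "sw (\<lambda>a b. scale (rint (h * b)) a) \<Lambda> = sw (\<lambda>a b. scale (rint b) (S h * a)) \<Lambda>"
    by (rule casimir_left) (simp add: rint_simps ac_simps)
  also have "\<dots> = S h * sw (\<lambda>a b. scale (rint b) a) \<Lambda>"
    by (simp flip: sw_mult_left add: rint_simps)
  finally show ?thesis by (simp add: rint_int_dual)
qed

lemma rint_nondegenerate:
  assumes "\<And>k. rint (x * k) = rint (y * k)"
  shows "x = y"
  using antipode_as_sum[of x] antipode_as_sum[of y] antipode_inj[of x y] by (simp add: assms)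

text \<open>
  The left integral of the dual. By cyclicity of the trace it is \<open>Tr (y \<mapsto> S\<^sup>2(y) x)\<close>.
\<close>

definition lint :: "'h \<Rightarrow> 'k" where "lint x = rint (S x)"

lemma lint_add: "lint (x + y) = lint x + lint y"
  by (simp add: lint_def hopf_linear rint_add)

lemma lint_scale: "lint (scale c x) = c * lint x"
  by (simp add: lint_def hopf_linear rint_scale)

lemmas lint_simps = rint_simps lint_add lint_scale

lemma linear_map_S: "linear_map S" "linear_map (\<lambda>x. S (S x))"
  by (simp_all add: linear_map_def hopf_linear)

lemma lint_eq_Tr: "lint x = Tr (\<lambda>y. S (S y) * x)"
proof -
  have "Tr (\<lambda>y. S (S y * x)) = Tr (\<lambda>y. S (S y) * x)"
    using Tr_commute[of S "\<lambda>y. S y * x"] by (simp add: linear_map_def rint_simps)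
  then show ?thesis by (simp add: lint_def rint_def antipode_mult)
qed

lemma lint_antipode: "lint (S x) = rint x"
proof -
  have "Tr (\<lambda>y. S (x * S y)) = Tr (\<lambda>y. x * S (S y))"
    using Tr_commute[of S "\<lambda>y. x * S y"] by (simp add: linear_map_def rint_simps)
  then show ?thesis by (simp add: lint_eq_Tr rint_def antipode_mult)
qed

lemma rint_antipode2: "rint (S (S x)) = rint x"
  using lint_antipode[of x] by (simp add: lint_def)

lemma lint_left_integral: "sw (\<lambda>a b. scale (lint a) b) h = scale (lint h) 1"
proof (rule antipode_inj)
  have "S (sw (\<lambda>a b. scale (lint a) b) h) = sw (\<lambda>a b. scale (rint (S a)) (S b)) h"
    by (subst sw_hom[of S]) (simp_all add: rint_simps lint_def)
  also have "\<dots> = sw (\<lambda>a b. scale (rint b) a) (S h)"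
    by (rule sw_antipode[symmetric]) (simp add: rint_simps ac_simps)
  finally show "S (sw (\<lambda>a b. scale (lint a) b) h) = S (scale (lint h) 1)"
    by (simp add: rint_right_integral lint_def hopf_linear antipode_one)
qed

text \<open>
  The two integrals are traces twisted by \<open>S\<^sup>2\<close>, on opposite sides.
\<close>

lemma rint_twist: "rint (x * y) = rint (y * S (S x))"
  unfolding rint_def
  using Tr_commute[of "\<lambda>z. x * z" "\<lambda>z. y * S (S z)"]
  by (simp add: linear_map_def rint_simps antipode_mult)

lemma lint_twist: "lint (x * y) = lint (S (S y) * x)"
  unfolding lint_eq_Tr
  using Tr_commute[of "\<lambda>z. S (S z) * x" "\<lambda>z. z * y"]
  by (simp add: linear_map_def rint_simps antipode_mult)

lemma chi_commute: "chi (x * y) = chi (y * x)"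
proof -
  have "Tr (\<lambda>z. x * (y * z)) = Tr (\<lambda>z. y * (x * z))"
    by (rule Tr_commute) (simp_all add: linear_map_def rint_simps)
  then show ?thesis unfolding chi_def mult.assoc .
qed

lemma casimir_commute:
  assumes "bal F"
  shows "sw (\<lambda>a b. F (h * a) (S b)) \<Lambda> = sw (\<lambda>a b. F a (S b * h)) \<Lambda>"
proof -
  obtain g where h: "h = S g" using antipode_surj by metis
  have "bal (\<lambda>a b. F a (S b))"
    using assms by (simp add: balanced2_def hopf_linear)
  from casimir_left[OF this, of g] show ?thesis
    by (simp add: h antipode_mult)
qed

text \<open>
  The legs of \<open>\<Sum> \<Lambda>\<^sub>1 \<otimes> S(\<Lambda>\<^sub>2)\<close> are dual bases for the bilinear form \<open>lint (x y)\<close>, so every trace can be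
  written with \<open>\<Lambda>\<close>.
\<close>

lemma dual_basis: "sw (\<lambda>a b. scale (lint (S b * h)) a) \<Lambda> = h"
proof -
  have "sw (\<lambda>a b. scale (lint (S b * h)) a) \<Lambda> = sw (\<lambda>a b. scale (lint (S b)) (h * a)) \<Lambda>"
    by (rule casimir_commute[symmetric]) (simp add: lint_simps ac_simps)
  also have "\<dots> = h * sw (\<lambda>a b. scale (lint (S b)) a) \<Lambda>"
    by (simp flip: sw_mult_left add: lint_simps)
  finally show ?thesis by (simp add: lint_antipode rint_int_dual)
qed

lemma sw_additive_hom:
  assumes "functional p" shows "p (sw F x) = sw (\<lambda>a b. p (F a b)) x"
  using assms by (intro sw_hom) (simp add: functional_def)

lemma Tr_dual_basis:
  assumes f: "linear_map f"
  shows "Tr f = sw (\<lambda>a b. lint (S b * f a)) \<Lambda>"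
proof -
  have fx: "f x = sw (\<lambda>a b. scale (lint (S b * x)) (f a)) \<Lambda>" for x
  proof -
    have "f x = f (sw (\<lambda>a b. scale (lint (S b * x)) a) \<Lambda>)" by (simp add: dual_basis)
    also have "\<dots> = sw (\<lambda>a b. scale (lint (S b * x)) (f a)) \<Lambda>"
      using f by (subst sw_hom[of f]) (simp_all add: linear_map_def)
    finally show ?thesis .
  qed
  have "Tr f = (\<Sum>c\<in>B. sw (\<lambda>a b. lint (S b * c) * coord c (f a)) \<Lambda>)"
    unfolding Tr_def by (subst fx) (simp add: sw_additive_hom[OF functional_coord] coord_scale)
  also have "\<dots> = sw (\<lambda>a b. Tr (\<lambda>c. scale (lint (S b * c)) (f a))) \<Lambda>"
    by (simp add: sw_sum Tr_def coord_scale)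
  also have "\<dots> = sw (\<lambda>a b. lint (S b * f a)) \<Lambda>"
    by (subst Tr_rank_one) (simp_all add: functional_def lint_simps)
  finally show ?thesis .
qed

lemma antipode_int: "S \<Lambda> = \<Lambda>"
proof -
  have "h * S \<Lambda> = scale (\<epsilon> h) (S \<Lambda>)" for h
  proof -
    obtain g where h: "h = S g" using antipode_surj by metis
    show ?thesis
      by (simp add: h int_right counit_antipode hopf_linear flip: antipode_mult)
  qed
  from this[of \<Lambda>] show ?thesis by (simp add: int_right counit_antipode counit_int)
qed

lemma lint_int: "lint \<Lambda> = 1"
  by (simp add: lint_def antipode_int rint_int)

lemma lint_int_dual: "sw (\<lambda>a b. scale (lint a) b) \<Lambda> = 1"
  by (simp add: lint_left_integral lint_int)

text \<open>
  The value \<open>\<gamma> h = \<Sum> lint(\<Lambda>\<^sub>1) \<gamma>(h \<Lambda>\<^sub>2)\<close> is computed by moving \<open>h\<close> to the first leg and using that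
  \<open>\<gamma>\<close> is an integral; only the factor \<open>\<gamma> \<Lambda>\<close> depends on \<open>\<gamma>\<close>.
\<close>

lemma right_integral_unique:
  assumes g: "functional \<gamma>" and int: "\<And>h. sw (\<lambda>a b. scale (\<gamma> b) a) h = scale (\<gamma> h) 1"
  shows "\<gamma> h = \<gamma> \<Lambda> * rint h"
proof -
  have [simp]: "\<gamma> (x + y) = \<gamma> x + \<gamma> y" "\<gamma> (scale c x) = c * \<gamma> x" for c x y
    using g by (simp_all add: functional_def)
  have 1: "sw (\<lambda>a b. scale (\<gamma> (h * b)) a) \<Lambda> = scale (\<gamma> \<Lambda>) (S h)"
  proof -
    have "sw (\<lambda>a b. scale (\<gamma> (h * b)) a) \<Lambda> = sw (\<lambda>a b. scale (\<gamma> b) (S h * a)) \<Lambda>"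
      by (rule casimir_left) (simp add: rint_simps ac_simps)
    also have "\<dots> = S h * sw (\<lambda>a b. scale (\<gamma> b) a) \<Lambda>"
      by (simp flip: sw_mult_left add: rint_simps)
    finally show ?thesis by (simp add: int scale_mult_right)
  qed
  have "\<gamma> h = \<gamma> (h * sw (\<lambda>a b. scale (lint a) b) \<Lambda>)" by (simp add: lint_int_dual)
  also have "\<dots> = sw (\<lambda>a b. lint (scale (\<gamma> (h * b)) a)) \<Lambda>"
    by (simp flip: sw_mult_left add: sw_additive_hom[OF g] scale_mult_right lint_scale ac_simps)
  also have "\<dots> = lint (sw (\<lambda>a b. scale (\<gamma> (h * b)) a) \<Lambda>)"
    by (rule sw_hom[symmetric]) (simp add: lint_add)
  finally show ?thesis by (simp add: 1 lint_scale lint_antipode)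
qed

text \<open>
  The distinguished group-like element, which measures the failure of the right integral to be
  a left integral.
\<close>

definition gr :: 'h where "gr = sw (\<lambda>a b. scale (rint a) b) \<Lambda>"

text \<open>
  For every functional \<open>p\<close> the convolution product of \<open>rint\<close> with \<open>p\<close> is again a right integral, hence
  a multiple of \<open>rint\<close>; the multiple is \<open>p gr\<close>.
\<close>

lemma rint_left_action: "sw (\<lambda>a b. scale (rint a) b) h = scale (rint h) gr"
proof -
  have *: "sw (\<lambda>a b. rint a * p b) h = p gr * rint h" if p: "functional p" for p h
  proof -
    have [simp]: "p (x + y) = p x + p y" "p (scale c x) = c * p x" for c x y
      using p by (simp_all add: functional_def)
    have "sw (\<lambda>a b. rint a * p b) h = sw (\<lambda>a b. rint a * p b) \<Lambda> * rint h"
    proof (rule right_integral_unique)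
      show "functional (sw (\<lambda>a b. rint a * p b))"
        by (simp add: functional_def rint_simps ac_simps)
      fix h
      have "sw (\<lambda>a b. scale (sw (\<lambda>a b. rint a * p b) b) a) h
          = sw (\<lambda>a t. sw (\<lambda>b c. scale (rint b * p c) a) t) h"
        by (subst sw_hom[where f = "\<lambda>z. scale z _"]) (simp_all add: scale_left_distrib)
      also have "\<dots> = sw (\<lambda>t c. sw (\<lambda>a b. scale (rint b * p c) a) t) h"
        by (rule sw_coassoc[symmetric]) (simp add: rint_simps ac_simps)
      also have "\<dots> = sw (\<lambda>t c. scale (p c) (sw (\<lambda>a b. scale (rint b) a) t)) h"
        by (simp flip: sw_scale_fun add: ac_simps)
      also have "\<dots> = sw (\<lambda>a b. scale (rint a * p b) 1) h"
        by (simp add: rint_right_integral ac_simps)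
      finally show "sw (\<lambda>a b. scale (sw (\<lambda>a b. rint a * p b) b) a) h = scale (sw (\<lambda>a b. rint a * p b) h) 1"
        by (subst sw_hom[where f = "\<lambda>z. scale z _"]) (simp_all add: scale_left_distrib)
    qed
    moreover have "sw (\<lambda>a b. rint a * p b) \<Lambda> = p gr"
      by (simp add: gr_def sw_additive_hom[OF p])
    ultimately show ?thesis by simp
  qed
  have "coord c (sw (\<lambda>a b. scale (rint a) b) h) = coord c (scale (rint h) gr)" for c
    using *[OF functional_coord, of c h] by (simp add: sw_additive_hom[OF functional_coord] coord_scale mult.commute)
  then show ?thesis by (metis (no_types, lifting) coord_expand sum.cong)
qed

text \<open>
  Both \<open>\<Delta> gr\<close> and \<open>gr \<otimes> gr\<close> result from \<open>\<Sum> rint(\<Lambda>\<^sub>1) \<Lambda>\<^sub>2 \<otimes> \<Lambda>\<^sub>3\<close>.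
\<close>

lemma sw_gr:
  assumes "bal F"
  shows "sw F gr = F gr gr"
proof -
  have F [simp]: "F (a + a') b = F a b + F a' b" "F a (b + b') = F a b + F a b'"
    "F (scale c a) b = F a (scale c b)" for a a' b b' c
    using assms by (auto simp: balanced2_def)
  have F1: "F (sw G x) c = sw (\<lambda>a b. F (G a b) c) x" for G x c
    by (rule sw_hom[where f = "\<lambda>z. F z c"]) simp
  have "sw F gr = sw (\<lambda>a b. sw F (scale (rint a) b)) \<Lambda>"
    unfolding gr_def by (rule sw_hom) (simp add: rint_simps)
  also have "\<dots> = sw (\<lambda>a t. sw (\<lambda>b c. F (scale (rint a) b) c) t) \<Lambda>"
    by (simp add: rint_simps)
  also have "\<dots> = sw (\<lambda>t c. sw (\<lambda>a b. F (scale (rint a) b) c) t) \<Lambda>"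
    by (rule sw_coassoc[symmetric]) (simp add: rint_simps ac_simps)
  also have "\<dots> = sw (\<lambda>t c. F (scale (rint t) gr) c) \<Lambda>"
    by (simp add: F1[symmetric] rint_left_action del: F(3))
  also have "\<dots> = sw (\<lambda>t c. F gr (scale (rint t) c)) \<Lambda>"
    by (simp only: F(3))
  also have "\<dots> = F gr (sw (\<lambda>t c. scale (rint t) c) \<Lambda>)"
    by (subst sw_hom[of "F gr"]) simp_all
  finally show ?thesis by (simp add: gr_def)
qed

text \<open>
  A right integral satisfies \<open>rint(g) g = rint(g) 1\<close> for a group-like \<open>g\<close>, so it vanishes at \<open>g\<close>
  unless \<open>g = 1\<close>, where the hypothesis applies.
\<close>

lemma rint_grouplike_power:
  assumes "rint 1 = 0"
  shows "rint (gr ^ n) = 0"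
proof -
  have p: "sw F (gr ^ n) = F (gr ^ n) (gr ^ n)" if "bal F" for F :: "'h \<Rightarrow> 'h \<Rightarrow> 'h"
    using that
  proof (induction n arbitrary: F)
    case 0
    then show ?case by (simp add: sw_one)
  next
    case (Suc n)
    have F: "F (a + a') b = F a b + F a' b" "F a (b + b') = F a b + F a b'"
      "F (scale c a) b = F a (scale c b)" for a a' b b' c
      using Suc.prems by (auto simp: balanced2_def)
    have "sw F (gr ^ Suc n) = sw (\<lambda>a b. F (a * gr ^ n) (b * gr ^ n)) gr"
      by (simp only: power_Suc sw_mult[OF Suc.prems], subst Suc.IH) (simp_all add: rint_simps F)
    also have "\<dots> = F (gr * gr ^ n) (gr * gr ^ n)"
      by (rule sw_gr) (simp add: rint_simps F)
    finally show ?case by simp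
  qed
  have "scale (rint (gr ^ n)) (gr ^ n) = scale (rint (gr ^ n)) 1"
    using rint_right_integral[of "gr ^ n"] p[of "\<lambda>a b. scale (rint b) a"] by (simp add: rint_simps ac_simps)
  then show ?thesis
    using assms by (cases "rint (gr ^ n) = 0") (simp_all add: scale_left_imp_eq)
qed

lemma rint_eq_lint_gr: "rint h = lint (S gr * h)"
proof -
  have "functional rint" by (simp add: functional_def rint_simps)
  have "rint h = sw (\<lambda>a b. lint (S (scale (rint a) b) * h)) \<Lambda>"
    by (subst dual_basis[of h, symmetric])
      (simp add: sw_additive_hom[OF \<open>functional rint\<close>] lint_simps ac_simps)
  also have "\<dots> = lint (S gr * h)"
    unfolding gr_def by (rule sw_hom[symmetric]) (simp add: lint_simps)
  finally show ?thesis .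
qed

text \<open>
  The powers of \<open>S gr\<close> are the elements that \<open>rho_antipode_gr_power\<close> computes in each block.
\<close>

lemma rint_antipode_grouplike_power:
  assumes "rint 1 = 0"
  shows "rint (S gr ^ n) = 0"
proof -
  have Sp: "S (x ^ n) = S x ^ n" for x n
    by (induction n) (simp_all add: antipode_one antipode_mult power_commutes)
  have "rint (S gr ^ n) = lint (S gr ^ Suc n)" by (simp add: rint_eq_lint_gr)
  also have "\<dots> = rint (gr ^ Suc n)"
    by (simp only: lint_def Sp[symmetric] rint_antipode2)
  also have "\<dots> = 0" by (rule rint_grouplike_power[OF assms])
  finally show ?thesis .
qed

text \<open>
  If the trace \<open>rint 1\<close> of \<open>S\<^sup>2\<close> does not vanish, then \<open>\<Sum> lint(h\<^sub>1) rint(h\<^sub>2)\<close>, evaluated in two ways,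
  identifies the left and the right integral.
\<close>

lemma lint_eq_rint:
  assumes "rint 1 \<noteq> 0"
  shows "lint h = rint h"
proof -
  have "rint (sw (\<lambda>a b. scale (lint a) b) h) = sw (\<lambda>a b. lint a * rint b) h"
    by (subst sw_hom[of rint]) (simp_all add: lint_simps)
  moreover have "lint (sw (\<lambda>a b. scale (rint b) a) h) = sw (\<lambda>a b. lint a * rint b) h"
    by (subst sw_hom[of lint]) (simp_all add: lint_simps mult.commute)
  moreover have "lint 1 = rint 1" by (simp add: lint_def antipode_one)
  moreover have "rint (sw (\<lambda>a b. scale (lint a) b) h) = lint h * rint 1"
    "lint (sw (\<lambda>a b. scale (rint b) a) h) = rint h * lint 1"
    by (simp_all add: lint_left_integral rint_right_integral lint_simps)
  ultimately show ?thesis using assms by (metis mult_right_cancel)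
qed

text \<open>
  The opposite twists \<open>rint_twist\<close> and \<open>lint_twist\<close> of one nondegenerate form differ by \<open>S\<^sup>4\<close>.
\<close>

lemma antipode_order_4:
  assumes "rint 1 \<noteq> 0"
  shows "S (S (S (S x))) = x"
proof (rule rint_nondegenerate)
  fix k
  have "rint (x * k) = rint (k * S (S x))" by (rule rint_twist)
  also have "\<dots> = lint (k * S (S x))" by (rule lint_eq_rint[OF assms, symmetric])
  also have "\<dots> = lint (S (S (S (S x))) * k)" by (rule lint_twist)
  also have "\<dots> = rint (S (S (S (S x))) * k)" by (rule lint_eq_rint[OF assms])
  finally show "rint (S (S (S (S x))) * k) = rint (x * k)" by simp
qed

section \<open>If the trace of the squared antipode is nonzero, the antipode is an involution\<close>

text \<open>
  The mirror image of \<open>trace_rotate\<close>, for scalar values.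
\<close>

lemma trace_rotate_left:
  assumes phi: "linear_map \<phi>" and Q: "bal Q" and Qs: "\<And>c u v. Q (scale c u) v = c * Q u v"
  shows "(\<Sum>b\<in>B. sw (\<lambda>t y. sw (\<lambda>u v. coord b u * Q v y) (\<phi> t)) b)
       = (\<Sum>b\<in>B. sw (\<lambda>u v. sw (\<lambda>u1 u2. coord b u1 * Q v u2) u) (\<phi> b))"
proof -
  have [simp]: "\<phi> (x + y) = \<phi> x + \<phi> y" "\<phi> (scale c x) = scale c (\<phi> x)" for c x y
    using phi by (auto simp: linear_map_def)
  have Q2: "Q u (scale c v) = c * Q u v" for c u v
    using Q Qs by (metis balanced2_def)
  have [simp]: "Q (u + u') v = Q u v + Q u' v" "Q u (v + v') = Q u v + Q u v'" for u u' v v'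
    using Q by (auto simp: balanced2_def)
  note [simp] = Qs Q2
  have 1: "sw (\<lambda>u v. coord b u * Q v y) (\<phi> t)
      = (\<Sum>c\<in>B. coord c t * (sw (\<lambda>u v. coord b u * Q v y) (\<phi> c)))" for b y t
    by (rule functional_expand) (simp add: functional_def rint_simps ac_simps)
  have 2: "sw (\<lambda>u1 u2. coord c u1 * Q v u2) u
      = (\<Sum>b\<in>B. coord b u * (sw (\<lambda>u1 u2. coord c u1 * Q v u2) b))" for c u v
    by (rule functional_expand) (simp add: functional_def rint_simps ac_simps)
  have "(\<Sum>b\<in>B. sw (\<lambda>t y. sw (\<lambda>u v. coord b u * Q v y) (\<phi> t)) b)
     = (\<Sum>b\<in>B. \<Sum>c\<in>B. sw (\<lambda>t y. coord c t * (sw (\<lambda>u v. coord b u * Q v y) (\<phi> c))) b)"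
    by (subst 1) (simp add: sw_sum)
  also have "\<dots> = (\<Sum>b\<in>B. \<Sum>c\<in>B. sw (\<lambda>u v. coord b u * (sw (\<lambda>u1 u2. coord c u1 * Q v u2) b)) (\<phi> c))"
    by (simp only: sw_mult_left[symmetric], subst sw_swap) (simp add: ac_simps)
  also have "\<dots> = (\<Sum>c\<in>B. sw (\<lambda>u v. sw (\<lambda>u1 u2. coord c u1 * Q v u2) u) (\<phi> c))"
    by (subst 2) (simp add: sw_sum, rule sum.swap)
  finally show ?thesis .
qed

lemma chi_one: "chi 1 = of_nat (card B)"
  by (simp add: chi_def Tr_id)

text \<open>
  The character form of the isomorphism of \<open>H \<otimes> H\<close> with a direct sum of copies of \<open>H\<close>. As for
  \<open>rint_right_integral\<close>, inserting \<open>y\<^sub>2 S(y\<^sub>3)\<close> and rotating the trace makes an antipode cancel.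
\<close>

lemma chi_square: "sw (\<lambda>a b. chi a * chi b) h = of_nat (card B) * chi h"
proof -
  define \<phi> where "\<phi> t = h * t" for t
  have phi: "linear_map \<phi>" by (simp add: linear_map_def \<phi>_def rint_simps)
  define Q where "Q v y = chi (v * S y)" for v y
  have Q: "bal Q" "Q (scale c u) v = c * Q u v" for c u v by (simp_all add: Q_def[abs_def] rint_simps)
  have Qe: "Q v y = chi (S y * v)" for v y unfolding Q_def by (rule chi_commute)
  have 1: "sw (\<lambda>h1 h2. coord b (h1 * y) * chi h2) h
     = sw (\<lambda>t y3. sw (\<lambda>u v. coord b u * Q v y3) (\<phi> t)) y" for b y
  proof -
    have "sw (\<lambda>h1 h2. coord b (h1 * y) * chi h2) h
        = sw (\<lambda>y1 t. sw (\<lambda>h1 h2. coord b (h1 * y1) * chi (h2 * (scale (\<epsilon> t) 1))) h) y"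
      using sw_counit_right[of "\<lambda>z. sw (\<lambda>h1 h2. coord b (h1 * z) * chi h2) h" y]
      by (simp add: rint_simps ac_simps)
    also have "\<dots> = sw (\<lambda>y1 t. sw (\<lambda>y2 y3. sw (\<lambda>h1 h2. coord b (h1 * y1) * chi (h2 * (y2 * S y3))) h) t) y"
      by (subst sw_antipode_right[of "\<lambda>z. sw (\<lambda>h1 h2. coord b (h1 * y1) * chi (h2 * z)) h" for y1])
         (simp_all add: rint_simps)
    also have "\<dots> = sw (\<lambda>p y3. sw (\<lambda>y1 y2. sw (\<lambda>h1 h2. coord b (h1 * y1) * chi (h2 * (y2 * S y3))) h) p) y"
      by (rule sw_coassoc[symmetric]) (simp add: rint_simps ac_simps)
    also have "\<dots> = sw (\<lambda>p y3. sw (\<lambda>h1 h2. sw (\<lambda>y1 y2. coord b (h1 * y1) * chi (h2 * (y2 * S y3))) p) h) y"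
      by (subst sw_swap) simp
    also have "\<dots> = sw (\<lambda>t y3. sw (\<lambda>u v. coord b u * Q v y3) (\<phi> t)) y"
      unfolding \<phi>_def by (subst sw_mult) (simp_all add: rint_simps ac_simps Q_def)
    finally show ?thesis .
  qed
  have 2: "sw (\<lambda>u v. sw (\<lambda>u1 u2. coord b u1 * Q v u2) u) z = of_nat (card B) * coord b z" for b z
  proof -
    have "sw (\<lambda>u v. sw (\<lambda>u1 u2. coord b u1 * Q v u2) u) z
       = sw (\<lambda>u v. sw (\<lambda>u1 u2. coord b u1 * chi (S u2 * v)) u) z"
      unfolding Qe ..
    also have "\<dots> = sw (\<lambda>u1 t. sw (\<lambda>u2 v. coord b u1 * chi (S u2 * v)) t) z"
      by (rule sw_coassoc) (simp_all add: rint_simps ac_simps)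
    also have "\<dots> = sw (\<lambda>u1 t. coord b u1 * chi (scale (\<epsilon> t) 1)) z"
      by (subst sw_antipode_left) (simp_all add: rint_simps ac_simps)
    also have "\<dots> = sw (\<lambda>u1 t. chi 1 * coord b (scale (\<epsilon> t) u1)) z"
      by (simp add: rint_simps ac_simps)
    also have "\<dots> = chi 1 * coord b z"
      by (rule sw_counit_right) (simp add: rint_simps)
    finally show ?thesis by (simp add: chi_one)
  qed
  have "sw (\<lambda>a b. chi a * chi b) h = (\<Sum>b\<in>B. sw (\<lambda>h1 h2. coord b (h1 * b) * chi h2) h)"
    by (subst chi_def) (simp add: Tr_def sum_distrib_right sw_sum)
  also have "\<dots> = (\<Sum>b\<in>B. sw (\<lambda>u v. sw (\<lambda>u1 u2. coord b u1 * Q v u2) u) (\<phi> b))"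
    unfolding 1 by (rule trace_rotate_left[OF phi Q])
  also have "\<dots> = of_nat (card B) * chi h"
    unfolding 2 by (simp add: chi_def Tr_def sum_distrib_left \<phi>_def)
  finally show ?thesis .
qed

text \<open>
  Dual bases turn the trace into \<open>\<Sum> chi(\<Lambda>\<^sub>1) lint(S(\<Lambda>\<^sub>3) S\<^sup>2(\<Lambda>\<^sub>2))\<close>, and
  \<open>S(\<Lambda>\<^sub>3) S\<^sup>2(\<Lambda>\<^sub>2) = S(S(\<Lambda>\<^sub>2) \<Lambda>\<^sub>3)\<close> collapses.
\<close>

lemma Tr_chi_antipode2:
  "Tr (sw (\<lambda>a b. scale (chi a) (S (S b)))) = rint 1"
proof -
  have "Tr (sw (\<lambda>a b. scale (chi a) (S (S b))))
      = sw (\<lambda>p c. lint (S c * sw (\<lambda>a b. scale (chi a) (S (S b))) p)) \<Lambda>"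
    by (rule Tr_dual_basis) (simp add: linear_map_def rint_simps ac_simps)
  also have "\<dots> = sw (\<lambda>p c. sw (\<lambda>a b. chi a * lint (S (S b * c))) p) \<Lambda>"
    by (subst sw_hom[where f = "\<lambda>z. lint (_ * z)"]) (simp_all add: lint_simps antipode_mult)
  also have "\<dots> = sw (\<lambda>a t. sw (\<lambda>b c. chi a * lint (S (S b * c))) t) \<Lambda>"
    by (rule sw_coassoc) (simp add: lint_simps ac_simps)
  also have "\<dots> = sw (\<lambda>a t. chi a * lint (S (scale (\<epsilon> t) 1))) \<Lambda>"
    by (subst sw_antipode_left) (simp_all add: lint_simps ac_simps)
  also have "\<dots> = sw (\<lambda>a t. lint 1 * chi (scale (\<epsilon> t) a)) \<Lambda>"
    by (simp add: lint_simps antipode_one ac_simps)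
  also have "\<dots> = lint 1 * chi \<Lambda>"
    by (rule sw_counit_right) (simp add: rint_simps)
  finally show ?thesis by (simp add: chi_int lint_def antipode_one)
qed

lemma rint_one: "rint 1 = Tr (\<lambda>x. S (S x))"
  by (simp add: rint_def)

end

locale semisimple_hopf_algebra = hopf_algebra_with_integral scale \<Delta> \<epsilon> S B \<Lambda>
  for scale :: "'k::{alg_closed_field, field_char_0} \<Rightarrow> 'h::ring_1 \<Rightarrow> 'h" and \<Delta> \<epsilon> S B \<Lambda>
begin

text \<open>
  The argument of Larson and Radford. Since \<open>chi_square\<close> makes \<open>chi / d\<close> a convolution
  idempotent, \<open>P(x) = \<Sum> chi(x\<^sub>1) x\<^sub>2 / d\<close> is idempotent. It commutes with the involution \<open>S\<^sup>2\<close>, so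
  the trace of \<open>P S\<^sup>2\<close> is an integer \<open>m\<close>, and \<open>Tr_chi_antipode2\<close> says \<open>Tr (S\<^sup>2) = d m\<close>. If \<open>a\<close> and \<open>b\<close> are
  the multiplicities of \<open>1\<close> and \<open>-1\<close> in \<open>S\<^sup>2\<close>, then \<open>a - b = (a + b) m\<close> with \<open>m \<noteq> 0\<close>, which leaves
  \<open>b = 0\<close>, because \<open>a \<noteq> 0\<close> on account of \<open>S\<^sup>2(1) = 1\<close>.
\<close>

lemma antipode_involutive_if_trace_nonzero:
  assumes D: "rint 1 \<noteq> 0"
  shows "S (S x) = x"
proof -
  define d where "d = (of_nat (card B) :: 'k)"
  define \<sigma> where "\<sigma> x = S (S x)" for x
  have \<sigma>\<sigma>: "\<sigma> (\<sigma> x) = x" for x by (simp add: \<sigma>_def antipode_order_4[OF D])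
  have \<sigma>_lin: "linear_map \<sigma>" using linear_map_S(2) by (simp add: \<sigma>_def[abs_def])
  have \<sigma>_simps: "\<sigma> (x + y) = \<sigma> x + \<sigma> y" "\<sigma> (scale c x) = scale c (\<sigma> x)" "\<sigma> (x * y) = \<sigma> x * \<sigma> y" "\<sigma> 1 = 1" for x y c
    by (simp_all add: \<sigma>_def rint_simps antipode_mult antipode_one)
  have "card B \<noteq> 0"
    using coord_expand[of 1] finite_Basis by (cases "B = {}") auto
  then have d: "d \<noteq> 0" by (simp add: d_def)
  define P where "P = sw (\<lambda>a b. scale (chi a / d) b)"
  have P_lin: "linear_map P"
    by (simp add: P_def linear_map_def rint_simps add_divide_distrib ac_simps flip: times_divide_eq_right)
  have P_simps: "P (x + y) = P x + P y" "P (scale c x) = scale c (P x)" for x y c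
    using P_lin by (simp_all add: linear_map_def)
  have chi_\<sigma>: "chi (\<sigma> x) = chi x" for x
  proof -
    have "Tr (\<lambda>y. \<sigma> (x * \<sigma> y)) = Tr (\<lambda>y. x * \<sigma> (\<sigma> y))"
      by (rule Tr_commute) (simp_all add: linear_map_def \<sigma>_simps rint_simps)
    then show ?thesis by (simp add: \<sigma>_simps \<sigma>\<sigma> chi_def)
  qed
  have P\<sigma>: "P (\<sigma> x) = \<sigma> (P x)" for x
  proof -
    have "P (\<sigma> x) = sw (\<lambda>a b. scale (chi (\<sigma> a) / d) (\<sigma> b)) x"
      unfolding P_def \<sigma>_def
      by (subst sw_antipode2) (simp_all add: rint_simps add_divide_distrib ac_simps)
    also have "\<dots> = \<sigma> (P x)"
      unfolding chi_\<sigma> P_def by (subst sw_hom[of \<sigma>]) (simp_all add: \<sigma>_simps)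
    finally show ?thesis .
  qed
  have PP: "P (P x) = P x" for x
  proof -
    have "P (P x) = sw (\<lambda>a t. sw (\<lambda>b c. scale (chi a / d * (chi b / d)) c) t) x"
      by (subst (2) P_def, subst sw_hom[of P]) (simp_all add: P_simps, simp add: P_def flip: sw_scale_fun)
    also have "\<dots> = sw (\<lambda>t c. sw (\<lambda>a b. scale (chi a / d * (chi b / d)) c) t) x"
      by (rule sw_coassoc[symmetric]) (simp add: rint_simps add_divide_distrib ac_simps)
    also have "\<dots> = sw (\<lambda>t c. scale (sw (\<lambda>a b. inverse d * inverse d * (chi a * chi b)) t) c) x"
      by (subst sw_hom[where f = "\<lambda>z. scale z _"]) (simp_all add: scale_left_distrib divide_inverse ac_simps)
    also have "\<dots> = P x"
    proof -
      have "inverse d * inverse d * (d * z) = z / d" for z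
        using d by (simp add: divide_inverse)
      then show ?thesis
        by (simp only: sw_mult_left chi_square P_def d_def[symmetric])
    qed
    finally show ?thesis .
  qed
  have TP: "Tr (\<lambda>x. P (\<sigma> x)) = rint 1 / d"
  proof -
    have "P (\<sigma> x) = scale (inverse d) (sw (\<lambda>a b. scale (chi a) (S (S b))) x)" for x
      by (simp only: P\<sigma>, subst P_def, subst sw_hom[of \<sigma>]) (simp_all add: \<sigma>_simps, simp add: \<sigma>_def divide_inverse ac_simps flip: sw_scale_fun)
    then have "Tr (\<lambda>x. P (\<sigma> x)) = inverse d * Tr (sw (\<lambda>a b. scale (chi a) (S (S b))))"
      by (simp add: Tr_scale)
    then show ?thesis by (simp add: Tr_chi_antipode2 divide_inverse)
  qed
  obtain m :: int where m: "rint 1 = d * of_int m"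
  proof -
    obtain a b :: nat where "Tr (\<lambda>x. P (\<sigma> x)) = of_nat a - of_nat b"
      by (rule Tr_idempotent_involution[OF _ P_lin PP P\<sigma> \<sigma>_lin \<sigma>\<sigma>]) simp_all
    then have "rint 1 / d = of_nat a - of_nat b" by (simp only: TP)
    then have "rint 1 = d * of_int (int a - int b)" using d by (simp add: divide_eq_eq mult.commute)
    then show ?thesis by (rule that)
  qed
  obtain a b where ab: "Tr \<sigma> = of_nat a - of_nat b" "Tr (\<lambda>x. x) = of_nat a + of_nat b"
      "\<And>x. a = 0 \<Longrightarrow> x + \<sigma> x = 0" "\<And>x. b = 0 \<Longrightarrow> x - \<sigma> x = 0"
    by (rule Tr_idempotent_involution[of "\<lambda>x. x" \<sigma>]) (simp_all add: linear_map_def \<sigma>\<sigma> \<sigma>_simps)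
  have "a \<noteq> 0"
  proof
    assume "a = 0"
    then have "(1::'h) + 1 = 0" using ab(3) \<sigma>_simps(4) by metis
    then have "scale 2 (1::'h) = 0" using scale_left_distrib[of 1 1 "1::'h"] by simp
    then show False by simp
  qed
  have cardB: "card B = a + b"
    using ab(2) by (simp add: Tr_id flip: of_nat_add)
  have "of_int (int a - int b) = (of_int ((int a + int b) * m) :: 'k)"
    using m ab(1) by (simp add: rint_one \<sigma>_def[abs_def] d_def cardB)
  then have "int a - int b = (int a + int b) * m" by (simp only: of_int_eq_iff)
  moreover have "m \<noteq> 0" using m D by auto
  ultimately have "b = 0"
  proof (cases "m > 0")
    case True
    then have "(int a + int b) * 1 \<le> (int a + int b) * m" by (intro mult_left_mono) auto
    then show ?thesis using \<open>int a - int b = _\<close> by simp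
  next
    case False
    then have "(int a + int b) * m \<le> (int a + int b) * (- 1)"
      using \<open>m \<noteq> 0\<close> by (intro mult_left_mono) auto
    then show ?thesis using \<open>int a - int b = _\<close> \<open>a \<noteq> 0\<close> by simp
  qed
  then show ?thesis using ab(4) by (simp add: \<sigma>_def)
qed

end

section \<open>Traces of matrix powers and a positivity principle\<close>

definition mat_trace :: "'a::comm_monoid_add mat \<Rightarrow> 'a" where
  "mat_trace A = (\<Sum>i<dim_row A. A $$ (i, i))"

lemma mat_mult_index:
  assumes "A \<in> carrier_mat n m" "C \<in> carrier_mat m l" "i < n" "j < l"
  shows "(A * C) $$ (i, j) = (\<Sum>t<m. A $$ (i, t) * C $$ (t, j))"
  using assms by (auto simp: scalar_prod_def lessThan_atLeast0 intro!: sum.cong)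

lemma mat_trace_commute:
  fixes A :: "'a::comm_ring_1 mat"
  assumes "A \<in> carrier_mat n m" "C \<in> carrier_mat m n"
  shows "mat_trace (A * C) = mat_trace (C * A)"
proof -
  have "mat_trace (A * C) = (\<Sum>i<n. \<Sum>t<m. A $$ (i, t) * C $$ (t, i))"
    using assms mat_mult_index[OF assms] by (auto simp: mat_trace_def intro!: sum.cong)
  also have "\<dots> = (\<Sum>t<m. \<Sum>i<n. C $$ (t, i) * A $$ (i, t))"
    by (subst sum.swap) (simp add: mult.commute)
  also have "\<dots> = mat_trace (C * A)"
    using assms mat_mult_index[OF assms(2,1)] by (auto simp: mat_trace_def intro!: sum.cong)
  finally show ?thesis .
qed

lemma mat_trace_similar:
  fixes A :: "'a::comm_ring_1 mat"
  assumes "similar_mat_wit A C P Q"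
  shows "mat_trace A = mat_trace C"
proof -
  obtain n where n: "n = dim_row A" by simp
  note D = similar_mat_witD[OF n assms]
  have "mat_trace A = mat_trace (P * (C * Q))"
    using assoc_mult_mat[OF D(6,5,7)] by (simp only: D(3))
  also have "\<dots> = mat_trace (C * Q * P)"
    by (rule mat_trace_commute[OF D(6) mult_carrier_mat[OF D(5,7)]])
  also have "C * Q * P = C * (Q * P)" by (rule assoc_mult_mat[OF D(5,7,6)])
  also have "\<dots> = C" unfolding D(2) by (rule right_mult_one_mat[OF D(5)])
  finally show ?thesis .
qed

lemma sum_delete_index:
  assumes "k < Suc n"
  shows "(\<Sum>i<Suc n. f i) = f k + (\<Sum>i<n. f (insert_index k i))"
proof -
  have "(\<Sum>i<n. f (insert_index k i)) = (\<Sum>i\<in>insert_index k ` {..<n}. f i)"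
    by (subst sum.reindex) (auto simp: insert_index_inj_on)
  also have "insert_index k ` {..<n} = {..<Suc n} - {k}"
    using insert_index_image[OF assms] by (simp add: lessThan_atLeast0)
  finally show ?thesis using assms by (subst sum.remove[of _ k]) auto
qed

lemma insert_index_less: "i < n \<Longrightarrow> insert_index k i < Suc n"
  by (simp add: insert_index_def)

text \<open>
  If the \<open>k\<close>-th standard basis vector is an eigenvector, it spans an invariant subspace, and the minor
  without row and column \<open>k\<close> describes the action on the quotient.
\<close>
lemma pow_mat_deflate:
  fixes C :: "'a::comm_ring_1 mat"
  assumes C: "C \<in> carrier_mat (Suc n) (Suc n)" and k: "k < Suc n"
    and col: "\<And>i. i < Suc n \<Longrightarrow> C $$ (i, k) = (if i = k then e else 0)"
  shows "mat_delete (C ^\<^sub>m m) k k = mat_delete C k k ^\<^sub>m m" (is ?A)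
    and "(C ^\<^sub>m m) $$ (k, k) = e ^ m" (is ?B)
proof -
  have Cm: "C ^\<^sub>m m \<in> carrier_mat (Suc n) (Suc n)" for m using C by (rule pow_carrier_mat)
  have Dc: "mat_delete C k k \<in> carrier_mat n n" using mat_delete_carrier[OF C] by simp
  have Dm: "mat_delete C k k ^\<^sub>m m \<in> carrier_mat n n" for m using Dc by (rule pow_carrier_mat)
  have cols: "(C ^\<^sub>m m) $$ (i, k) = (if i = k then e ^ m else 0)" if "i < Suc n" for i m
    using that
  proof (induction m arbitrary: i)
    case 0
    then show ?case using C k by auto
  next
    case (Suc m)
    have "(C ^\<^sub>m Suc m) $$ (i, k) = (\<Sum>t<Suc n. (C ^\<^sub>m m) $$ (i, t) * C $$ (t, k))"
      using mat_mult_index[OF Cm C Suc.prems k] by simp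
    also have "\<dots> = (\<Sum>t<Suc n. if t = k then (C ^\<^sub>m m) $$ (i, k) * e else 0)"
      using col by (intro sum.cong) auto
    also have "\<dots> = (C ^\<^sub>m m) $$ (i, k) * e" using k by (subst sum.delta) auto
    finally show ?case using Suc by simp
  qed
  show ?B using cols[OF k] by simp
  show ?A
  proof (induction m)
    case 0
    have "mat_delete (1\<^sub>m (Suc n)) k k = (1\<^sub>m n :: 'a mat)"
      using k by (auto simp: mat_delete_def insert_index_def)
    then show ?case using C Dc by simp
  next
    case (Suc m)
    show ?case
    proof (rule eq_matI)
      fix i j assume ij: "i < dim_row (mat_delete C k k ^\<^sub>m Suc m)" "j < dim_col (mat_delete C k k ^\<^sub>m Suc m)"
      then have ij: "i < n" "j < n" using Dm[of "Suc m"] by auto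
      have del: "mat_delete M k k $$ (i, j) = M $$ (insert_index k i, insert_index k j)"
        if "M \<in> carrier_mat (Suc n) (Suc n)" "i < n" "j < n" for M :: "'a mat" and i j
        using mat_delete_index[of M n k k i j] that k by simp
      have "mat_delete (C ^\<^sub>m Suc m) k k $$ (i, j)
          = (\<Sum>t<Suc n. (C ^\<^sub>m m) $$ (insert_index k i, t) * C $$ (t, insert_index k j))"
        using mat_mult_index[OF Cm C, of "insert_index k i" "insert_index k j" m] ij
        by (subst del[OF Cm ij]) (simp add: insert_index_less)
      also have "\<dots> = (\<Sum>t<n. (C ^\<^sub>m m) $$ (insert_index k i, insert_index k t) * C $$ (insert_index k t, insert_index k j))"
        using cols[of "insert_index k i" m] ij by (subst sum_delete_index[OF k]) (simp add: insert_index_less)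
      also have "\<dots> = (\<Sum>t<n. mat_delete (C ^\<^sub>m m) k k $$ (i, t) * mat_delete C k k $$ (t, j))"
        using ij by (intro sum.cong) (auto simp: del Cm C)
      also have "\<dots> = (mat_delete C k k ^\<^sub>m Suc m) $$ (i, j)"
        using mat_mult_index[OF Dm Dc ij] by (simp add: Suc)
      finally show "mat_delete (C ^\<^sub>m Suc m) k k $$ (i, j) = (mat_delete C k k ^\<^sub>m Suc m) $$ (i, j)" .
    qed (use Cm[of "Suc m"] Dm[of "Suc m"] in auto)
  qed
qed

text \<open>
  The list \<open>es\<close> consists of the eigenvalues with multiplicity. Each step of the induction makes an
  eigenvector the \<open>k\<close>-th basis vector, where \<open>k\<close> is a position at which it does not vanish, and
  deletes row and column \<open>k\<close>.
\<close>

lemma trace_power_sums: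
  fixes A :: "'a::alg_closed_field mat"
  assumes "A \<in> carrier_mat n n"
  shows "\<exists>es. \<forall>m. mat_trace (A ^\<^sub>m m) = (\<Sum>e\<leftarrow>es. e ^ m)"
  using assms
proof (induction n arbitrary: A)
  case 0
  then have "mat_trace (A ^\<^sub>m m) = 0" for m using pow_carrier_mat[OF 0] by (simp add: mat_trace_def)
  then show ?case by (intro exI[of _ "[]"]) simp
next
  case (Suc n)
  note A = Suc.prems
  have "degree (char_poly A) > 0" using degree_monic_char_poly[OF A] by simp
  then obtain e where "poly (char_poly A) e = 0" using alg_closed_imp_poly_has_root by blast
  then obtain v where v: "v \<in> carrier_vec (Suc n)" "v \<noteq> 0\<^sub>v (Suc n)" "A *\<^sub>v v = e \<cdot>\<^sub>v v"
    using eigenvalue_root_char_poly[OF A] A unfolding eigenvalue_def eigenvector_def by auto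
  have "\<exists>k<Suc n. v $ k \<noteq> 0"
  proof (rule ccontr)
    assume "\<not> ?thesis"
    then have "v = 0\<^sub>v (Suc n)" using v(1) by (intro eq_vecI) auto
    then show False using v(2) by simp
  qed
  then obtain k where k: "k < Suc n" "v $ k \<noteq> 0" by blast
  define P where "P = mat (Suc n) (Suc n) (\<lambda>(i, j). if j = k then v $ i else if i = j then 1 else 0)"
  define Q where "Q = mat (Suc n) (Suc n) (\<lambda>(i, j). if j = k then (if i = k then 1 / v $ k else - v $ i / v $ k)
     else if i = j then 1 else 0)"
  have PQc: "P \<in> carrier_mat (Suc n) (Suc n)" "Q \<in> carrier_mat (Suc n) (Suc n)" by (auto simp: P_def Q_def)
  have PQ: "P * Q = 1\<^sub>m (Suc n)"
  proof (rule eq_matI)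
    fix i j assume "i < dim_row (1\<^sub>m (Suc n) :: 'a mat)" "j < dim_col (1\<^sub>m (Suc n) :: 'a mat)"
    then have ij: "i < Suc n" "j < Suc n" by auto
    have "(P * Q) $$ (i, j) = (\<Sum>t<Suc n. P $$ (i, t) * Q $$ (t, j))"
      by (rule mat_mult_index[OF PQc ij])
    also have "\<dots> = v $ i * Q $$ (k, j) + (\<Sum>t\<in>{..<Suc n} - {k}. (if i = t then Q $$ (t, j) else 0))"
    proof -
      have "P $$ (i, t) * Q $$ (t, j) = (if i = t then Q $$ (t, j) else 0)" if "t \<in> {..<Suc n} - {k}" for t
        using that ij by (auto simp: P_def)
      moreover have "P $$ (i, k) = v $ i" using k ij by (simp add: P_def)
      ultimately show ?thesis using k by (subst sum.remove[of _ k]) auto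
    qed
    also have "\<dots> = v $ i * Q $$ (k, j) + (if i = k then 0 else Q $$ (i, j))"
      using ij by (subst sum.delta') auto
    also have "\<dots> = 1\<^sub>m (Suc n) $$ (i, j)" using k ij by (auto simp: Q_def)
    finally show "(P * Q) $$ (i, j) = 1\<^sub>m (Suc n) $$ (i, j)" .
  qed (use PQc in auto)
  have QP: "Q * P = 1\<^sub>m (Suc n)" using mat_mult_left_right_inverse[OF PQc PQ] .
  define C where "C = Q * A * P"
  have C: "C \<in> carrier_mat (Suc n) (Suc n)" using PQc A by (auto simp: C_def)
  have APC: "A = P * C * Q"
  proof -
    have "P * C * Q = (P * Q) * A * (P * Q)" unfolding C_def using PQc A by (simp add: assoc_mult_mat[of _ "Suc n" "Suc n" _ "Suc n" _ "Suc n"])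
    then show ?thesis using A by (simp add: PQ)
  qed
  have sim: "similar_mat_wit A C P Q"
    by (rule similar_mat_witI[OF PQ QP APC A C PQc])
  have col: "C $$ (i, k) = (if i = k then e else 0)" if i: "i < Suc n" for i
  proof -
    have colP: "col P k = v" using v k by (auto simp: P_def)
    have "C $$ (i, k) = (Q *\<^sub>v (A *\<^sub>v v)) $ i"
    proof -
      have "C $$ (i, k) = row Q i \<bullet> col (A * P) k"
        using PQc A i k unfolding C_def by (subst assoc_mult_mat[of _ "Suc n" "Suc n" _ "Suc n" _ "Suc n"]) auto
      also have "col (A * P) k = A *\<^sub>v v" using col_mult2[OF A PQc(1) k(1)] colP by simp
      finally show ?thesis using PQc i by simp
    qed
    also have "\<dots> = e * (Q *\<^sub>v v) $ i"
      using v PQc i by simp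
    also have "Q *\<^sub>v v = col (1\<^sub>m (Suc n)) k"
      using col_mult2[OF PQc(2,1) k(1)] colP QP by simp
    finally show ?thesis using i k by simp
  qed
  have D: "mat_delete C k k \<in> carrier_mat n n" using mat_delete_carrier[OF C] by simp
  from Suc.IH[OF D] obtain es where es: "mat_trace (mat_delete C k k ^\<^sub>m m) = (\<Sum>e\<leftarrow>es. e ^ m)" for m by blast
  have "mat_trace (A ^\<^sub>m m) = (\<Sum>e\<leftarrow>e # es. e ^ m)" for m
  proof -
    have Cm: "C ^\<^sub>m m \<in> carrier_mat (Suc n) (Suc n)" using C by (rule pow_carrier_mat)
    have Dm: "mat_delete C k k ^\<^sub>m m \<in> carrier_mat n n" using D by (rule pow_carrier_mat)
    have "mat_trace (A ^\<^sub>m m) = mat_trace (C ^\<^sub>m m)"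
      by (rule mat_trace_similar[OF similar_mat_wit_pow[OF sim]])
    also have "\<dots> = (\<Sum>i<Suc n. (C ^\<^sub>m m) $$ (i, i))" using carrier_matD(1)[OF Cm] by (simp only: mat_trace_def)
    also have "\<dots> = e ^ m + (\<Sum>i<n. mat_delete (C ^\<^sub>m m) k k $$ (i, i))"
      using mat_delete_index[OF Cm k(1) k(1)]
      by (subst sum_delete_index[OF k(1)]) (simp add: pow_mat_deflate(2)[OF C k(1) col])
    also have "\<dots> = e ^ m + mat_trace (mat_delete C k k ^\<^sub>m m)"
      using Dm C by (simp add: pow_mat_deflate(1)[OF C k(1) col] mat_trace_def)
    finally show ?thesis by (simp add: es)
  qed
  then show ?case by blast
qed

lemma poly_interpolation:
  fixes F :: "'a::field \<Rightarrow> 'a"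
  assumes "finite A"
  shows "\<exists>r. \<forall>x\<in>A. poly r x = F x"
  using assms
proof induction
  case empty
  then show ?case by simp
next
  case (insert a A)
  then obtain r where r: "poly r x = F x" if "x \<in> A" for x by blast
  define q where "q = (\<Prod>x\<in>A. [:- x, 1:])"
  have "poly q a \<noteq> 0" using insert by (auto simp: q_def poly_prod)
  moreover have "poly q x = 0" if "x \<in> A" for x using that insert(1) by (auto simp: q_def poly_prod)
  ultimately show ?case
    using r by (intro exI[of _ "r + Polynomial.smult ((F a - poly r a) / poly q a) q"]) auto
qed

text \<open>
  A field of characteristic \<open>0\<close> need not embed into the complex numbers, but rational linear
  functionals exist in abundance and replace the usual positivity argument with complex
  conjugation.
\<close>

lemma rational_functional:
  fixes f0 :: "'a::field_char_0"
  assumes "f0 \<noteq> 0"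
  obtains \<phi> :: "'a \<Rightarrow> rat" where "\<And>x y. \<phi> (x + y) = \<phi> x + \<phi> y"
    "\<And>q x. \<phi> (of_rat q * x) = q * \<phi> x" "\<phi> f0 \<noteq> 0"
proof -
  interpret V: vector_space_pair "\<lambda>q (x::'a). of_rat q * x" "(*) :: rat \<Rightarrow> rat \<Rightarrow> rat"
    by unfold_locales (auto simp: algebra_simps of_rat_add of_rat_mult)
  have "V.vs1.independent {f0}" using assms by simp
  from V.linear_independent_extend[OF this, of "\<lambda>_. 1"] obtain g where
    g: "Vector_Spaces.linear (\<lambda>q (x::'a). of_rat q * x) (*) g" "g f0 = 1" by auto
  interpret g: Vector_Spaces.linear "\<lambda>q (x::'a). of_rat q * x" "(*)" g by (rule g(1))
  show ?thesis using that[of g] g(2) g.add g.scale by auto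
qed

text \<open>
  Let \<open>f\<^sub>i\<close> be the sum of the list \<open>es i\<close>, and let \<open>\<phi>\<close> be a rational functional with \<open>\<phi>(f\<^sub>i\<^sub>0) \<noteq> 0\<close>. As \<open>\<phi>\<close> is odd,
  some odd polynomial \<open>x r(x\<^sup>2)\<close> agrees with \<open>\<phi>\<close> on the finitely many entries. Replacing the odd
  powers in the hypothesis by this polynomial gives \<open>\<Sum>\<^sub>i f\<^sub>i \<phi>(f\<^sub>i) = 0\<close>, and applying \<open>\<phi>\<close> gives
  \<open>\<Sum>\<^sub>i \<phi>(f\<^sub>i)\<^sup>2 = 0\<close> in the rationals.
\<close>

lemma odd_power_sums_orthogonal_imp_zero:
  fixes es :: "'i \<Rightarrow> 'a::field_char_0 list"
  assumes I: "finite I" and orth: "\<And>k. (\<Sum>i\<in>I. (\<Sum>e\<leftarrow>es i. e) * (\<Sum>e\<leftarrow>es i. e ^ (2 * k + 1))) = 0"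
    and i: "i0 \<in> I"
  shows "(\<Sum>e\<leftarrow>es i0. e) = 0"
proof (rule ccontr)
  define f where "f i = sum_list (es i)" for i
  assume "(\<Sum>e\<leftarrow>es i0. e) \<noteq> 0"
  then have "f i0 \<noteq> 0" by (simp add: f_def)
  then obtain \<phi> :: "'a \<Rightarrow> rat" where \<phi>: "\<And>x y. \<phi> (x + y) = \<phi> x + \<phi> y"
    "\<And>q x. \<phi> (of_rat q * x) = q * \<phi> x" "\<phi> (f i0) \<noteq> 0"
    using rational_functional by blast
  have \<phi>0: "\<phi> 0 = 0" using \<phi>(2)[of 0 0] by simp
  have \<phi>m: "\<phi> (- x) = - \<phi> x" for x using \<phi>(2)[of "-1" x] by simp
  have \<phi>sum: "\<phi> (sum g A) = (\<Sum>a\<in>A. \<phi> (g a))" for g :: "'i \<Rightarrow> 'a" and A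
    by (induction A rule: infinite_finite_induct) (simp_all add: \<phi>0 \<phi>(1))
  have \<phi>list: "(\<Sum>e\<leftarrow>xs. of_rat (\<phi> e)) = (of_rat (\<phi> (sum_list xs)) :: 'a)" for xs
    by (induction xs) (simp_all add: \<phi>0 \<phi>(1) of_rat_add)
  define E where "E = (\<Union>i\<in>I. set (es i))"
  define F where "F s = (let e = SOME e. e ^ 2 = s in of_rat (\<phi> e) / e)" for s
  \<comment> \<open>The two square roots of \<open>s\<close> give the same value of \<open>F s\<close>, because \<open>\<phi>\<close> is odd.\<close>
  have F: "F (e ^ 2) = of_rat (\<phi> e) / e" for e
  proof -
    define e' where "e' = (SOME e'. e' ^ 2 = e ^ 2)"
    have "e' ^ 2 = e ^ 2" unfolding e'_def by (rule someI) (rule refl)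
    then have "e' = e \<or> e' = - e" by (simp add: power2_eq_iff)
    then show ?thesis by (auto simp: F_def Let_def \<phi>m of_rat_minus simp flip: e'_def)
  qed
  have "finite ((\<lambda>e. e ^ 2) ` E)" using I by (auto simp: E_def)
  from poly_interpolation[OF this, of F] obtain r where r: "poly r (e ^ 2) = F (e ^ 2)" if "e \<in> E" for e by auto
  have er: "e * poly r (e ^ 2) = of_rat (\<phi> e)" if "e \<in> E" for e
    using r[OF that] by (cases "e = 0") (simp_all add: F \<phi>0)
  have "(\<Sum>i\<in>I. f i * of_rat (\<phi> (f i))) = (\<Sum>i\<in>I. f i * (\<Sum>e\<leftarrow>es i. e * poly r (e ^ 2)))"
  proof (intro sum.cong refl)
    fix i assume "i \<in> I"
    then have "(\<Sum>e\<leftarrow>es i. e * poly r (e ^ 2)) = (\<Sum>e\<leftarrow>es i. of_rat (\<phi> e))"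
      by (intro arg_cong[of _ _ sum_list] map_cong refl er) (auto simp: E_def)
    then show "f i * of_rat (\<phi> (f i)) = f i * (\<Sum>e\<leftarrow>es i. e * poly r (e ^ 2))"
      by (simp add: \<phi>list f_def)
  qed
  also have "\<dots> = (\<Sum>i\<in>I. f i * (\<Sum>k\<le>degree r. coeff r k * (\<Sum>e\<leftarrow>es i. e ^ (2 * k + 1))))"
  proof -
    have "(\<Sum>e\<leftarrow>xs. e * poly r (e ^ 2)) = (\<Sum>k\<le>degree r. coeff r k * (\<Sum>e\<leftarrow>xs. e ^ (2 * k + 1)))" for xs
      by (induction xs) (simp_all add: poly_altdef sum.distrib distrib_left sum_distrib_left ac_simps flip: power_mult)
    then show ?thesis by simp
  qed
  also have "\<dots> = (\<Sum>k\<le>degree r. coeff r k * (\<Sum>i\<in>I. f i * (\<Sum>e\<leftarrow>es i. e ^ (2 * k + 1))))"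
    by (simp only: sum_distrib_left, subst sum.swap) (simp add: ac_simps)
  also have "\<dots> = 0" using orth by (simp add: f_def)
  finally have "(\<Sum>i\<in>I. of_rat (\<phi> (f i)) * f i) = 0" by (simp add: mult.commute)
  then have "\<phi> (\<Sum>i\<in>I. of_rat (\<phi> (f i)) * f i) = 0" by (simp add: \<phi>0)
  then have "(\<Sum>i\<in>I. \<phi> (f i) * \<phi> (f i)) = 0" by (simp add: \<phi>sum \<phi>(2))
  then have "\<phi> (f i0) * \<phi> (f i0) = 0" using I i by (subst (asm) sum_nonneg_eq_0_iff) auto
  then show False using \<phi>(3) by simp
qed

section \<open>Lemmas of Schur for matrix representations\<close>

lemma invariant_subspaceI:
  assumes "W \<subseteq> carrier_vec n" "0\<^sub>v n \<in> W" "\<And>v w. v \<in> W \<Longrightarrow> w \<in> W \<Longrightarrow> v + w \<in> W"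
    "\<And>c v. v \<in> W \<Longrightarrow> c \<cdot>\<^sub>v v \<in> W" "\<And>a v. v \<in> W \<Longrightarrow> \<rho> a *\<^sub>v v \<in> W"
  shows "invariant_subspace n \<rho> W"
  using assms unfolding invariant_subspace_def by blast

lemma irreducible_repD:
  assumes "irreducible_rep scale n \<rho>"
  shows "\<rho> a \<in> carrier_mat n n" "\<rho> (a + b) = \<rho> a + \<rho> b" "\<rho> (scale c a) = c \<cdot>\<^sub>m \<rho> a"
    "\<rho> (a * b) = \<rho> a * \<rho> b" "\<rho> 1 = 1\<^sub>m n" "n > 0"
    "invariant_subspace n \<rho> W \<Longrightarrow> W = {0\<^sub>v n} \<or> W = carrier_vec n"
  using assms unfolding irreducible_rep_def matrix_rep_def by simp_all

lemma mat_eq_zero_if_mult_vec: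
  assumes X: "(X :: 'a::comm_ring_1 mat) \<in> carrier_mat n m" and "\<And>v. v \<in> carrier_vec m \<Longrightarrow> X *\<^sub>v v = 0\<^sub>v n"
  shows "X = 0\<^sub>m n m"
proof (rule eq_matI)
  fix i j assume "i < dim_row (0\<^sub>m n m :: 'a mat)" "j < dim_col (0\<^sub>m n m :: 'a mat)"
  then have ij: "i < n" "j < m" by auto
  have "X $$ (i, j) = (X *\<^sub>v unit_vec m j) $ i" using X ij by simp
  also have "X *\<^sub>v unit_vec m j = 0\<^sub>v n" by (rule assms(2)) simp
  finally show "X $$ (i, j) = 0\<^sub>m n m $$ (i, j)" using ij by simp
qed (use X in auto)

lemma mat_eq_if_diff_zero:
  fixes A :: "'a::ab_group_add mat"
  assumes "A \<in> carrier_mat n m" "C \<in> carrier_mat n m" "A - C = 0\<^sub>m n m"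
  shows "A = C"
proof (rule eq_matI)
  fix i j assume "i < dim_row C" "j < dim_col C"
  then have "(A - C) $$ (i, j) = A $$ (i, j) - C $$ (i, j)" and ij: "i < n" "j < m"
    using assms(1,2) by auto
  moreover have "(A - C) $$ (i, j) = 0" using ij by (simp add: assms(3))
  ultimately show "A $$ (i, j) = C $$ (i, j)" by simp
qed (use assms in auto)

text \<open>
  Kernel and image of an intertwiner are invariant subspaces, so a nonzero intertwiner is
  bijective. That the two degrees agree follows by comparing the traces of \<open>X Y\<close> and \<open>Y X\<close>.
\<close>

lemma schur_invertible:
  fixes \<rho> \<sigma> :: "'h::ring_1 \<Rightarrow> 'k::field_char_0 mat"
  assumes \<rho>: "irreducible_rep scale n \<rho>" and \<sigma>: "irreducible_rep scale' m \<sigma>"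
    and X: "X \<in> carrier_mat n m" and comm: "\<And>h. \<rho> h * X = X * \<sigma> h" and nz: "X \<noteq> 0\<^sub>m n m"
  obtains Y where "n = m" "Y \<in> carrier_mat n n" "X * Y = 1\<^sub>m n" "Y * X = 1\<^sub>m n"
proof -
  note r = irreducible_repD[OF \<rho>] and s = irreducible_repD[OF \<sigma>]
  define W where "W = {v \<in> carrier_vec m. X *\<^sub>v v = 0\<^sub>v n}"
  have "invariant_subspace m \<sigma> W"
  proof (rule invariant_subspaceI)
    show "\<sigma> a *\<^sub>v v \<in> W" if "v \<in> W" for a v
    proof -
      have v: "v \<in> carrier_vec m" "X *\<^sub>v v = 0\<^sub>v n" using that by (auto simp: W_def)
      have "X *\<^sub>v (\<sigma> a *\<^sub>v v) = (X * \<sigma> a) *\<^sub>v v" using assoc_mult_mat_vec[OF X s(1) v(1)] by simp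
      also have "\<dots> = \<rho> a *\<^sub>v (X *\<^sub>v v)" unfolding comm[symmetric] by (rule assoc_mult_mat_vec[OF r(1) X v(1)])
      also have "\<dots> = 0\<^sub>v n" using r(1)[of a] v by auto
      finally show ?thesis using v mult_mat_vec_carrier[OF s(1)] by (auto simp: W_def)
    qed
    show "c \<cdot>\<^sub>v v \<in> W" if "v \<in> W" for c v
      using that X mult_mat_vec[OF X, of v c] by (auto simp: W_def)
    show "v + w \<in> W" if "v \<in> W" "w \<in> W" for v w
      using that X mult_add_distrib_mat_vec[OF X, of v w] by (auto simp: W_def)
  qed (use X in \<open>auto simp: W_def\<close>)
  moreover have "W \<noteq> carrier_vec m"
    using mat_eq_zero_if_mult_vec[OF X] nz by (auto simp: W_def)
  ultimately have inj: "W = {0\<^sub>v m}" using s(7) by blast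
  define V where "V = {X *\<^sub>v v | v. v \<in> carrier_vec m}"
  have "invariant_subspace n \<rho> V"
  proof (rule invariant_subspaceI)
    show "\<rho> a *\<^sub>v v \<in> V" if "v \<in> V" for a v
    proof -
      obtain u where u: "u \<in> carrier_vec m" "v = X *\<^sub>v u" using \<open>v \<in> V\<close> unfolding V_def by blast
      have "\<rho> a *\<^sub>v v = (X * \<sigma> a) *\<^sub>v u"
        unfolding u(2) comm[symmetric] by (rule assoc_mult_mat_vec[OF r(1) X u(1), symmetric])
      also have "\<dots> = X *\<^sub>v (\<sigma> a *\<^sub>v u)" by (rule assoc_mult_mat_vec[OF X s(1) u(1)])
      finally show ?thesis using mult_mat_vec_carrier[OF s(1) u(1)] by (auto simp: V_def)
    qed
    show "c \<cdot>\<^sub>v v \<in> V" if "v \<in> V" for c v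
    proof -
      obtain u where u: "u \<in> carrier_vec m" "v = X *\<^sub>v u" using \<open>v \<in> V\<close> unfolding V_def by blast
      then have "c \<cdot>\<^sub>v v = X *\<^sub>v (c \<cdot>\<^sub>v u)" using mult_mat_vec[OF X] by simp
      then show ?thesis using u by (auto simp: V_def)
    qed
    show "v + w \<in> V" if "v \<in> V" "w \<in> V" for v w
    proof -
      obtain u u' where u: "u \<in> carrier_vec m" "v = X *\<^sub>v u" "u' \<in> carrier_vec m" "w = X *\<^sub>v u'"
        using \<open>v \<in> V\<close> \<open>w \<in> V\<close> unfolding V_def by blast
      then have "v + w = X *\<^sub>v (u + u')" using mult_add_distrib_mat_vec[OF X] by simp
      then show ?thesis using u by (auto simp: V_def)
    qed
    have "X *\<^sub>v 0\<^sub>v m = 0\<^sub>v n" using X by auto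
    then show "0\<^sub>v n \<in> V" unfolding V_def by (auto intro!: exI[of _ "0\<^sub>v m"])
  qed (use X in \<open>auto simp: V_def\<close>)
  moreover have "V \<noteq> {0\<^sub>v n}"
    using mat_eq_zero_if_mult_vec[OF X] nz by (auto simp: V_def)
  ultimately have surj: "V = carrier_vec n" using r(7) by blast
  have "\<exists>v. v \<in> carrier_vec m \<and> X *\<^sub>v v = unit_vec n i" for i
  proof -
    have "unit_vec n i \<in> V" unfolding surj by simp
    then obtain v where "v \<in> carrier_vec m" "unit_vec n i = X *\<^sub>v v" unfolding V_def by blast
    then show ?thesis by metis
  qed
  then obtain y where y: "y i \<in> carrier_vec m" "X *\<^sub>v y i = unit_vec n i" for i by metis
  define Y where "Y = mat m n (\<lambda>(i, j). y j $ i)"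
  have Y: "Y \<in> carrier_mat m n" by (simp add: Y_def)
  have XY: "X * Y = 1\<^sub>m n"
  proof (rule eq_matI)
    fix i j assume "i < dim_row (1\<^sub>m n :: 'k mat)" "j < dim_col (1\<^sub>m n :: 'k mat)"
    then have ij: "i < n" "j < n" by auto
    have "col Y j = y j" using y(1)[of j] ij by (intro eq_vecI) (auto simp: Y_def)
    then have "(X * Y) $$ (i, j) = (X *\<^sub>v y j) $ i" using X Y ij by simp
    then show "(X * Y) $$ (i, j) = 1\<^sub>m n $$ (i, j)" using y(2) ij by simp
  qed (use X Y in auto)
  have YX: "Y * X = 1\<^sub>m m"
  proof -
    let ?Z = "Y * X - 1\<^sub>m m"
    have Z: "?Z \<in> carrier_mat m m" using X Y by auto
    have "?Z *\<^sub>v v \<in> W" if v: "v \<in> carrier_vec m" for v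
    proof -
      have "X *\<^sub>v (Y *\<^sub>v (X *\<^sub>v v)) = X *\<^sub>v v"
        using assoc_mult_mat_vec[OF X Y, of "X *\<^sub>v v"] X v by (simp add: XY)
      moreover have "?Z *\<^sub>v v = Y *\<^sub>v (X *\<^sub>v v) - v"
        using X Y v by (simp add: minus_mult_distrib_mat_vec[of _ m m] assoc_mult_mat_vec[of _ m n _ m])
      moreover have "X *\<^sub>v (Y *\<^sub>v (X *\<^sub>v v) - v) = X *\<^sub>v (Y *\<^sub>v (X *\<^sub>v v)) - X *\<^sub>v v"
        using X Y v by (intro mult_minus_distrib_mat_vec) auto
      ultimately show ?thesis using X Y v by (auto simp: W_def)
    qed
    then have "?Z = 0\<^sub>m m m" using Z unfolding inj by (intro mat_eq_zero_if_mult_vec) auto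
    then show ?thesis by (rule mat_eq_if_diff_zero[OF mult_carrier_mat[OF Y X] one_carrier_mat])
  qed
  have "of_nat n = (of_nat m :: 'k)"
    using mat_trace_commute[OF X Y] by (simp add: XY YX mat_trace_def)
  then have "n = m" by simp
  then show ?thesis using that Y XY YX by blast
qed

lemma schur_scalar:
  fixes \<rho> :: "'h::ring_1 \<Rightarrow> 'k::{alg_closed_field, field_char_0} mat"
  assumes \<rho>: "irreducible_rep scale n \<rho>" and X: "X \<in> carrier_mat n n"
    and comm: "\<And>h. \<rho> h * X = X * \<rho> h"
  obtains e where "X = e \<cdot>\<^sub>m 1\<^sub>m n"
proof -
  note r = irreducible_repD[OF \<rho>]
  have "degree (char_poly X) > 0" using degree_monic_char_poly[OF X] r(6) by simp
  then obtain e where "poly (char_poly X) e = 0" using alg_closed_imp_poly_has_root by blast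
  then obtain v where v: "v \<in> carrier_vec n" "v \<noteq> 0\<^sub>v n" "X *\<^sub>v v = e \<cdot>\<^sub>v v"
    using eigenvalue_root_char_poly[OF X] X unfolding eigenvalue_def eigenvector_def by auto
  define Z where "Z = X - e \<cdot>\<^sub>m 1\<^sub>m n"
  have Z: "Z \<in> carrier_mat n n" using X by (auto simp: Z_def)
  have "(e \<cdot>\<^sub>m 1\<^sub>m n) *\<^sub>v v = e \<cdot>\<^sub>v v" using v(1) by (intro eq_vecI) auto
  then have Zv: "Z *\<^sub>v v = 0\<^sub>v n" using X v
    by (simp add: Z_def minus_mult_distrib_mat_vec[of _ n n])
  have Zc: "\<rho> h * Z = Z * \<rho> h" for h
    using X r(1)[of h] comm[of h]
    by (simp add: Z_def mult_minus_distrib_mat[of _ n n _ n] minus_mult_distrib_mat[of _ n n _ _ n]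
      mult_smult_distrib[of _ n n _ n] mult_smult_assoc_mat[of _ n n _ n])
  have "Z = 0\<^sub>m n n"
  proof (rule ccontr)
    assume "Z \<noteq> 0\<^sub>m n n"
    then obtain Y where Y: "Y \<in> carrier_mat n n" "Y * Z = 1\<^sub>m n"
      using schur_invertible[OF \<rho> \<rho> Z Zc] by metis
    have "v = (Y * Z) *\<^sub>v v" using v Y by simp
    also have "\<dots> = 0\<^sub>v n" using assoc_mult_mat_vec[OF Y(1) Z v(1)] Zv Y(1) by auto
    finally show False using v(2) by simp
  qed
  then have "X = e \<cdot>\<^sub>m 1\<^sub>m n"
    unfolding Z_def by (intro mat_eq_if_diff_zero[OF X]) auto
  then show ?thesis by (rule that)
qed

section \<open>Irreducible representations separate points\<close>

context fd_unital_algebra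
begin

lemma left_ideal_subspace:
  assumes "left_ideal L"
  shows "subspace L"
  unfolding subspace_def
proof (intro conjI ballI allI)
  fix c x assume "x \<in> L"
  then have "scale c 1 * x \<in> L" using assms unfolding left_ideal_def by blast
  then show "scale c x \<in> L" by (simp add: scale_mult_left)
qed (use assms in \<open>auto simp: left_ideal_def\<close>)

lemma minimal_left_ideal_exists:
  fixes J :: "'h set"
  assumes J: "left_ideal J" "J \<noteq> {0}"
  obtains L where "left_ideal L" "L \<subseteq> J" "L \<noteq> {0}"
    "\<And>L'. left_ideal L' \<Longrightarrow> L' \<subseteq> L \<Longrightarrow> L' \<noteq> {0} \<Longrightarrow> L' = L"
proof -
  let ?P = "\<lambda>L :: 'h set. left_ideal L \<and> L \<subseteq> J \<and> L \<noteq> {0}"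
  obtain L where L: "?P L" "\<And>L'. ?P L' \<Longrightarrow> dim L \<le> dim L'"
    using ex_has_least_nat[of ?P J local.dim] J by auto
  have "L' = L" if "left_ideal L'" "L' \<subseteq> L" "L' \<noteq> {0}" for L'
    using subspace_dim_equal[of L' L] that L(1) L(2)[of L'] left_ideal_subspace by (metis order_trans)
  then show ?thesis using that L(1) by blast
qed

text \<open>
  The representation \<open>\<sigma>\<close> is the action of the algebra on \<open>L\<close>, written in a basis of \<open>L\<close>. Its invariant
  subspaces are the left ideals contained in \<open>L\<close>.
\<close>

lemma rep_of_minimal_left_ideal:
  assumes L: "left_ideal L" "L \<noteq> {0}"
    and min: "\<And>L'. left_ideal L' \<Longrightarrow> L' \<subseteq> L \<Longrightarrow> L' \<noteq> {0} \<Longrightarrow> L' = L"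
  obtains n \<sigma> where "irreducible_rep scale n \<sigma>" "\<And>a y. \<sigma> a = 0\<^sub>m n n \<Longrightarrow> y \<in> L \<Longrightarrow> a * y = 0"
proof -
  have sub: "subspace L" by (rule left_ideal_subspace[OF L(1)])
  obtain C where C: "C \<subseteq> L" "independent C" "L \<subseteq> span C" "card C = dim L"
    by (rule basis_exists)
  have fin: "finite C" using C(2) by (rule finiteI_independent)
  have spC: "span C = L" using C sub by (metis span_minimal subset_antisym)
  define n where "n = card C"
  obtain e where e: "bij_betw e {..<n} C"
    using ex_bij_betw_nat_finite[OF fin] by (auto simp: n_def lessThan_atLeast0)
  have eC: "p < n \<Longrightarrow> e p \<in> C" for p using e by (auto simp: bij_betw_def)
  then have eL: "p < n \<Longrightarrow> e p \<in> L" for p using C(1) by blast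
  have ideal: "x \<in> L \<Longrightarrow> a * x \<in> L" for a x using L(1) by (simp add: left_ideal_def)
  define co where "co p x = representation C x (e p)" for p x
  have co_add: "co p (x + y) = co p x + co p y" if "x \<in> L" "y \<in> L" for p x y
    using that C(2) by (simp add: co_def representation_add spC)
  have co_scale: "co p (scale c x) = c * co p x" if "x \<in> L" for p x c
    using that C(2) by (simp add: co_def representation_scale spC)
  have co_sum: "co p (\<Sum>i\<in>A. f i) = (\<Sum>i\<in>A. co p (f i))" if "\<And>i. i \<in> A \<Longrightarrow> f i \<in> L" for p A and f :: "nat \<Rightarrow> 'h"
    using C(2) that by (simp add: co_def representation_sum spC)
  have co_e: "co p (e q) = (if p = q then 1 else 0)" if "p < n" "q < n" for p q
    using that e C(2) eC by (auto simp: co_def representation_basis bij_betw_def inj_on_def)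
  have exp: "(\<Sum>p<n. scale (co p x) (e p)) = x" if "x \<in> L" for x
  proof -
    have "(\<Sum>p<n. scale (co p x) (e p)) = (\<Sum>c\<in>C. scale (representation C x c) c)"
      unfolding co_def using e by (rule sum.reindex_bij_betw)
    also have "\<dots> = x" using that by (intro sum_representation_eq C(2) fin) (simp_all add: spC)
    finally show ?thesis .
  qed
  have comb: "(\<Sum>p<n. scale (c p) (e p)) \<in> L" for c
    using sub eL by (intro subspace_sum) (auto intro: subspace_scale)
  have co_comb: "co q (\<Sum>p<n. scale (c p) (e p)) = c q" if "q < n" for c q
  proof -
    have "co q (\<Sum>p<n. scale (c p) (e p)) = (\<Sum>p<n. c p * co q (e p))"
      using sub eL by (subst co_sum) (auto intro: subspace_scale simp: co_scale)
    also have "\<dots> = (\<Sum>p<n. if q = p then c p else 0)"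
      using that by (intro sum.cong) (auto simp: co_e)
    finally show ?thesis using that by simp
  qed
  define \<sigma> where "\<sigma> a = mat n n (\<lambda>(p, q). co p (a * e q))" for a
  have \<sigma>c: "\<sigma> a \<in> carrier_mat n n" for a by (simp add: \<sigma>_def)
  have act: "a * x = (\<Sum>p<n. scale (\<Sum>q<n. \<sigma> a $$ (p, q) * co q x) (e p))" if "x \<in> L" for a x
  proof -
    have "co p (a * x) = (\<Sum>q<n. \<sigma> a $$ (p, q) * co q x)" if p: "p < n" for p
    proof -
      have "a * x = (\<Sum>q<n. scale (co q x) (a * e q))"
        by (subst exp[OF \<open>x \<in> L\<close>, symmetric]) (simp add: sum_distrib_left scale_mult_right)
      moreover have "co p (\<Sum>q<n. scale (co q x) (a * e q)) = (\<Sum>q<n. co p (scale (co q x) (a * e q)))"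
        using subspace_scale[OF sub ideal[OF eL]] by (intro co_sum) simp
      ultimately have "co p (a * x) = (\<Sum>q<n. co q x * co p (a * e q))"
        by (simp add: co_scale[OF ideal[OF eL]])
      then show ?thesis using p by (simp add: \<sigma>_def mult.commute)
    qed
    then have "(\<Sum>p<n. scale (co p (a * x)) (e p)) = (\<Sum>p<n. scale (\<Sum>q<n. \<sigma> a $$ (p, q) * co q x) (e p))"
      by (intro sum.cong refl) simp
    then show ?thesis by (simp only: exp[OF ideal[OF that, of a]])
  qed
  have \<sigma>_rep: "matrix_rep scale n \<sigma>"
    unfolding matrix_rep_def
  proof (intro conjI allI)
    fix a b c
    show "\<sigma> a \<in> carrier_mat n n" by (rule \<sigma>c)
    show "\<sigma> (a + b) = \<sigma> a + \<sigma> b"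
      using eL ideal by (intro eq_matI) (auto simp: \<sigma>_def distrib_right co_add)
    show "\<sigma> (scale c a) = c \<cdot>\<^sub>m \<sigma> a"
      using eL ideal by (intro eq_matI) (auto simp: \<sigma>_def scale_mult_left co_scale)
    show "\<sigma> 1 = 1\<^sub>m n"
      by (intro eq_matI) (auto simp: \<sigma>_def co_e)
    show "\<sigma> (a * b) = \<sigma> a * \<sigma> b"
    proof (rule eq_matI)
      fix p q assume "p < dim_row (\<sigma> a * \<sigma> b)" "q < dim_col (\<sigma> a * \<sigma> b)"
      then have pq: "p < n" "q < n" using \<sigma>c[of a] \<sigma>c[of b] by auto
      have "\<sigma> (a * b) $$ (p, q) = co p (a * (b * e q))" using pq by (simp add: \<sigma>_def mult.assoc)
      also have "\<dots> = (\<Sum>r<n. \<sigma> a $$ (p, r) * co r (b * e q))"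
        using pq eL ideal by (subst act) (simp_all add: co_comb)
      also have "\<dots> = (\<sigma> a * \<sigma> b) $$ (p, q)"
        using pq by (subst mat_mult_index[OF \<sigma>c \<sigma>c pq]) (simp add: \<sigma>_def)
      finally show "\<sigma> (a * b) $$ (p, q) = (\<sigma> a * \<sigma> b) $$ (p, q)" .
    qed (use \<sigma>c in \<open>auto simp: \<sigma>_def\<close>)
  qed
  define vect where "vect v = (\<Sum>p<n. scale (v $ p) (e p))" for v :: "'k vec"
  have co_vect: "co q (vect v) = v $ q" if "q < n" for v q
    using that by (simp add: vect_def co_comb)
  have vect_L: "vect v \<in> L" for v by (simp add: vect_def comb)
  have vect_act: "a * vect v = vect (\<sigma> a *\<^sub>v v)" if "v \<in> carrier_vec n" for a v
  proof -
    have "(\<sigma> a *\<^sub>v v) $ p = (\<Sum>q<n. \<sigma> a $$ (p, q) * v $ q)" if "p < n" for p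
      using that \<sigma>c[of a] \<open>v \<in> carrier_vec n\<close> by (auto simp: scalar_prod_def lessThan_atLeast0 intro!: sum.cong)
    then show ?thesis
      by (subst act[OF vect_L]) (auto simp: vect_def[of "\<sigma> a *\<^sub>v v"] co_vect intro!: sum.cong arg_cong2[where f = scale])
  qed
  have irr: "irreducible_rep scale n \<sigma>"
    unfolding irreducible_rep_def
  proof (intro conjI allI impI \<sigma>_rep)
    show "n > 0"
    proof (rule ccontr)
      assume "\<not> n > 0"
      then have "C = {}" using fin by (simp add: n_def)
      then show False using spC L(2) by simp
    qed
    fix W assume W: "invariant_subspace n \<sigma> W"
    then have Wc: "v \<in> W \<Longrightarrow> v \<in> carrier_vec n" for v by (auto simp: invariant_subspace_def)
    have vadd: "vect (v + w) = vect v + vect w" if "v \<in> carrier_vec n" "w \<in> carrier_vec n" for v w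
      using that by (simp add: vect_def scale_left_distrib sum.distrib)
    have "left_ideal (vect ` W)"
      unfolding left_ideal_def
    proof (intro conjI ballI allI)
      have "vect (0\<^sub>v n) = 0" by (simp add: vect_def)
      then show "0 \<in> vect ` W" using W by (metis image_eqI invariant_subspace_def)
      show "x + y \<in> vect ` W" if "x \<in> vect ` W" "y \<in> vect ` W" for x y
      proof -
        obtain v w where vw: "v \<in> W" "w \<in> W" "x = vect v" "y = vect w" using \<open>x \<in> _\<close> \<open>y \<in> _\<close> by blast
        then have "v + w \<in> W" using W unfolding invariant_subspace_def by blast
        moreover have "x + y = vect (v + w)" using vw vadd Wc by simp
        ultimately show ?thesis by blast
      qed
      show "a * x \<in> vect ` W" if "x \<in> vect ` W" for a x
      proof -
        obtain v where v: "v \<in> W" "x = vect v" using \<open>x \<in> _\<close> by blast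
        then have "\<sigma> a *\<^sub>v v \<in> W" using W unfolding invariant_subspace_def by blast
        moreover have "a * x = vect (\<sigma> a *\<^sub>v v)" using v vect_act Wc by simp
        ultimately show ?thesis by blast
      qed
    qed
    moreover have "vect ` W \<subseteq> L" using vect_L by auto
    ultimately consider "vect ` W = {0}" | "vect ` W = L" using min by blast
    then show "W = {0\<^sub>v n} \<or> W = carrier_vec n"
    proof cases
      case 1
      have "v = 0\<^sub>v n" if "v \<in> W" for v
      proof (rule eq_vecI)
        fix i assume "i < dim_vec (0\<^sub>v n :: 'k vec)"
        then have i: "i < n" by simp
        have "vect v = 0" using 1 that by blast
        then have "v $ i = co i 0" using co_vect[OF i, of v] by simp
        also have "co i 0 = 0" using co_scale[of 0 i 0] sub by (simp add: subspace_0)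
        finally show "v $ i = 0\<^sub>v n $ i" using i by simp
      qed (use Wc that in auto)
      then show ?thesis using W by (auto simp: invariant_subspace_def)
    next
      case 2
      have "v \<in> W" if "v \<in> carrier_vec n" for v
      proof -
        obtain w where w: "w \<in> W" "vect v = vect w" using 2 vect_L[of v] by (metis imageE)
        have "v = w"
          using that Wc[OF w(1)] w(2) co_vect by (intro eq_vecI) (metis carrier_vecD, auto)
        then show ?thesis using w by simp
      qed
      then show ?thesis using Wc by blast
    qed
  qed
  have "a * y = 0" if "\<sigma> a = 0\<^sub>m n n" "y \<in> L" for a y
    using act[OF that(2), of a] that(1) by simp
  with irr show ?thesis by (rule that)
qed

text \<open>
  Otherwise the common kernel \<open>J\<close> contains a minimal left ideal \<open>L\<close>. The action on \<open>L\<close> is an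
  irreducible representation, so \<open>J L = 0\<close>. A complement of \<open>L\<close> provides a right unit of \<open>L\<close> inside
  \<open>L\<close>, and multiplying by it shows \<open>L = 0\<close>.
\<close>

lemma irreps_separate:
  assumes ss: "semisimple_ring TYPE('h)" and irreps: "complete_irreps scale I deg \<rho>"
    and x: "\<And>i. i \<in> I \<Longrightarrow> \<rho> i x = 0\<^sub>m (deg i) (deg i)"
  shows "x = 0"
proof (rule ccontr)
  assume "x \<noteq> 0"
  define J where "J = {x. \<forall>i\<in>I. \<rho> i x = 0\<^sub>m (deg i) (deg i)}"
  have ri: "irreducible_rep scale (deg i) (\<rho> i)" if "i \<in> I" for i
    using irreps that by (simp add: complete_irreps_def)
  note r = irreducible_repD[OF ri]
  have "left_ideal J"
    unfolding left_ideal_def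
  proof (intro conjI ballI allI)
    have "\<rho> i 0 = 0\<^sub>m (deg i) (deg i)" if "i \<in> I" for i
      using r(3)[OF that, of 0 0] r(1)[OF that, of 0] by (intro eq_matI) (auto, metis index_smult_mat(1) carrier_matD mult_zero_left)
    then show "0 \<in> J" by (simp add: J_def)
    show "x + y \<in> J" if "x \<in> J" "y \<in> J" for x y using that r(2) by (auto simp: J_def)
    show "a * x \<in> J" if "x \<in> J" for a x
      using that r(4) r(1) by (auto simp: J_def intro!: right_mult_zero_mat)
  qed
  moreover have "J \<noteq> {0}" using x \<open>x \<noteq> 0\<close> by (auto simp: J_def)
  ultimately obtain L where L: "left_ideal L" "L \<subseteq> J" "L \<noteq> {0}"
    "\<And>L'. left_ideal L' \<Longrightarrow> L' \<subseteq> L \<Longrightarrow> L' \<noteq> {0} \<Longrightarrow> L' = L"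
    using minimal_left_ideal_exists by metis
  obtain n \<sigma> where \<sigma>: "irreducible_rep scale n \<sigma>" "\<And>a y. \<sigma> a = 0\<^sub>m n n \<Longrightarrow> y \<in> L \<Longrightarrow> a * y = 0"
    using rep_of_minimal_left_ideal[OF L(1,3,4)] by metis
  then obtain i where i: "i \<in> I" "equivalent_reps n \<sigma> (deg i) (\<rho> i)"
    using irreps unfolding complete_irreps_def by blast
  then obtain P where P: "n = deg i" "P \<in> carrier_mat n n" "invertible_mat P" "\<And>a. P * \<sigma> a = \<rho> i a * P"
    by (auto simp: equivalent_reps_def)
  obtain Q where Q: "Q * P = 1\<^sub>m n" "Q \<in> carrier_mat n n"
  proof -
    obtain Q where Q: "P * Q = 1\<^sub>m (dim_row P)" "Q * P = 1\<^sub>m (dim_row Q)"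
      using P(3) unfolding invertible_mat_def inverts_mat_def by blast
    have "dim_row Q = n" using arg_cong[OF Q(2), of dim_col] P(2) by simp
    moreover have "dim_col Q = n" using arg_cong[OF Q(1), of dim_col] P(2) by simp
    ultimately show ?thesis using that[of Q] Q(2) by auto
  qed
  have JL: "a * y = 0" if "a \<in> J" "y \<in> L" for a y
  proof -
    have s: "\<sigma> a \<in> carrier_mat n n" using irreducible_repD(1)[OF \<sigma>(1)] .
    have "P * \<sigma> a = 0\<^sub>m n n" using that(1) i(1) P by (auto simp: J_def)
    then have "Q * P * \<sigma> a = 0\<^sub>m n n" using assoc_mult_mat[OF Q(2) P(2) s] Q(2) by simp
    then have "\<sigma> a = 0\<^sub>m n n" using s by (simp add: Q)
    then show ?thesis using \<sigma>(2) that(2) by blast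
  qed
  obtain M where M: "left_ideal M" "L \<inter> M = {0}" "{x + y | x y. x \<in> L \<and> y \<in> M} = UNIV"
    using ss[unfolded semisimple_ring_def, rule_format, OF L(1)] by (elim exE conjE)
  have "1 \<in> {x + y | x y. x \<in> L \<and> y \<in> M}" unfolding M(3) by simp
  then obtain e m where em: "e \<in> L" "m \<in> M" "1 = e + m" by blast
  have "y = 0" if "y \<in> L" for y
  proof -
    have "y = y * e + y * m" using em(3) by (metis distrib_left mult_1_right)
    moreover have "y * e = 0" using JL that L(2) em(1) by blast
    ultimately have "y = y * m" by simp
    then have "y \<in> M" using M(1) em(2) unfolding left_ideal_def by metis
    then show ?thesis using M(2) that by blast
  qed
  then show False using L(1,3) by (auto simp: left_ideal_def)
qed

end

section \<open>The block decomposition\<close>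

lemma pow_mat_commutes:
  fixes A :: "'a::semiring_1 mat"
  assumes A: "A \<in> carrier_mat n n"
  shows "A * A ^\<^sub>m k = A ^\<^sub>m k * A"
proof (induction k)
  case (Suc k)
  have "A * (A ^\<^sub>m k * A) = A * A ^\<^sub>m k * A"
    using assoc_mult_mat[OF A pow_carrier_mat[OF A] A] by simp
  then show ?case by (simp add: Suc)
qed (use A in simp)

lemma smult_smult_mat: "a \<cdot>\<^sub>m (b \<cdot>\<^sub>m A) = (a * b) \<cdot>\<^sub>m A" for a :: "'a::semigroup_mult"
  by (intro eq_matI) (auto simp: mult.assoc)

lemma mat_trace_smult: "mat_trace (c \<cdot>\<^sub>m A) = c * mat_trace A" if "A \<in> carrier_mat n n" for c :: "'a::comm_semiring_0"
  using that by (simp add: mat_trace_def sum_distrib_left)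

locale hopf_algebra_irreps = semisimple_hopf_algebra scale \<Delta> \<epsilon> S B \<Lambda>
  for scale :: "'k::{alg_closed_field, field_char_0} \<Rightarrow> 'h::ring_1 \<Rightarrow> 'h" and \<Delta> \<epsilon> S B \<Lambda> +
  fixes I :: "'i set" and deg :: "'i \<Rightarrow> nat" and \<rho> :: "'i \<Rightarrow> 'h \<Rightarrow> 'k mat"
  assumes semisimple: "semisimple_ring TYPE('h)"
    and irreps: "complete_irreps scale I deg \<rho>"
begin

lemma irr: "i \<in> I \<Longrightarrow> irreducible_rep scale (deg i) (\<rho> i)"
  using irreps by (simp add: complete_irreps_def)

lemmas rho = irreducible_repD[OF irr]

definition entry :: "'i \<Rightarrow> 'h \<Rightarrow> nat \<Rightarrow> nat \<Rightarrow> 'k" where "entry i h p q = \<rho> i h $$ (p, q)"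

lemma entry_add: "i \<in> I \<Longrightarrow> p < deg i \<Longrightarrow> q < deg i \<Longrightarrow> entry i (x + y) p q = entry i x p q + entry i y p q"
  by (simp add: entry_def rho(2) carrier_matD[OF rho(1)])

lemma entry_scale: "i \<in> I \<Longrightarrow> p < deg i \<Longrightarrow> q < deg i \<Longrightarrow> entry i (scale c x) p q = c * entry i x p q"
  by (simp add: entry_def rho(3) carrier_matD[OF rho(1)])

lemma entry_mult:
  assumes "i \<in> I" "p < deg i" "q < deg i"
  shows "entry i (x * y) p q = (\<Sum>t<deg i. entry i x p t * entry i y t q)"
  using assms mat_mult_index[OF rho(1)[OF assms(1)] rho(1)[OF assms(1)] assms(2,3)] by (simp add: entry_def rho(4))

lemma entry_one: "i \<in> I \<Longrightarrow> p < deg i \<Longrightarrow> q < deg i \<Longrightarrow> entry i 1 p q = (if p = q then 1 else 0)"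
  using rho(5) by (simp add: entry_def)

lemmas entry_simps = entry_add entry_scale lint_simps

lemma entry_functional: "i \<in> I \<Longrightarrow> p < deg i \<Longrightarrow> q < deg i \<Longrightarrow> functional (\<lambda>x. entry i x p q)"
  by (simp add: functional_def entry_simps)

lemma entry_zero: "i \<in> I \<Longrightarrow> p < deg i \<Longrightarrow> q < deg i \<Longrightarrow> entry i 0 p q = 0"
  using functional_zero[OF entry_functional] .

lemma entries_separate:
  assumes "\<And>i p q. i \<in> I \<Longrightarrow> p < deg i \<Longrightarrow> q < deg i \<Longrightarrow> entry i x p q = entry i y p q"
  shows "x = y"
proof -
  have "entry i (x - y) p q = 0" if "i \<in> I" "p < deg i" "q < deg i" for i p q
    using functional_diff[OF entry_functional[OF that]] assms[OF that] by simp
  then have "\<rho> i (x - y) = 0\<^sub>m (deg i) (deg i)" if "i \<in> I" for i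
    using that carrier_matD[OF rho(1)[OF that]] by (intro eq_matI) (auto simp: entry_def)
  then have "x - y = 0" by (rule irreps_separate[OF semisimple irreps])
  then show ?thesis by simp
qed

text \<open>
  Up to the factor \<open>deg i\<close> the matrix of \<open>\<Sum> S(\<Lambda>\<^sub>2) \<Lambda>\<^sub>1\<close>. Conjugation by it is \<open>S\<^sup>2\<close> on the block \<open>i\<close>
  (\<open>rho_antipode2\<close>). By \<open>schur_orthogonality\<close> any other index could replace the two zeros.
\<close>

definition twist :: "'i \<Rightarrow> 'k mat" where
  "twist i = mat (deg i) (deg i) (\<lambda>(s, r). sw (\<lambda>a b. entry i a 0 r * entry i (S b) s 0) \<Lambda>)"

lemma twist_carrier: "twist i \<in> carrier_mat (deg i) (deg i)"
  by (simp add: twist_def)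

text \<open>
  By \<open>casimir_commute\<close>, averaging an elementary matrix with \<open>\<Sum> \<Lambda>\<^sub>1 \<otimes> S(\<Lambda>\<^sub>2)\<close> gives an intertwiner
  from \<open>\<rho> j\<close> to \<open>\<rho> i\<close>, to which the lemmas of Schur apply.
\<close>

lemma schur_orthogonality:
  assumes ij: "i \<in> I" "j \<in> I" and bounds: "p < deg i" "r < deg i" "s < deg j" "q < deg j"
  shows "sw (\<lambda>a b. entry i a p r * entry j (S b) s q) \<Lambda> = (if i = j \<and> p = q then twist i $$ (s, r) else 0)"
proof -
  define X where "X = mat (deg i) (deg j) (\<lambda>(p, q). sw (\<lambda>a b. entry i a p r * entry j (S b) s q) \<Lambda>)"
  have X: "X \<in> carrier_mat (deg i) (deg j)" by (simp add: X_def)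
  have comm: "\<rho> i h * X = X * \<rho> j h" for h
  proof (rule eq_matI)
    fix p q assume "p < dim_row (X * \<rho> j h)" "q < dim_col (X * \<rho> j h)"
    then have pq: "p < deg i" "q < deg j" using X rho(1)[OF ij(2), of h] by auto
    have "(\<rho> i h * X) $$ (p, q) = (\<Sum>t<deg i. sw (\<lambda>a b. entry i h p t * (entry i a t r * entry j (S b) s q)) \<Lambda>)"
      using pq by (subst mat_mult_index[OF rho(1)[OF ij(1)] X pq]) (simp add: X_def entry_def sw_mult_left)
    also have "\<dots> = sw (\<lambda>a b. entry i (h * a) p r * entry j (S b) s q) \<Lambda>"
      using ij bounds pq by (simp add: entry_mult sum_distrib_right sw_sum mult.assoc)
    also have "\<dots> = sw (\<lambda>a b. entry i a p r * entry j (S b * h) s q) \<Lambda>"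
      using ij bounds pq by (intro casimir_commute) (simp add: entry_simps ac_simps)
    also have "\<dots> = (\<Sum>t<deg j. sw (\<lambda>a b. entry i a p r * entry j (S b) s t * entry j h t q) \<Lambda>)"
      using ij bounds pq by (simp add: entry_mult sum_distrib_left sw_sum mult.assoc)
    also have "\<dots> = (X * \<rho> j h) $$ (p, q)"
      using pq by (subst mat_mult_index[OF X rho(1)[OF ij(2)] pq]) (simp add: X_def entry_def sw_mult_right)
    finally show "(\<rho> i h * X) $$ (p, q) = (X * \<rho> j h) $$ (p, q)" .
  qed (use X rho(1)[OF ij(1), of h] rho(1)[OF ij(2), of h] in auto)
  show ?thesis
  proof (cases "i = j")
    case False
    have "X = 0\<^sub>m (deg i) (deg j)"
    proof (rule ccontr)
      assume "X \<noteq> 0\<^sub>m (deg i) (deg j)"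
      then obtain Y where Y: "deg i = deg j" "Y \<in> carrier_mat (deg i) (deg i)"
          "X * Y = 1\<^sub>m (deg i)" "Y * X = 1\<^sub>m (deg i)"
        using schur_invertible[OF irr[OF ij(1)] irr[OF ij(2)] X comm] by metis
      have "invertible_mat X"
        using X Y unfolding invertible_mat_def inverts_mat_def by auto
      moreover have "X * \<rho> j a = \<rho> i a * X" for a by (rule comm[symmetric])
      ultimately have "equivalent_reps (deg j) (\<rho> j) (deg i) (\<rho> i)"
        using X Y(1) unfolding equivalent_reps_def by auto
      then show False using irreps ij False by (auto simp: complete_irreps_def)
    qed
    then have "X $$ (p, q) = 0" using bounds by simp
    then show ?thesis using False bounds by (simp add: X_def)
  next
    case True
    then obtain e where e: "X = e \<cdot>\<^sub>m 1\<^sub>m (deg i)"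
      using schur_scalar[OF irr[OF ij(1)]] X comm by metis
    have "X $$ (p, q) = (if p = q then e else 0)" using bounds True by (simp add: e)
    moreover have "X $$ (0, 0) = e" using bounds by (simp add: e)
    ultimately show ?thesis using bounds True by (simp add: X_def twist_def)
  qed
qed

lemma twist_trace:
  assumes i: "i \<in> I" shows "mat_trace (twist i) = 1"
proof -
  have d: "0 < deg i" by (rule rho(6)[OF i])
  have "mat_trace (twist i) = sw (\<lambda>a b. entry i (a * S b) 0 0) \<Lambda>"
    using i d by (simp add: mat_trace_def twist_def entry_mult sw_sum)
  also have "\<dots> = 1"
    using i d by (subst sw_antipode_right[of "\<lambda>z. entry i z 0 0"]) (simp_all add: entry_simps entry_one counit_int)
  finally show ?thesis .
qed

lemma twist_intertwines:
  assumes i: "i \<in> I"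
  shows "\<rho> i (S (S h)) * twist i = twist i * \<rho> i h"
proof (rule eq_matI)
  fix s t assume "s < dim_row (twist i * \<rho> i h)" "t < dim_col (twist i * \<rho> i h)"
  then have st: "s < deg i" "t < deg i" using twist_carrier[of i] rho(1)[OF i, of h] by auto
  have d: "0 < deg i" by (rule rho(6)[OF i])
  have "(twist i * \<rho> i h) $$ (s, t) = (\<Sum>r<deg i. sw (\<lambda>a b. entry i a 0 r * entry i h r t * entry i (S b) s 0) \<Lambda>)"
  proof -
    have "sw (\<lambda>a b. entry i a 0 r * entry i h r t * entry i (S b) s 0) \<Lambda> = sw (\<lambda>a b. entry i a 0 r * entry i (S b) s 0) \<Lambda> * entry i h r t" for r
      by (simp add: ac_simps flip: sw_mult_left)
    then show ?thesis
      using st by (subst mat_mult_index[OF twist_carrier rho(1)[OF i] st]) (simp add: twist_def entry_def[of _ _ _ t])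
  qed
  also have "\<dots> = sw (\<lambda>a b. entry i (a * h) 0 t * entry i (S b) s 0) \<Lambda>"
    using i d st by (simp add: entry_mult sum_distrib_right sw_sum)
  also have "\<dots> = sw (\<lambda>a b. entry i a 0 t * entry i (S (b * S h)) s 0) \<Lambda>"
    using i d st by (intro casimir_right) (simp add: entry_simps ac_simps)
  also have "\<dots> = (\<Sum>r<deg i. entry i (S (S h)) s r * sw (\<lambda>a b. entry i a 0 t * entry i (S b) r 0) \<Lambda>)"
    using i d st by (simp add: antipode_mult entry_mult sum_distrib_left sw_sum ac_simps flip: sw_mult_left)
  also have "\<dots> = (\<rho> i (S (S h)) * twist i) $$ (s, t)"
    using st by (subst mat_mult_index[OF rho(1)[OF i] twist_carrier st]) (simp add: twist_def entry_def[of _ "S (S h)"])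
  finally show "(\<rho> i (S (S h)) * twist i) $$ (s, t) = (twist i * \<rho> i h) $$ (s, t)" ..
qed (use twist_carrier[of i] rho(1)[OF i, of h] rho(1)[OF i, of "S (S h)"] in auto)

text \<open>
  The matrix intertwines \<open>\<rho> i\<close> with its twist by the automorphism \<open>S\<^sup>2\<close>, which is again irreducible.
\<close>

lemma twist_inverse_exists:
  assumes i: "i \<in> I"
  shows "\<exists>Y. Y \<in> carrier_mat (deg i) (deg i) \<and> twist i * Y = 1\<^sub>m (deg i) \<and> Y * twist i = 1\<^sub>m (deg i)"
proof -
  have SSm: "S (S (x * y)) = S (S x) * S (S y)" for x y by (simp add: antipode_mult)
  have "irreducible_rep scale (deg i) (\<lambda>h. \<rho> i (S (S h)))"
    unfolding irreducible_rep_def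
  proof (intro conjI allI impI)
    show "matrix_rep scale (deg i) (\<lambda>h. \<rho> i (S (S h)))"
      unfolding matrix_rep_def SSm antipode_one hopf_linear
      using rho(1-5)[OF i] by blast
    show "deg i > 0" by (rule rho(6)[OF i])
    fix Y assume Y: "invariant_subspace (deg i) (\<lambda>h. \<rho> i (S (S h))) Y"
    have "\<exists>h. S (S h) = a" for a using antipode_surj by metis
    then have "invariant_subspace (deg i) (\<rho> i) Y"
      using Y unfolding invariant_subspace_def by metis
    then show "Y = {0\<^sub>v (deg i)} \<or> Y = carrier_vec (deg i)" by (rule rho(7)[OF i])
  qed
  moreover have "twist i \<noteq> 0\<^sub>m (deg i) (deg i)"
    using twist_trace[OF i] by (auto simp: mat_trace_def)
  ultimately show ?thesis
    using schur_invertible[OF _ irr[OF i] twist_carrier twist_intertwines[OF i]] by metis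
qed

definition untwist :: "'i \<Rightarrow> 'k mat" where
  "untwist i = (SOME Y. Y \<in> carrier_mat (deg i) (deg i) \<and> twist i * Y = 1\<^sub>m (deg i) \<and> Y * twist i = 1\<^sub>m (deg i))"

lemma untwist:
  assumes "i \<in> I"
  shows "untwist i \<in> carrier_mat (deg i) (deg i)" "twist i * untwist i = 1\<^sub>m (deg i)" "untwist i * twist i = 1\<^sub>m (deg i)"
  using someI_ex[OF twist_inverse_exists[OF assms]] unfolding untwist_def by auto

text \<open>
  The element that acts as an elementary matrix in the block \<open>i\<close> and as zero in all others. The
  orthogonality relations dictate the coefficients; the inverse of the twist normalises them.
\<close>

definition matrix_unit :: "'i \<Rightarrow> nat \<Rightarrow> nat \<Rightarrow> 'h" where
  "matrix_unit i p q = sw (\<lambda>a b. scale (\<Sum>s<deg i. untwist i $$ (q, s) * entry i (S b) s p) a) \<Lambda>"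

lemma entry_matrix_unit:
  assumes ij: "i \<in> I" "j \<in> I" and b: "p < deg i" "q < deg i" "t < deg j" "r < deg j"
  shows "entry j (matrix_unit i p q) t r = (if i = j \<and> t = p \<and> r = q then 1 else 0)"
proof -
  have "entry j (matrix_unit i p q) t r = sw (\<lambda>a b. entry j (scale (\<Sum>s<deg i. untwist i $$ (q, s) * entry i (S b) s p) a) t r) \<Lambda>"
    unfolding matrix_unit_def by (rule sw_additive_hom[OF entry_functional[OF ij(2) b(3,4)]])
  also have "\<dots> = (\<Sum>s<deg i. untwist i $$ (q, s) * sw (\<lambda>a b. entry j a t r * entry i (S b) s p) \<Lambda>)"
    using ij b by (simp add: entry_scale sum_distrib_right sum_distrib_left sw_sum ac_simps flip: sw_mult_left)
  also have "\<dots> = (\<Sum>s<deg i. untwist i $$ (q, s) * (if j = i \<and> t = p then twist j $$ (s, r) else 0))"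
    using ij b by (intro sum.cong refl) (simp add: schur_orthogonality)
  also have "\<dots> = (if i = j \<and> t = p \<and> r = q then 1 else 0)"
  proof (cases "i = j \<and> t = p")
    case True
    then have "(\<Sum>s<deg i. untwist i $$ (q, s) * twist j $$ (s, r)) = (untwist i * twist i) $$ (q, r)"
      using b by (subst mat_mult_index[OF untwist(1)[OF ij(1)] twist_carrier]) auto
    then show ?thesis using True b ij untwist(3)[OF ij(2)] by simp
  qed auto
  finally show ?thesis .
qed

text \<open>
  The matrix units of different blocks are linearly independent.
\<close>

lemma finite_irreps: "finite I"
proof -
  have inj: "inj_on (\<lambda>i. matrix_unit i 0 0) I"
    using entry_matrix_unit rho(6) by (intro inj_onI) (metis zero_neq_one)
  have "independent ((\<lambda>i. matrix_unit i 0 0) ` I)"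
  proof
    assume "dependent ((\<lambda>i. matrix_unit i 0 0) ` I)"
    then obtain T u v where T: "finite T" "T \<subseteq> (\<lambda>i. matrix_unit i 0 0) ` I" "(\<Sum>v\<in>T. scale (u v) v) = 0" "v \<in> T" "u v \<noteq> 0"
      unfolding dependent_explicit by blast
    then obtain j where j: "j \<in> I" "v = matrix_unit j 0 0" by blast
    note d = rho(6)[OF j(1)]
    have "0 = entry j (\<Sum>v\<in>T. scale (u v) v) 0 0" using entry_zero[OF j(1) d d] T(3) by simp
    also have "\<dots> = (\<Sum>w\<in>T. u w * entry j w 0 0)"
      by (simp add: functional_sum[OF entry_functional[OF j(1) d d]] entry_scale[OF j(1) d d])
    also have "\<dots> = (\<Sum>w\<in>T. if w = v then u v else 0)"
    proof (intro sum.cong refl)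
      fix w assume "w \<in> T"
      then obtain i where i: "i \<in> I" "w = matrix_unit i 0 0" using T(2) by blast
      have "w = v \<longleftrightarrow> i = j" using inj i j by (auto simp: inj_on_def)
      then show "u w * entry j w 0 0 = (if w = v then u v else 0)"
        using entry_matrix_unit[OF i(1) j(1), of 0 0 0 0] rho(6)[OF i(1)] d i(2) by auto
    qed
    also have "\<dots> = u v" using T by simp
    finally show False using T(5) by simp
  qed
  then have "finite ((\<lambda>i. matrix_unit i 0 0) ` I)" by (rule finiteI_independent)
  then show ?thesis using inj by (rule finite_imageD)
qed

lemma wedderburn_expand: "x = (\<Sum>i\<in>I. \<Sum>p<deg i. \<Sum>q<deg i. scale (entry i x p q) (matrix_unit i p q))"
proof (rule entries_separate)
  fix j t r assume j: "j \<in> I" and tr: "t < deg j" "r < deg j"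
  have "entry j (\<Sum>i\<in>I. \<Sum>p<deg i. \<Sum>q<deg i. scale (entry i x p q) (matrix_unit i p q)) t r
      = (\<Sum>i\<in>I. \<Sum>p<deg i. \<Sum>q<deg i. entry i x p q * entry j (matrix_unit i p q) t r)"
    using entry_scale[OF j tr] by (simp add: functional_sum[OF entry_functional[OF j tr]])
  also have "\<dots> = (\<Sum>i\<in>I. if i = j then entry j x t r else 0)"
  proof (intro sum.cong refl)
    fix i assume i: "i \<in> I"
    have "(\<Sum>p<deg i. \<Sum>q<deg i. entry i x p q * entry j (matrix_unit i p q) t r)
        = (\<Sum>p<deg i. \<Sum>q<deg i. if i = j \<and> p = t \<and> q = r then entry i x p q else 0)"
      using entry_matrix_unit[OF i j _ _ tr] by (intro sum.cong refl) auto
    also have "\<dots> = (\<Sum>p<deg i. if i = j \<and> p = t then entry i x p r else 0)"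
      using tr by (intro sum.cong refl) (auto simp: if_distrib sum.delta)
    also have "\<dots> = (if i = j then entry j x t r else 0)" using tr by auto
    finally show "(\<Sum>p<deg i. \<Sum>q<deg i. entry i x p q * entry j (matrix_unit i p q) t r) = (if i = j then entry j x t r else 0)" .
  qed
  also have "\<dots> = entry j x t r" using j finite_irreps by simp
  finally show "entry j x t r = entry j (\<Sum>i\<in>I. \<Sum>p<deg i. \<Sum>q<deg i. scale (entry i x p q) (matrix_unit i p q)) t r" ..
qed

lemma Tr_wedderburn:
  assumes f: "linear_map f"
  shows "Tr f = (\<Sum>i\<in>I. \<Sum>p<deg i. \<Sum>q<deg i. entry i (f (matrix_unit i p q)) p q)"
proof -
  have "f x = (\<Sum>i\<in>I. \<Sum>p<deg i. \<Sum>q<deg i. scale (entry i x p q) (f (matrix_unit i p q)))" for x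
    using f by (subst wedderburn_expand[of x]) (simp add: linear_map_sum, simp add: linear_map_def)
  then have "Tr f = Tr (\<lambda>x. \<Sum>i\<in>I. \<Sum>p<deg i. \<Sum>q<deg i. scale (entry i x p q) (f (matrix_unit i p q)))"
    by (intro arg_cong[of _ _ Tr] ext)
  also have "\<dots> = (\<Sum>i\<in>I. \<Sum>p<deg i. \<Sum>q<deg i. entry i (f (matrix_unit i p q)) p q)"
    by (simp add: Tr_sum Tr_rank_one[OF entry_functional])
  finally show ?thesis .
qed

lemma rho_antipode2:
  assumes i: "i \<in> I" shows "\<rho> i (S (S h)) = twist i * \<rho> i h * untwist i"
proof -
  have "\<rho> i (S (S h)) * (twist i * untwist i) = twist i * \<rho> i h * untwist i"
    using twist_intertwines[OF i, of h] assoc_mult_mat[OF rho(1)[OF i] twist_carrier untwist(1)[OF i]] by metis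
  then show ?thesis using right_mult_one_mat[OF rho(1)[OF i]] by (simp add: untwist(2)[OF i])
qed

lemma mult_matrix_unit_entry:
  assumes i: "i \<in> I" and pq: "p < deg i" "q < deg i"
    and A: "A \<in> carrier_mat (deg i) (deg i)" and C: "C \<in> carrier_mat (deg i) (deg i)"
  shows "(A * \<rho> i (matrix_unit i p q) * C) $$ (p, q) = A $$ (p, p) * C $$ (q, q)"
proof -
  have 1: "(A * \<rho> i (matrix_unit i p q)) $$ (p, r) = (if r = q then A $$ (p, p) else 0)" if r: "r < deg i" for r
  proof -
    have "(A * \<rho> i (matrix_unit i p q)) $$ (p, r) = (\<Sum>t<deg i. A $$ (p, t) * entry i (matrix_unit i p q) t r)"
      using pq r by (subst mat_mult_index[OF A rho(1)[OF i]]) (simp_all add: entry_def)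
    also have "\<dots> = (\<Sum>t<deg i. if t = p then (if r = q then A $$ (p, p) else 0) else 0)"
      using pq r by (intro sum.cong refl) (auto simp: entry_matrix_unit[OF i i])
    finally show ?thesis using pq by simp
  qed
  have "(A * \<rho> i (matrix_unit i p q) * C) $$ (p, q) = (\<Sum>r<deg i. (A * \<rho> i (matrix_unit i p q)) $$ (p, r) * C $$ (r, q))"
    using mult_carrier_mat[OF A rho(1)[OF i]] C pq by (rule mat_mult_index)
  also have "\<dots> = (\<Sum>r<deg i. if r = q then A $$ (p, p) * C $$ (q, q) else 0)"
    by (intro sum.cong refl) (auto simp: 1)
  finally show ?thesis using pq by simp
qed

text \<open>
  On the block \<open>i\<close> the map \<open>y \<mapsto> x S\<^sup>2(y)\<close> multiplies by \<open>\<rho> i x * twist i\<close> on the left and by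
  \<open>untwist i\<close> on the right, so its trace is a product of two traces.
\<close>

lemma rint_wedderburn: "rint x = (\<Sum>i\<in>I. mat_trace (untwist i) * mat_trace (\<rho> i x * twist i))"
proof -
  have "rint x = (\<Sum>i\<in>I. \<Sum>p<deg i. \<Sum>q<deg i. entry i (x * S (S (matrix_unit i p q))) p q)"
    unfolding rint_def by (rule Tr_wedderburn) (simp add: linear_map_def entry_simps)
  also have "\<dots> = (\<Sum>i\<in>I. \<Sum>p<deg i. \<Sum>q<deg i. (\<rho> i x * twist i) $$ (p, p) * untwist i $$ (q, q))"
  proof (intro sum.cong refl)
    fix i p q assume i: "i \<in> I" and pq: "p \<in> {..<deg i}" "q \<in> {..<deg i}"
    note c = rho(1)[OF i] twist_carrier[of i] untwist(1)[OF i] mult_carrier_mat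
    have "\<rho> i x * (twist i * \<rho> i (matrix_unit i p q) * untwist i) = \<rho> i x * twist i * \<rho> i (matrix_unit i p q) * untwist i"
      using assoc_mult_mat[OF c(1) c(2) c(1)] assoc_mult_mat[OF c(1) c(4)[OF c(2) c(1)] c(3)] by metis
    then show "entry i (x * S (S (matrix_unit i p q))) p q = (\<rho> i x * twist i) $$ (p, p) * untwist i $$ (q, q)"
      using pq by (simp add: entry_def rho(4)[OF i] rho_antipode2[OF i] mult_matrix_unit_entry[OF i _ _ c(4)[OF c(1,2)] c(3)])
  qed
  also have "\<dots> = (\<Sum>i\<in>I. mat_trace (untwist i) * mat_trace (\<rho> i x * twist i))"
  proof (intro sum.cong refl)
    fix i assume i: "i \<in> I"
    have "(\<Sum>p<deg i. \<Sum>q<deg i. (\<rho> i x * twist i) $$ (p, p) * untwist i $$ (q, q)) = mat_trace (\<rho> i x * twist i) * mat_trace (untwist i)"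
      using carrier_matD[OF rho(1)[OF i, of x]] carrier_matD[OF untwist(1)[OF i]]
      by (simp add: mat_trace_def sum_product)
    then show "(\<Sum>p<deg i. \<Sum>q<deg i. (\<rho> i x * twist i) $$ (p, p) * untwist i $$ (q, q)) = mat_trace (untwist i) * mat_trace (\<rho> i x * twist i)"
      by (simp only: mult.commute)
  qed
  finally show ?thesis .
qed

lemma lint_wedderburn: "lint x = (\<Sum>i\<in>I. mat_trace (untwist i * \<rho> i x))"
proof -
  have "lint x = (\<Sum>i\<in>I. \<Sum>p<deg i. \<Sum>q<deg i. entry i (S (S (matrix_unit i p q)) * x) p q)"
    unfolding lint_eq_Tr by (rule Tr_wedderburn) (simp add: linear_map_def entry_simps)
  also have "\<dots> = (\<Sum>i\<in>I. \<Sum>p<deg i. \<Sum>q<deg i. twist i $$ (p, p) * (untwist i * \<rho> i x) $$ (q, q))"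
  proof (intro sum.cong refl)
    fix i p q assume i: "i \<in> I" and pq: "p \<in> {..<deg i}" "q \<in> {..<deg i}"
    note c = rho(1)[OF i] twist_carrier[of i] untwist(1)[OF i] mult_carrier_mat
    have "twist i * \<rho> i (matrix_unit i p q) * untwist i * \<rho> i x = twist i * \<rho> i (matrix_unit i p q) * (untwist i * \<rho> i x)"
      by (rule assoc_mult_mat[OF c(4)[OF c(2,1)] c(3) c(1)])
    then show "entry i (S (S (matrix_unit i p q)) * x) p q = twist i $$ (p, p) * (untwist i * \<rho> i x) $$ (q, q)"
      using pq by (simp add: entry_def rho(4)[OF i] rho_antipode2[OF i] mult_matrix_unit_entry[OF i _ _ c(2) c(4)[OF c(3,1)]])
  qed
  also have "\<dots> = (\<Sum>i\<in>I. mat_trace (untwist i * \<rho> i x))"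
  proof (intro sum.cong refl)
    fix i assume i: "i \<in> I"
    have "(\<Sum>p<deg i. \<Sum>q<deg i. twist i $$ (p, p) * (untwist i * \<rho> i x) $$ (q, q)) = mat_trace (twist i) * mat_trace (untwist i * \<rho> i x)"
      using carrier_matD[OF twist_carrier[of i]] carrier_matD[OF untwist(1)[OF i]]
      by (simp add: mat_trace_def sum_product)
    then show "(\<Sum>p<deg i. \<Sum>q<deg i. twist i $$ (p, p) * (untwist i * \<rho> i x) $$ (q, q)) = mat_trace (untwist i * \<rho> i x)"
      by (simp add: twist_trace[OF i])
  qed
  finally show ?thesis .
qed

section \<open>The trace of the squared antipode\<close>

text \<open>
  Compare the two block formulas for \<open>rint x = lint (S gr * x)\<close> at the matrix units.
\<close>

lemma rho_antipode_gr:
  assumes i: "i \<in> I"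
  shows "\<rho> i (S gr) = mat_trace (untwist i) \<cdot>\<^sub>m (twist i * twist i)"
proof -
  note c = rho(1)[OF i] twist_carrier[of i] untwist(1)[OF i] mult_carrier_mat
  have E: "mat_trace (M * \<rho> j (matrix_unit i p q)) = (if j = i then M $$ (q, p) else 0)"
    if j: "j \<in> I" and pq: "p < deg i" "q < deg i" and M: "M \<in> carrier_mat (deg j) (deg j)" for M j p q
  proof -
    have "mat_trace (M * \<rho> j (matrix_unit i p q)) = (\<Sum>s<deg j. \<Sum>t<deg j. M $$ (s, t) * entry j (matrix_unit i p q) t s)"
      using M mat_mult_index[OF M rho(1)[OF j]] carrier_matD[OF M]
      by (auto simp: mat_trace_def entry_def intro!: sum.cong)
    also have "\<dots> = (\<Sum>s<deg j. \<Sum>t<deg j. if t = p then (if i = j \<and> s = q then M $$ (q, p) else 0) else 0)"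
      using pq by (intro sum.cong refl) (auto simp: entry_matrix_unit[OF i j])
    also have "\<dots> = (\<Sum>s<deg j. if s = q then (if i = j then M $$ (q, p) else 0) else 0)"
      using pq by (intro sum.cong refl) auto
    also have "\<dots> = (if j = i then M $$ (q, p) else 0)" using pq by auto
    finally show ?thesis .
  qed
  have eq: "mat_trace (untwist i) * twist i $$ (q, p) = (untwist i * \<rho> i (S gr)) $$ (q, p)" if pq: "p < deg i" "q < deg i" for p q
  proof -
    have "rint (matrix_unit i p q) = (\<Sum>j\<in>I. if j = i then mat_trace (untwist i) * twist i $$ (q, p) else 0)"
      unfolding rint_wedderburn
    proof (intro sum.cong refl)
      fix j assume j: "j \<in> I"
      show "mat_trace (untwist j) * mat_trace (\<rho> j (matrix_unit i p q) * twist j) = (if j = i then mat_trace (untwist i) * twist i $$ (q, p) else 0)"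
        using mat_trace_commute[OF rho(1)[OF j] twist_carrier] E[OF j pq twist_carrier] by auto
    qed
    moreover have "lint (S gr * matrix_unit i p q) = (\<Sum>j\<in>I. if j = i then (untwist i * \<rho> i (S gr)) $$ (q, p) else 0)"
      unfolding lint_wedderburn
    proof (intro sum.cong refl)
      fix j assume j: "j \<in> I"
      have "untwist j * (\<rho> j (S gr) * \<rho> j (matrix_unit i p q)) = untwist j * \<rho> j (S gr) * \<rho> j (matrix_unit i p q)"
        by (rule assoc_mult_mat[OF untwist(1)[OF j] rho(1)[OF j] rho(1)[OF j], symmetric])
      then show "mat_trace (untwist j * \<rho> j (S gr * matrix_unit i p q)) = (if j = i then (untwist i * \<rho> i (S gr)) $$ (q, p) else 0)"
        using E[OF j pq mult_carrier_mat[OF untwist(1)[OF j] rho(1)[OF j]]] by (simp add: rho(4)[OF j])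
    qed
    ultimately show ?thesis using rint_eq_lint_gr[of "matrix_unit i p q"] i finite_irreps by simp
  qed
  have "mat_trace (untwist i) \<cdot>\<^sub>m twist i = untwist i * \<rho> i (S gr)"
  proof (rule eq_matI)
    fix s t assume "s < dim_row (untwist i * \<rho> i (S gr))" "t < dim_col (untwist i * \<rho> i (S gr))"
    then have st: "s < deg i" "t < deg i" using carrier_matD[OF c(4)[OF c(3,1)]] by auto
    then show "(mat_trace (untwist i) \<cdot>\<^sub>m twist i) $$ (s, t) = (untwist i * \<rho> i (S gr)) $$ (s, t)"
      using eq[OF st(2,1)] carrier_matD[OF c(2)] by simp
  qed (use carrier_matD[OF c(2)] carrier_matD[OF c(4)[OF c(3,1)]] in simp_all)
  then have "twist i * (untwist i * \<rho> i (S gr)) = mat_trace (untwist i) \<cdot>\<^sub>m (twist i * twist i)"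
    using mult_smult_distrib[OF c(2) c(2)] by metis
  then show ?thesis
    using assoc_mult_mat[OF c(2) c(3) c(1), of "S gr"] untwist(2)[OF i] left_mult_one_mat[OF c(1)] by metis
qed

lemma rho_antipode_gr_power:
  assumes i: "i \<in> I"
  shows "\<rho> i (S gr ^ n) * twist i = mat_trace (untwist i) ^ n \<cdot>\<^sub>m (twist i ^\<^sub>m (2 * n + 1))"
proof (induction n)
  case 0
  have "1 \<cdot>\<^sub>m twist i = twist i" using twist_carrier[of i] by (intro eq_matI) auto
  then show ?case using rho(5)[OF i] twist_carrier[of i] by simp
next
  case (Suc n)
  let ?q = "mat_trace (untwist i)"
  note c = rho(1)[OF i] twist_carrier[of i] mult_carrier_mat pow_carrier_mat[OF twist_carrier[of i]]
  have "\<rho> i (S gr ^ Suc n) * twist i = \<rho> i (S gr) * (\<rho> i (S gr ^ n) * twist i)"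
    using assoc_mult_mat[OF c(1) c(1) c(2)] by (simp add: rho(4)[OF i])
  also have "\<dots> = (?q \<cdot>\<^sub>m (twist i * twist i)) * (?q ^ n \<cdot>\<^sub>m (twist i ^\<^sub>m (2 * n + 1)))"
    by (simp only: Suc rho_antipode_gr[OF i])
  also have "\<dots> = (?q ^ n * ?q) \<cdot>\<^sub>m (twist i * twist i * twist i ^\<^sub>m (2 * n + 1))"
    using mult_smult_distrib[OF _ c(4)[of "2 * n + 1"], of "?q \<cdot>\<^sub>m (twist i * twist i)" "deg i" "?q ^ n"]
      mult_smult_assoc_mat[OF c(3)[OF c(2,2)] c(4)[of "2 * n + 1"], of ?q] c(3)[OF c(2,2)]
    by (simp add: smult_smult_mat)
  also have "twist i * twist i * twist i ^\<^sub>m (2 * n + 1) = twist i ^\<^sub>m (2 * Suc n + 1)"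
  proof -
    have "twist i * twist i * twist i ^\<^sub>m k = twist i ^\<^sub>m (k + 2)" for k
    proof -
      have "twist i * twist i * twist i ^\<^sub>m k = twist i * (twist i * twist i ^\<^sub>m k)" by (rule assoc_mult_mat[OF c(2,2,4)])
      also have "twist i * twist i ^\<^sub>m k = twist i ^\<^sub>m Suc k" using pow_mat_commutes[OF c(2)] by simp
      also have "twist i * twist i ^\<^sub>m Suc k = twist i ^\<^sub>m Suc (Suc k)" using pow_mat_commutes[OF c(2), of "Suc k"] by simp
      finally show ?thesis by simp
    qed
    from this[of "2 * n + 1"] show ?thesis by simp
  qed
  finally show ?case by (simp add: mult.commute)
qed

text \<open>
  Write \<open>W\<^sub>i\<close> for the twist, \<open>q\<^sub>i\<close> for the trace of its inverse, and choose \<open>f\<^sub>i\<close> with \<open>f\<^sub>i\<^sup>2 = q\<^sub>i\<close>. Then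
  \<open>f\<^sub>i W\<^sub>i\<close> has trace \<open>f\<^sub>i\<close>, and if the trace of \<open>S\<^sup>2\<close> is zero, then the vanishing of \<open>rint\<close> at the
  powers of \<open>S gr\<close> says that \<open>\<Sum>\<^sub>i f\<^sub>i tr((f\<^sub>i W\<^sub>i)\<^sup>2\<^sup>k\<^sup>+\<^sup>1) = 0\<close> for all \<open>k\<close>. By the positivity principle all
  \<open>f\<^sub>i\<close> vanish, hence so does \<open>rint\<close>, contrary to \<open>rint \<Lambda> = 1\<close>.
\<close>

lemma trace_antipode2_nonzero: "rint 1 \<noteq> 0"
proof
  assume D: "rint 1 = 0"
  have "\<exists>f. f ^ 2 = mat_trace (untwist i)" for i
    by (rule nth_root_exists) simp
  then obtain f where f: "f i ^ 2 = mat_trace (untwist i)" for i by metis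
  have "\<exists>es. \<forall>m. mat_trace (twist i ^\<^sub>m m) = (\<Sum>e\<leftarrow>es. e ^ m)" for i
    by (rule trace_power_sums[OF twist_carrier])
  then obtain es where es: "mat_trace (twist i ^\<^sub>m m) = (\<Sum>e\<leftarrow>es i. e ^ m)" for i m by metis
  have es1: "sum_list (es i) = 1" if "i \<in> I" for i
    using es[of i 1] twist_trace[OF that] twist_carrier[of i] by simp
  have sc: "(\<Sum>e\<leftarrow>map ((*) c) xs. e ^ m) = c ^ m * (\<Sum>e\<leftarrow>xs. e ^ m)" for c :: 'k and xs m
    by (induction xs) (simp_all add: algebra_simps power_mult_distrib)
  have f0: "f i = 0" if i: "i \<in> I" for i
  proof -
    have "(\<Sum>e\<leftarrow>map ((*) (f i)) (es i). e) = 0"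
    proof (rule odd_power_sums_orthogonal_imp_zero[OF finite_irreps _ i])
      fix k
      have "(\<Sum>e\<leftarrow>map ((*) (f i)) (es i). e) * (\<Sum>e\<leftarrow>map ((*) (f i)) (es i). e ^ (2 * k + 1))
          = mat_trace (untwist i) * mat_trace (\<rho> i (S gr ^ k) * twist i)" if i: "i \<in> I" for i
      proof -
        have "(\<Sum>e\<leftarrow>map ((*) (f i)) (es i). e) = f i"
          using sc[of 1 "f i" "es i"] es1[OF i] by simp
        moreover have "(\<Sum>e\<leftarrow>map ((*) (f i)) (es i). e ^ (2 * k + 1)) = f i ^ (2 * k + 1) * mat_trace (twist i ^\<^sub>m (2 * k + 1))"
          unfolding sc es ..
        moreover have "mat_trace (\<rho> i (S gr ^ k) * twist i) = (f i ^ 2) ^ k * mat_trace (twist i ^\<^sub>m (2 * k + 1))"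
          unfolding rho_antipode_gr_power[OF i] f by (rule mat_trace_smult[OF pow_carrier_mat[OF twist_carrier]])
        moreover have "f i * (f i ^ (2 * k + 1) * T) = f i ^ 2 * ((f i ^ 2) ^ k * T)" for T
          by (simp add: power_mult power2_eq_square power_mult_distrib ac_simps)
        ultimately show ?thesis by (simp only: f[symmetric])
      qed
      then have "(\<Sum>i\<in>I. (\<Sum>e\<leftarrow>map ((*) (f i)) (es i). e) * (\<Sum>e\<leftarrow>map ((*) (f i)) (es i). e ^ (2 * k + 1))) = rint (S gr ^ k)"
        unfolding rint_wedderburn by (intro sum.cong refl)
      then show "(\<Sum>i\<in>I. (\<Sum>e\<leftarrow>map ((*) (f i)) (es i). e) * (\<Sum>e\<leftarrow>map ((*) (f i)) (es i). e ^ (2 * k + 1))) = 0"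
        using rint_antipode_grouplike_power[OF D] by simp
    qed
    then show ?thesis using sc[of 1 "f i" "es i"] es1[OF i] by simp
  qed
  have "rint \<Lambda> = 0" unfolding rint_wedderburn using f0 by (simp flip: f)
  then show False by (simp add: rint_int)
qed

lemma antipode_involutive: "S (S x) = x"
  by (rule antipode_involutive_if_trace_nonzero[OF trace_antipode2_nonzero])

section \<open>The commutator element\<close>

lemma lint_rint: "lint x = rint x" by (rule lint_eq_rint[OF trace_antipode2_nonzero])

lemma rint_antipode: "rint (S x) = rint x"
  using lint_rint[of x] by (simp add: lint_def)

lemma rint_chi: "rint x = chi x"
  by (simp add: rint_def chi_def antipode_involutive)

lemma rint_commute: "rint (x * y) = rint (y * x)"
  using rint_twist[of x y] by (simp add: antipode_involutive)

lemma twist_scalar: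
  assumes i: "i \<in> I" and sr: "s < deg i" "r < deg i"
  shows "twist i $$ (s, r) = (if s = r then 1 / of_nat (deg i) else 0)"
proof -
  have "\<rho> i h * twist i = twist i * \<rho> i h" for h
    using twist_intertwines[OF i, of h] by (simp add: antipode_involutive)
  then obtain e where e: "twist i = e \<cdot>\<^sub>m 1\<^sub>m (deg i)"
    using schur_scalar[OF irr[OF i] twist_carrier] by metis
  have "mat_trace (twist i) = e * of_nat (deg i)"
    by (simp add: e mat_trace_def mult.commute)
  then have "e * of_nat (deg i) = 1" using twist_trace[OF i] by simp
  then have "e = 1 / of_nat (deg i)" using rho(6)[OF i] by (simp add: field_simps)
  then show ?thesis using sr by (simp add: e)
qed

lemma antipode_as_sum2: "sw (\<lambda>a b. scale (rint (h * a)) b) \<Lambda> = S h"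
proof -
  have "sw (\<lambda>a b. scale (rint (h * a)) b) \<Lambda> = sw (\<lambda>a b. scale (rint (a * h)) b) \<Lambda>"
    unfolding rint_commute[of h] ..
  also have "\<dots> = sw (\<lambda>a b. scale (rint a) (b * S h)) \<Lambda>"
    by (rule casimir_right) (simp add: rint_simps ac_simps)
  also have "\<dots> = sw (\<lambda>a b. scale (rint a) b) \<Lambda> * S h"
    by (simp flip: sw_mult_right add: rint_simps)
  finally show ?thesis using lint_int_dual by (simp add: lint_rint)
qed

text \<open>
  Both \<open>\<Sum> rint(h \<Lambda>\<^sub>2) \<Lambda>\<^sub>1\<close> and \<open>\<Sum> rint(h \<Lambda>\<^sub>1) \<Lambda>\<^sub>2\<close> equal \<open>S h\<close>. Since every coordinate functional has the
  form \<open>rint (h _)\<close>, this determines \<open>\<Delta> \<Lambda>\<close> and shows it to be symmetric.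
\<close>

lemma integral_cocommutative:
  fixes F :: "'h \<Rightarrow> 'h \<Rightarrow> 'h"
  assumes add1: "\<And>a a' b. F (a + a') b = F a b + F a' b" and add2: "\<And>a b b'. F a (b + b') = F a b + F a b'"
    and scale1: "\<And>c a b. F (scale c a) b = scale c (F a b)" and scale2: "\<And>c a b. F a (scale c b) = scale c (F a b)"
  shows "sw F \<Lambda> = sw (\<lambda>a b. F b a) \<Lambda>"
proof -
  define k where "k c = sw (\<lambda>a b. scale (coord c a) (S b)) \<Lambda>" for c
  have coord_k: "coord c v = rint (k c * v)" for c v
  proof -
    have "coord c v = coord c (sw (\<lambda>a b. scale (lint (S b * v)) a) \<Lambda>)" by (simp add: dual_basis)
    also have "\<dots> = sw (\<lambda>a b. rint (scale (coord c a) (S b) * v)) \<Lambda>"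
      by (simp add: sw_additive_hom[OF functional_coord] coord_scale lint_rint rint_simps ac_simps)
    also have "\<dots> = rint (k c * v)"
      unfolding k_def by (rule sw_hom[symmetric]) (simp add: rint_simps)
    finally show ?thesis .
  qed
  have lin1: "linear_map (\<lambda>u. F u c)" and lin2: "linear_map (F u)" for c u
    using assms by (simp_all add: linear_map_def)
  have exp: "F u v = (\<Sum>c\<in>B. F (scale (rint (k c * v)) u) c)" for u v
    using linear_map_expand[OF lin2, of u v] by (simp add: coord_k scale1)
  have exp1: "F = (\<lambda>u v. \<Sum>c\<in>B. F (scale (rint (k c * v)) u) c)"
    and exp2: "(\<lambda>v u. F u v) = (\<lambda>v u. \<Sum>c\<in>B. F (scale (rint (k c * v)) u) c)"
    by (intro ext, rule exp)+
  have "sw F \<Lambda> = sw (\<lambda>u v. \<Sum>c\<in>B. F (scale (rint (k c * v)) u) c) \<Lambda>"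
    by (rule arg_cong[OF exp1])
  also have "\<dots> = (\<Sum>c\<in>B. F (sw (\<lambda>u v. scale (rint (k c * v)) u) \<Lambda>) c)"
    by (simp add: sw_sum sw_hom[where f = "\<lambda>u. F u _", OF add1])
  also have "\<dots> = (\<Sum>c\<in>B. F (sw (\<lambda>v u. scale (rint (k c * v)) u) \<Lambda>) c)"
    by (simp only: antipode_as_sum antipode_as_sum2)
  also have "\<dots> = sw (\<lambda>a b. F b a) \<Lambda>"
    by (subst exp2) (simp add: sw_sum sw_hom[where f = "\<lambda>u. F u _", OF add1])
  finally show ?thesis .
qed

text \<open>
  The projection onto the centre, as an average over the adjoint action.
\<close>

definition center_proj :: "'h \<Rightarrow> 'h" where "center_proj x = sw (\<lambda>a b. a * x * S b) \<Lambda>"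

lemma linear_map_center_proj: "linear_map center_proj"
  by (simp add: center_proj_def[abs_def] linear_map_def rint_simps)

lemma antipode_center_proj: "S (center_proj (S x)) = center_proj x"
proof -
  have "S (center_proj (S x)) = sw (\<lambda>a b. b * x * S a) \<Lambda>"
    unfolding center_proj_def
    by (subst sw_hom[of S]) (simp_all add: rint_simps antipode_mult antipode_involutive)
  also have "\<dots> = center_proj x"
    unfolding center_proj_def by (rule integral_cocommutative[symmetric]) (simp_all add: rint_simps)
  finally show ?thesis .
qed

lemma entry_center_proj_matrix_unit:
  assumes i: "i \<in> I" and b: "p < deg i" "q < deg i" "t < deg i" "r < deg i"
  shows "entry i (center_proj (matrix_unit i p q)) t r = (if t = r \<and> p = q then 1 / of_nat (deg i) else 0)"
proof -
  have "entry i (center_proj (matrix_unit i p q)) t r = sw (\<lambda>a b. entry i (a * matrix_unit i p q * S b) t r) \<Lambda>"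
    unfolding center_proj_def by (rule sw_additive_hom[OF entry_functional[OF i b(3,4)]])
  also have "\<dots> = sw (\<lambda>a b. entry i a t p * entry i (S b) q r) \<Lambda>"
  proof -
    have "entry i (a * matrix_unit i p q * y) t r = entry i a t p * entry i y q r" for a y
    proof -
      have "entry i (a * matrix_unit i p q) t v = (if v = q then entry i a t p else 0)" if "v < deg i" for v
      proof -
        have "entry i (a * matrix_unit i p q) t v = (\<Sum>w<deg i. if w = p then (if v = q then entry i a t p else 0) else 0)"
          by (subst entry_mult[OF i b(3) that], intro sum.cong refl) (auto simp: entry_matrix_unit[OF i i b(1,2)] that)
        then show ?thesis using b by simp
      qed
      then have "entry i (a * matrix_unit i p q * y) t r = (\<Sum>v<deg i. if v = q then entry i a t p * entry i y q r else 0)"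
        by (subst entry_mult[OF i b(3,4)], intro sum.cong refl) auto
      then show ?thesis using b by simp
    qed
    then show ?thesis by simp
  qed
  also have "\<dots> = (if t = r \<and> p = q then 1 / of_nat (deg i) else 0)"
    using schur_orthogonality[OF i i b(3,1,2,4)] twist_scalar[OF i b(2,1)] by auto
  finally show ?thesis .
qed

lemma Tr_center_proj: "Tr (\<lambda>x. center_proj x * a) = (\<Sum>i\<in>I. character (\<rho> i) a / of_nat (deg i))"
proof -
  have "Tr (\<lambda>x. center_proj x * a) = (\<Sum>i\<in>I. \<Sum>p<deg i. \<Sum>q<deg i. entry i (center_proj (matrix_unit i p q) * a) p q)"
    using linear_map_center_proj by (intro Tr_wedderburn) (simp add: linear_map_def rint_simps)
  also have "\<dots> = (\<Sum>i\<in>I. character (\<rho> i) a / of_nat (deg i))"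
  proof (intro sum.cong refl)
    fix i assume i: "i \<in> I"
    have "entry i (center_proj (matrix_unit i p q) * a) p q = (if q = p then entry i a p p / of_nat (deg i) else 0)"
      if "p < deg i" "q < deg i" for p q
    proof -
      have "entry i (center_proj (matrix_unit i p q) * a) p q = (\<Sum>t<deg i. if t = p then (if q = p then entry i a p p / of_nat (deg i) else 0) else 0)"
        by (subst entry_mult[OF i that], intro sum.cong refl) (auto simp: entry_center_proj_matrix_unit[OF i that that(1)])
      then show ?thesis using that by simp
    qed
    then have "(\<Sum>p<deg i. \<Sum>q<deg i. entry i (center_proj (matrix_unit i p q) * a) p q) = (\<Sum>p<deg i. entry i a p p / of_nat (deg i))"
      by simp
    also have "\<dots> = character (\<rho> i) a / of_nat (deg i)"
      using carrier_matD[OF rho(1)[OF i]] by (simp add: character_def entry_def sum_divide_distrib)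
    finally show "(\<Sum>p<deg i. \<Sum>q<deg i. entry i (center_proj (matrix_unit i p q) * a) p q) = character (\<rho> i) a / of_nat (deg i)" .
  qed
  finally show ?thesis .
qed

lemma z2_eq_center_proj: "z2 \<Delta> S \<Lambda> = sw (\<lambda>a b. center_proj a * S b) \<Lambda>"
proof -
  have "z2 \<Delta> S \<Lambda> = sw (\<lambda>a1 a2. sw (\<lambda>b1 b2. a1 * b1 * S a2 * S b2) \<Lambda>) \<Lambda>"
    unfolding z2_def sw_def ..
  also have "\<dots> = sw (\<lambda>b1 b2. sw (\<lambda>a1 a2. a1 * b1 * S a2 * S b2) \<Lambda>) \<Lambda>"
    by (rule sw_swap)
  finally show ?thesis by (simp only: center_proj_def sw_mult_right)
qed

text \<open>
  Here \<open>z\<^sub>2 = \<Sum> center_proj(\<Lambda>\<^sub>1) S(\<Lambda>\<^sub>2)\<close>, so the dual basis formula recognises the left-hand side as the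
  trace of \<open>x \<mapsto> S(a) center_proj(x)\<close>. Conjugating with the involution \<open>S\<close> moves \<open>a\<close> to the right and
  removes its antipode.
\<close>

lemma chi_z2: "chi (S (z2 \<Delta> S \<Lambda>) * a) = (\<Sum>i\<in>I. character (\<rho> i) a / of_nat (deg i))"
proof -
  have center_proj_linear: "center_proj (x + y) = center_proj x + center_proj y" "center_proj (scale c x) = scale c (center_proj x)" for c x y
    using linear_map_center_proj by (simp_all add: linear_map_def)
  have "chi (S (z2 \<Delta> S \<Lambda>) * a) = rint (S (S (z2 \<Delta> S \<Lambda>) * a))"
    unfolding rint_antipode by (rule rint_chi[symmetric])
  also have "\<dots> = rint (S a * sw (\<lambda>x y. center_proj x * S y) \<Lambda>)"
    by (simp add: antipode_mult antipode_involutive z2_eq_center_proj)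
  also have "\<dots> = sw (\<lambda>x y. rint (S a * (center_proj x * S y))) \<Lambda>"
    by (rule sw_hom) (simp add: rint_simps)
  also have "\<dots> = sw (\<lambda>x y. lint (S y * (S a * center_proj x))) \<Lambda>"
  proof -
    have "rint (S a * (center_proj x * S y)) = lint (S y * (S a * center_proj x))" for x y
      using rint_commute[of "S a * center_proj x" "S y"] by (simp add: lint_rint mult.assoc)
    then show ?thesis by simp
  qed
  also have "\<dots> = Tr (\<lambda>x. S a * center_proj x)"
    by (rule Tr_dual_basis[symmetric]) (simp add: linear_map_def rint_simps center_proj_linear)
  also have "\<dots> = Tr (\<lambda>x. S (S (S a * center_proj x)))"
    by (simp add: antipode_involutive)
  also have "\<dots> = Tr (\<lambda>x. S (S a * center_proj (S x)))"
    by (rule Tr_commute) (simp_all add: linear_map_def rint_simps center_proj_linear)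
  also have "\<dots> = Tr (\<lambda>x. center_proj x * a)"
    by (simp add: antipode_mult antipode_involutive antipode_center_proj)
  finally show ?thesis by (simp add: Tr_center_proj)
qed

end

theorem proposition3p2:
  fixes scale :: "'k::{alg_closed_field, field_char_0} \<Rightarrow> 'h::ring_1 \<Rightarrow> 'h"
    and \<Delta> :: "'h \<Rightarrow> ('h \<times> 'h) list"
    and \<epsilon> :: "'h \<Rightarrow> 'k"
    and S :: "'h \<Rightarrow> 'h"
    and B :: "'h set"
    and d :: nat
    and \<Lambda> :: 'h
    and I :: "'i set"
    and deg :: "'i \<Rightarrow> nat"
    and \<rho> :: "'i \<Rightarrow> 'h \<Rightarrow> 'k mat"
  assumes hopf: "hopf_algebra scale \<Delta> \<epsilon> S"
    and basis: "finite_dimensional_vector_space scale B"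
    and dimension: "vector_space.dim scale (UNIV :: 'h set) = d"
    and semisimple: "semisimple_ring TYPE('h)"
    and integral: "idempotent_integral scale \<epsilon> \<Lambda>"
    and irreps: "complete_irreps scale I deg \<rho>"
  shows "(\<lambda>a. of_nat d * frobenius_map scale B S (z2 \<Delta> S \<Lambda>) a) = f_rob d I deg \<rho>"
proof
  interpret hopf_algebra scale \<Delta> \<epsilon> S by (rule hopf)
  interpret finite_dimensional_vector_space scale B by (rule basis)
  interpret hopf_algebra_irreps scale \<Delta> \<epsilon> S B \<Lambda> I deg \<rho>
    by unfold_locales (fact integral semisimple irreps)+
  fix a
  have "frobenius_map scale B S (z2 \<Delta> S \<Lambda>) a = chi (S (z2 \<Delta> S \<Lambda>) * a)"
    by (simp add: frobenius_map_def right_act_def regular_character_def chi_def)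
  then show "of_nat d * frobenius_map scale B S (z2 \<Delta> S \<Lambda>) a = f_rob d I deg \<rho> a"
    by (simp add: chi_z2 f_rob_def sum_distrib_left)
qed

end
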